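(* Let $R$ be the homogeneous coordinate ring of an irreducible plane projective curve over an algebraically closed field of prime characteristic $p$, and let $I\subseteq R$ be a graded ideal generated by two elements. Then $e_{gHK}(R/I)$ is rational.
   Context: Let $\mathfrak m$ be the irrelevant maximal ideal of $R$. For $q=p^n$, $I^{[q]}=(x^q:x\in I)$; $H^0_{\mathfrak m}(M)$ is the submodule of elements of $M$ annihilated by some power of $\mathfrak m$; $f_{gHK}^{R/I}(n)$ is the length of $H^0_{\mathfrak m}(R/I^{[p^n]})$; and $e_{gHK}(R/I)=\lim_{n\to\infty} f_{gHK}^{R/I}(n)/p^{n\dim R}$ if the limit exists, and $\infty$ otherwise. *)

theory Defs
  imports
    "HOL-Algebra.Algebraic_Closure_Type"
    "HOL-Algebra.Ideal_Product"
    "HOL-Algebra.QuotRing"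
    "HOL-Algebra.Module"
    "HOL-Library.Poly_Mapping"
    "HOL-Library.Numeral_Type"
    "HOL-Library.Extended_Real"
begin

section \<open>Dimension and length\<close>

definition krull_dim :: "('a, 'm) ring_scheme \<Rightarrow> enat" where
  "krull_dim R = Sup {enat n | n P. (\<forall>i\<le>n. primeideal (P i) R) \<and>
                                    (\<forall>i<n. P i \<subset> P (Suc i))}"

definition module_length :: "('a, 'm) ring_scheme \<Rightarrow> ('a, 'b, 'n) module_scheme \<Rightarrow> enat" where
  "module_length R M = Sup {enat n | n N. (\<forall>i\<le>n. submodule (N i) R M) \<and>
                                          (\<forall>i<n. N i \<subset> N (Suc i))}"

text \<open>The cyclic module \<open>R/J\<close>, with \<open>r\<close> acting as multiplication by the class of \<open>r\<close>.\<close>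

definition quot_module :: "('a, 'm) ring_scheme \<Rightarrow> 'a set \<Rightarrow> ('a, 'a set) module" where
  "quot_module R J =
     \<lparr>carrier = carrier (R Quot J), monoid.mult = (\<otimes>\<^bsub>R Quot J\<^esub>), one = \<one>\<^bsub>R Quot J\<^esub>,
      ring.zero = \<zero>\<^bsub>R Quot J\<^esub>, add = (\<oplus>\<^bsub>R Quot J\<^esub>),
      module.smult = (\<lambda>r x. (J +>\<^bsub>R\<^esub> r) \<otimes>\<^bsub>R Quot J\<^esub> x)\<rparr>"


section \<open>Generalized Hilbert-Kunz function and multiplicity\<close>

text \<open>Powers of the ideal \<open>m\<close> are its powers in the monoid of ideals \<^const>\<open>ideals_set\<close>
  under the ideal product.\<close>

definition H0 :: "('a, 'm) ring_scheme \<Rightarrow> 'a set \<Rightarrow> ('a, 'b, 'n) module_scheme \<Rightarrow> 'b set" where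
  "H0 R m M = {x \<in> carrier M. \<exists>t::nat. \<forall>a \<in> m [^]\<^bsub>ideals_set R\<^esub> t. a \<odot>\<^bsub>M\<^esub> x = \<zero>\<^bsub>M\<^esub>}"

definition frobenius_power :: "('a, 'm) ring_scheme \<Rightarrow> 'a set \<Rightarrow> nat \<Rightarrow> 'a set" where
  "frobenius_power R I q = Idl\<^bsub>R\<^esub> ((\<lambda>x. x [^]\<^bsub>R\<^esub> q) ` I)"

definition f_gHK :: "('a, 'm) ring_scheme \<Rightarrow> 'a set \<Rightarrow> nat \<Rightarrow> 'a set \<Rightarrow> nat \<Rightarrow> enat" where
  "f_gHK R m p I n =
     (let M = quot_module R (frobenius_power R I (p ^ n))
      in module_length R (M\<lparr>carrier := H0 R m M\<rparr>))"

text \<open>Limits are taken in the extended reals; a sequence that tends to infinity gets the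
  same value as one without a limit. The dimension of \<open>R\<close> is supposed to be finite.\<close>

definition e_gHK :: "('a, 'm) ring_scheme \<Rightarrow> 'a set \<Rightarrow> nat \<Rightarrow> 'a set \<Rightarrow> ereal" where
  "e_gHK R m p I =
     (let s = (\<lambda>n. ereal_of_enat (f_gHK R m p I n) / ereal (real p ^ (n * the_enat (krull_dim R))))
      in if convergent s then lim s else \<infinity>)"


section \<open>Graded ideals\<close>

text \<open>A grading of \<open>R\<close> is given by its family \<open>A\<close> of homogeneous parts \<open>A d\<close>.\<close>

definition graded_ideal :: "('a, 'm) ring_scheme \<Rightarrow> (nat \<Rightarrow> 'a set) \<Rightarrow> 'a set \<Rightarrow> bool" where
  "graded_ideal R A I \<longleftrightarrow> ideal I R \<and> I = Idl\<^bsub>R\<^esub> (I \<inter> (\<Union>d. A d))"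

definition irrelevant_ideal :: "('a, 'm) ring_scheme \<Rightarrow> (nat \<Rightarrow> 'a set) \<Rightarrow> 'a set" where
  "irrelevant_ideal R A = Idl\<^bsub>R\<^esub> (\<Union>d\<in>{1..}. A d)"


section \<open>Homogeneous coordinate rings of plane curves\<close>

text \<open>\<open>(3 \<Rightarrow>\<^sub>0 nat) \<Rightarrow>\<^sub>0 'k\<close> is the polynomial ring in three variables: a finitely
  supported map from exponent vectors to coefficients, multiplied by convolution.\<close>

type_synonym 'k poly3 = "(3 \<Rightarrow>\<^sub>0 nat) \<Rightarrow>\<^sub>0 'k"

definition homogeneous :: "nat \<Rightarrow> 'k::zero poly3 \<Rightarrow> bool" where
  "homogeneous d f \<longleftrightarrow>
     (\<forall>m \<in> Poly_Mapping.keys f. (\<Sum>i\<in>UNIV. Poly_Mapping.lookup m i) = d)"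

definition coord_ring :: "'k::field poly3 \<Rightarrow> 'k poly3 set ring" where
  "coord_ring F = ring_of_type_algebra Quot (PIdl\<^bsub>ring_of_type_algebra\<^esub> F)"

definition coord_grading :: "'k::field poly3 \<Rightarrow> nat \<Rightarrow> 'k poly3 set set" where
  "coord_grading F d =
     {PIdl\<^bsub>ring_of_type_algebra\<^esub> F +>\<^bsub>ring_of_type_algebra\<^esub> f | f. homogeneous d f}"

text \<open>The form \<open>F\<close> defines an irreducible plane projective curve. Irreducible elements are
  neither zero nor units, so the degree is positive.\<close>

definition irreducible_plane_curve :: "'k::field poly3 \<Rightarrow> bool" where
  "irreducible_plane_curve F \<longleftrightarrow> (\<exists>d. homogeneous d F) \<and> Factorial_Ring.irreducible F"

end

theory Submission
  imports Defs "HOL-Library.Set_Algebras"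
begin

text \<open>Write \<open>R = S / (F)\<close> with \<open>S = k[x, y, z]\<close>. Let \<open>x\<close>, \<open>y\<close> be linear parameters of \<open>R\<close>. The Koszul
  relations make the Hilbert function of a saturated graded ideal of \<open>R\<close> convex, and it grows with slope
  \<open>\<delta> = deg F\<close> in the end; hence it differs from \<open>max 0 (\<delta> m + c)\<close> by a bound that depends on \<open>R\<close> only, and
  it equals \<open>\<delta> m + c\<close> soon after the first degree where the ideal is nonzero.

  By a graded Nakayama argument \<open>I = (f, g)\<close> for forms of degrees \<open>a\<close>, \<open>b\<close>, and \<open>I\<^sup>[\<^sup>q\<^sup>]\<close> is
  \<open>J\<^sub>q = (f\<^sup>q, g\<^sup>q)\<close> for \<open>q = p\<^sup>n\<close>. Let \<open>c\<^sub>q\<close> be the constant of the saturation of \<open>J\<^sub>q\<close>. Comparing \<open>J\<^sub>q\<close> with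
  the ordinary powers \<open>W\<^sub>n = (f, g)\<^sup>n\<close>, through \<open>J\<^sub>q \<subseteq> W\<^sub>q\<close> and \<open>W\<^sub>2\<^sub>q\<^sub>-\<^sub>1 = J\<^sub>q W\<^sub>q\<^sub>-\<^sub>1\<close>, gives
  \<open>c\<^sub>q = - e q + O(1)\<close> for an integer \<open>e\<close>. The length of the local cohomology is the sum over all degrees \<open>m\<close>
  of the difference of the Hilbert functions of the saturation of \<open>J\<^sub>q\<close> and of \<open>J\<^sub>q\<close>. The latter is determined
  by the saturated ideal \<open>(f\<^sup>q) \<inter> (g\<^sup>q)\<close>, so up to \<open>O(q)\<close> the length is a sum of values of piecewise
  linear functions, asymptotic to \<open>\<delta> (a - e / \<delta>) (b - e / \<delta>) q\<^sup>2\<close>.\<close>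

section \<open>Finite-dimensional subspaces\<close>

text \<open>The obstacle is that the curve may be singular. The ideal sheaf generated by
  \<open>f^q\<close> and \<open>g^q\<close> need not be invertible then, and its degree need not be
  exactly linear in \<open>q\<close>; only for the powers of \<open>(f, g)\<close> is linearity
  available, and only eventually. Hence the comparison with powers, and hence all errors must be
  bounded uniformly in \<open>q\<close>.

  Uniformity comes from integrality. A saturated ideal with a nonzero element in degree
  \<open>m0\<close> contains a copy of \<open>R\<close> shifted by \<open>m0\<close>, and the excess
  of its Hilbert function over the limiting line is a nonnegative integer that drops in every degree
  until it is 0. How long this takes depends on \<open>R\<close> alone.

  For the lower estimate, \<open>W (q - 1)\<close> is replaced by the multiples of an element
  \<open>s\<close> of least degree in its saturation. The loss is bounded, and the product with
  \<open>J q\<close> becomes \<open>s J q\<close>, whose Hilbert function is a shift of that of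
  \<open>J q\<close>.

  The asymptotics hold along all \<open>q\<close>; the characteristic enters through the description
  of the Frobenius powers by \<open>f^q\<close> and \<open>g^q\<close>.\<close>

locale vspace = vector_space scale for scale :: "'k::field \<Rightarrow> 'v::ab_group_add \<Rightarrow> 'v"
begin

text \<open>\<open>dim\<close> is the cardinality of a basis and hence 0 when bases are infinite, so
  monotonicity of \<open>dim\<close> has to be tied to this predicate.\<close>

definition fin_dim :: "'v set \<Rightarrow> bool" where
  "fin_dim V \<longleftrightarrow> (\<exists>B. finite B \<and> V \<subseteq> span B)"

lemma fin_dim_mono: "fin_dim T \<Longrightarrow> S \<subseteq> T \<Longrightarrow> fin_dim S"
  unfolding fin_dim_def by blast

lemma independent_fin_dim:
  assumes "independent B" "B \<subseteq> V" "fin_dim V"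
  shows "finite B" "card B \<le> dim V"
proof -
  obtain A where A: "finite A" "V \<subseteq> span A" using assms(3) unfolding fin_dim_def by blast
  show fin: "finite B"
    using independent_span_bound[OF A(1) assms(1)] assms(2) A(2) by blast
  obtain C where C: "B \<subseteq> C" "C \<subseteq> V" "independent C" "V \<subseteq> span C"
    using maximal_independent_subset_extend[OF assms(2,1)] by blast
  have "finite C" using independent_span_bound[OF A(1) C(3)] C(2) A(2) by blast
  then show "card B \<le> dim V"
    using C basis_card_eq_dim[OF C(2,4,3)] card_mono by metis
qed

lemma fin_dim_basis:
  assumes "subspace V" "fin_dim V"
  obtains B where "finite B" "independent B" "span B = V" "card B = dim V"
proof -
  obtain B where B: "B \<subseteq> V" "independent B" "V \<subseteq> span B" "card B = dim V"
    using basis_exists by blast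
  have "span B = V" using B assms(1) by (simp add: span_subspace)
  then show ?thesis using that B independent_fin_dim(1)[OF B(2,1) assms(2)] by blast
qed

lemma dim_mono_fin_dim:
  assumes "S \<subseteq> T" "fin_dim T"
  shows "dim S \<le> dim T"
proof -
  obtain B where B: "B \<subseteq> S" "independent B" "S \<subseteq> span B" "card B = dim S"
    using basis_exists by blast
  then show ?thesis using independent_fin_dim(2)[OF B(2) _ assms(2)] assms(1) by auto
qed

lemma dim_psubset_fin_dim:
  assumes "subspace S" "S \<subset> T" "fin_dim T"
  shows "dim S < dim T"
proof -
  have fS: "fin_dim S" using assms fin_dim_mono by blast
  obtain B where B: "finite B" "independent B" "span B = S" "card B = dim S"
    using fin_dim_basis[OF assms(1) fS] by blast
  obtain v where v: "v \<in> T" "v \<notin> S" using assms(2) by blast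
  have "independent (insert v B)" using v B independent_insertI by blast
  moreover have "insert v B \<subseteq> T" using v assms(2) B span_superset by blast
  ultimately have "card (insert v B) \<le> dim T" using independent_fin_dim(2) assms(3) by blast
  moreover have "v \<notin> B" using v B span_base by blast
  ultimately show ?thesis using B by simp
qed

lemma subspace_plus: "subspace A \<Longrightarrow> subspace B \<Longrightarrow> subspace (A + B)"
proof -
  have "A + B = {x + y |x y. x \<in> A \<and> y \<in> B}" by (auto simp: set_plus_def)
  then show "subspace A \<Longrightarrow> subspace B \<Longrightarrow> subspace (A + B)" using subspace_sums[of A B] by simp
qed

lemma subset_plus_left: "0 \<in> B \<Longrightarrow> A \<subseteq> A + (B :: 'v set)"
  unfolding set_plus_def by force

lemma subset_plus_right: "0 \<in> A \<Longrightarrow> B \<subseteq> A + (B :: 'v set)"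
  unfolding set_plus_def by force

lemma fin_dim_plus:
  assumes "fin_dim A" "fin_dim B"
  shows "fin_dim (A + B)"
proof -
  obtain S T where ST: "finite S" "A \<subseteq> span S" "finite T" "B \<subseteq> span T"
    using assms unfolding fin_dim_def by blast
  have "A + B \<subseteq> span (S \<union> T)"
    unfolding span_Un using ST by (auto simp: set_plus_def)
  then show ?thesis unfolding fin_dim_def using ST by blast
qed

lemma plus_subspace_subset:
  assumes "subspace L" "A \<subseteq> L" "B \<subseteq> L"
  shows "A + B \<subseteq> L"
proof
  fix u assume "u \<in> A + B"
  then obtain v w where "u = v + w" "v \<in> A" "w \<in> B" by (rule set_plus_elim)
  then show "u \<in> L" using assms subspace_add[of L v w] by blast
qed

text \<open>A basis \<open>C\<close> of the intersection is extended to a basis \<open>D\<close> of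
  \<open>A\<close>, and \<open>D\<close> to a basis \<open>E\<close> of the sum by vectors of
  \<open>B\<close>. The vectors added last complete \<open>C\<close> to a basis of \<open>B\<close>,
  and counting gives the formula.\<close>

lemma dim_plus_Int:
  assumes sA: "subspace A" and sB: "subspace B" and fA: "fin_dim A" and fB: "fin_dim B"
  shows "dim (A + B) + dim (A \<inter> B) = dim A + dim B"
proof -
  have fAB: "fin_dim (A + B)" using fin_dim_plus[OF fA fB] .
  have A0: "A \<subseteq> A + B" and B0: "B \<subseteq> A + B"
    using subset_plus_left[OF subspace_0[OF sB]] subset_plus_right[OF subspace_0[OF sA]] by blast+
  obtain C where C: "C \<subseteq> A \<inter> B" "independent C" "A \<inter> B \<subseteq> span C"
    using maximal_independent_subset[of "A \<inter> B"] by metis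
  obtain D where D: "C \<subseteq> D" "D \<subseteq> A" "independent D" "A \<subseteq> span D"
    using maximal_independent_subset_extend[of C A] C by blast
  obtain E where E: "D \<subseteq> E" "E \<subseteq> D \<union> B" "independent E" "D \<union> B \<subseteq> span E"
    using maximal_independent_subset_extend[of D "D \<union> B"] D by blast
  have spC: "span C = A \<inter> B" using C span_subspace subspace_inter[OF sA sB] by blast
  have spD: "span D = A" using D span_subspace sA by blast
  have EAB: "E \<subseteq> A + B" using E D A0 B0 by blast
  have spE: "A + B \<subseteq> span E"
  proof -
    have "A \<subseteq> span E" using spD span_mono[OF E(1)] by blast
    then show ?thesis using E(4) by (auto elim!: set_plus_elim intro!: span_add)
  qed
  have finE: "finite E" using independent_fin_dim(1)[OF E(3) EAB fAB] .
  define E' where "E' = E - D"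
  have CE: "C \<union> E' \<subseteq> B" using C E(2) unfolding E'_def by blast
  have "B \<subseteq> span (C \<union> E')"
  proof
    fix b assume b: "b \<in> B"
    then have "b \<in> span (D \<union> E')" using E(4) E(1) unfolding E'_def by (metis Diff_partition Un_iff subsetD)
    then obtain u v where uv: "b = u + v" "u \<in> span D" "v \<in> span E'" unfolding span_Un by blast
    have "v \<in> B" using uv(3) CE sB span_minimal by blast
    then have "u \<in> A \<inter> B" using uv b spD subspace_diff[OF sB b, of v] by simp
    then show "b \<in> span (C \<union> E')" unfolding span_Un using uv spC by blast
  qed
  moreover have "independent (C \<union> E')"
    using E(3) by (rule independent_mono) (use D E in \<open>auto simp: E'_def\<close>)
  ultimately have dB: "dim B = card (C \<union> E')" using basis_card_eq_dim[OF CE] by simp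
  have "card (C \<union> E') = card C + card E'"
    by (rule card_Un_disjoint) (use finE D E in \<open>auto simp: E'_def dest: finite_subset\<close>)
  moreover have "card E = card D + card E'"
    unfolding E'_def using card_Diff_subset[of D E] finE E(1) card_mono[OF finE E(1)]
    by (simp add: finite_subset)
  moreover have "dim A = card D" using basis_card_eq_dim D by metis
  moreover have "dim (A \<inter> B) = card C" using basis_card_eq_dim C by metis
  moreover have "dim (A + B) = card E" using basis_card_eq_dim EAB spE E(3) by metis
  ultimately show ?thesis using dB by simp
qed

lemma dim_inj_image:
  assumes lin: "Vector_Spaces.linear scale scale h" and inj: "inj_on h V" and V: "subspace V"
  shows "dim (h ` V) = dim V"
proof -
  interpret h: Vector_Spaces.linear scale scale h by fact
  obtain B where B: "B \<subseteq> V" "independent B" "V \<subseteq> span B" "card B = dim V"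
    using basis_exists by blast
  have sp: "span B = V" using B V span_subspace by blast
  have "independent (h ` B)" using h.independent_injective_image[OF B(2)] inj sp by simp
  moreover have "h ` V \<subseteq> span (h ` B)" using h.span_image[of B] sp by simp
  moreover have "h ` B \<subseteq> h ` V" using B by blast
  moreover have "card (h ` B) = card B" using card_image inj_on_subset[OF inj B(1)] by blast
  ultimately show ?thesis using basis_card_eq_dim B(4) by metis
qed

end

section \<open>Convex integer functions of bounded slope\<close>

lemma int_mono_from_step:
  fixes f :: "int \<Rightarrow> int"
  assumes "\<And>m. k \<le> m \<Longrightarrow> f m \<le> f (m + 1)" "k \<le> m" "m \<le> n"
  shows "f m \<le> f n"
  using assms(3)
proof (induction n rule: int_ge_induct)
  case (step i)
  then show ?case using assms(1)[of i] assms(2) by linarith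
qed simp

text \<open>The differences \<open>s\<close> increase by convexity, cannot exceed \<open>d\<close>
  because of the upper bound by \<open>H\<close>, and reach \<open>d\<close> because of the lower
  bound. The excess \<open>E\<close> over the final line starts with at most \<open>d + C\<close> at
  \<open>m0\<close> and falls by at least one as long as \<open>s\<close> is below \<open>d\<close>,
  so it is used up after \<open>d + C\<close> steps.\<close>

lemma convex_growth:
  fixes D H :: "int \<Rightarrow> int" and d C m0 :: int
  assumes conv: "\<And>m. 2 * D (m + 1) \<le> D (m + 2) + D m"
    and nonneg: "\<And>m. 0 \<le> D m" and upper: "\<And>m. D m \<le> H m"
    and lower: "\<And>m. m0 \<le> m \<Longrightarrow> H (m - m0) \<le> D m"
    and zero: "\<And>m. m < m0 \<Longrightarrow> D m = 0" and m0: "0 \<le> m0" and d: "0 \<le> d"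
    and H: "\<And>m. 0 \<le> m \<Longrightarrow> \<bar>H m - d * m\<bar> \<le> C"
  shows "\<exists>c. \<bar>c + d * m0\<bar> \<le> 2 * C + d \<and> (\<forall>m\<ge>m0. \<bar>D m - d * (m - m0)\<bar> \<le> 2 * C + d)
    \<and> (\<forall>m\<ge>m0 + (2 * C + d). D m = d * m + c)"
proof -
  define s where "s m = D (m + 1) - D m" for m
  have C0: "0 \<le> C" using H[of 0] by linarith
  have s_mono: "s m \<le> s n" if "m \<le> n" for m n
  proof (rule int_mono_from_step[where f = s and k = m])
    fix i assume "m \<le> i"
    show "s i \<le> s (i + 1)" using conv[of i] unfolding s_def by (simp add: add.assoc)
  qed (use that in auto)
  have s_ge: "D (m + int j) \<ge> D m + s m * int j" for m j
  proof (induction j)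
    case (Suc j)
    have "s m \<le> D (m + int (Suc j)) - D (m + int j)"
      using s_mono[of m "m + int j"] unfolding s_def by (simp add: algebra_simps)
    then show ?case using Suc by (simp add: algebra_simps)
  qed simp
  have s_le: "D (m + int j) \<le> D m + b * int j" if "\<And>n. s n \<le> b" for m j b
  proof (induction j)
    case (Suc j)
    have "D (m + int (Suc j)) - D (m + int j) \<le> b"
      using that[of "m + int j"] unfolding s_def by (simp add: algebra_simps)
    then show ?case using Suc by (simp add: algebra_simps)
  qed simp
  have slope: "s m \<le> d" for m
  proof (rule ccontr)
    assume "\<not> s m \<le> d"
    define n where "n = max m 0"
    have sn: "d + 1 \<le> s n" using s_mono[of m n] \<open>\<not> s m \<le> d\<close> unfolding n_def by linarith
    \<comment> \<open>The two estimates of \<open>D (n + j)\<close> below force \<open>j\<close> to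
      be at most \<open>d * n + C\<close>; one more is a contradiction.\<close>
    define j where "j = nat (d * n + C + 1)"
    have j: "int j = d * n + C + 1" unfolding j_def n_def using d C0 by simp
    have "D n + (d + 1) * int j \<le> D (n + int j)"
      using s_ge[of n j] mult_right_mono[OF sn, of "int j"] by linarith
    also have "\<dots> \<le> d * (n + int j) + C"
      using upper[of "n + int j"] H[of "n + int j"] unfolding n_def by fastforce
    finally show False using j nonneg[of n] by (simp add: algebra_simps)
  qed
  obtain m1 where m1: "s m1 = d" "m0 \<le> m1"
  proof -
    have "\<exists>m\<ge>m0. \<not> s m \<le> d - 1"
    proof (rule ccontr)
      assume "\<not> ?thesis"
      then have "s (max n m0) \<le> d - 1" for n by simp
      then have b: "s n \<le> d - 1" for n using s_mono[of n "max n m0"] by (meson max.cobounded1 order_trans)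
      \<comment> \<open>With all slopes at most \<open>d - 1\<close>, the lower bound
        \<open>d * j - C\<close> is violated as soon as \<open>j\<close> exceeds
        \<open>D m0 + C\<close>.\<close>
      define j where "j = nat (D m0 + C + 1)"
      have j: "int j = D m0 + C + 1" unfolding j_def using nonneg[of m0] C0 by simp
      have "D (m0 + int j) \<le> D m0 + (d - 1) * int j" by (rule s_le[OF b])
      moreover have "d * int j - C \<le> D (m0 + int j)" using lower[of "m0 + int j"] H[of "int j"] by simp
      ultimately show False using j by (simp add: algebra_simps)
    qed
    then show ?thesis using that slope by (metis linorder_not_less order_le_less zle_diff1_eq)
  qed
  have s_d: "s m = d" if "m1 \<le> m" for m using s_mono[OF that] slope[of m] m1 by linarith
  define c where "c = D m1 - d * m1"
  define E where "E m = D m - d * m - c" for m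
  have E_step: "E (m + 1) = E m + (s m - d)" for m unfolding E_def s_def by (simp add: algebra_simps)
  have E_const: "E n = E m" if sm: "s m = d" and mn: "m \<le> n" for m n
    using mn
  proof (induction n rule: int_ge_induct)
    case (step i)
    have "s i = d" using s_mono[OF step(1)] slope[of i] sm by linarith
    then show ?case using step E_step[of i] by simp
  qed simp
  have E_m1: "E m = 0" if "m1 \<le> m" for m using E_const[OF m1(1) that] unfolding E_def c_def by simp
  have E_zero: "E m = 0" if "s m = d" for m
    using E_const[OF that, of "max m m1"] E_m1[of "max m m1"] by simp
  have E_nonneg: "0 \<le> E m" for m
  proof -
    have "- E m \<le> - E (max m m1)"
      by (rule int_mono_from_step[where f = "\<lambda>i. - E i" and k = m]) (use E_step slope in \<open>auto simp: add.commute\<close>)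
    then show ?thesis using E_m1[of "max m m1"] by simp
  qed
  have ub: "D m \<le> d * (m - m0) + d" if "m0 \<le> m" for m
  proof -
    \<comment> \<open>Counting starts at \<open>m0 - 1\<close>, where \<open>D\<close> vanishes;
      this extra step is the summand \<open>d\<close>.\<close>
    have "D (m0 - 1 + int (nat (m - m0 + 1))) \<le> D (m0 - 1) + d * int (nat (m - m0 + 1))"
      by (rule s_le[OF slope])
    then show ?thesis using that zero[of "m0 - 1"] by (simp add: algebra_simps)
  qed
  have lb: "d * (m - m0) - C \<le> D m" if "m0 \<le> m" for m
    using lower[OF that] H[of "m - m0"] that by simp
  have c1: "c + d * m0 \<le> d" using E_m1[of m1] ub[OF m1(2)] unfolding E_def by (simp add: algebra_simps)
  have c2: "- C \<le> c + d * m0" using E_m1[of m1] lb[OF m1(2)] unfolding E_def by (simp add: algebra_simps)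
  have E_dec: "E (m0 + int j) \<le> max 0 (d + C - int j)" for j
  proof (induction j)
    case 0
    have "E m0 = D m0 - (c + d * m0)" unfolding E_def by simp
    then show ?case using ub[of m0] c2 by simp
  next
    case (Suc j)
    have *: "m0 + int (Suc j) = m0 + int j + 1" by simp
    show ?case
    proof (cases "s (m0 + int j) = d")
      case True
      then show ?thesis using E_zero[OF True] E_step[of "m0 + int j"] unfolding * by simp
    next
      case False
      then have "s (m0 + int j) \<le> d - 1" using slope[of "m0 + int j"] by linarith
      then show ?thesis using Suc E_step[of "m0 + int j"] E_nonneg[of "m0 + int j + 1"] unfolding * by simp
    qed
  qed
  have "D m = d * m + c" if "m0 + (2 * C + d) \<le> m" for m
  proof -
    have "E m \<le> 0" using E_dec[of "nat (m - m0)"] that C0 d by simp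
    then show ?thesis using E_nonneg[of m] unfolding E_def by simp
  qed
  moreover have "\<bar>D m - d * (m - m0)\<bar> \<le> 2 * C + d" if "m0 \<le> m" for m
    using ub[OF that] lb[OF that] C0 d by linarith
  ultimately show ?thesis using c1 c2 C0 d by (intro exI[of _ c]) auto
qed

section \<open>Graded submodules of a two-dimensional graded domain\<close>

text \<open>The graded domain is \<open>S/P\<close> for a graded prime \<open>P\<close> of \<open>S\<close>; all its graded submodules are
  represented by their preimages in \<open>S\<close>, given degree by degree. The elements \<open>x\<close>, \<open>y\<close> are
  linear parameters: a regular sequence (\<open>koszul\<close>) that generates all forms of large
  degree (\<open>primary\<close>). Grading by integers avoids truncated subtraction of degrees.\<close>

locale graded_surface = vspace scale for scale :: "'k::field \<Rightarrow> 's::idom \<Rightarrow> 's" +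
  fixes G P :: "int \<Rightarrow> 's set" and x y :: 's and r0 :: int
  assumes scale_mult: "a * scale c b = scale c (a * b)"
    and G_sub: "subspace (G m)" and G_fin: "fin_dim (G m)"
    and G_neg: "m < 0 \<Longrightarrow> G m = {0}"
    and G_mult: "a \<in> G i \<Longrightarrow> b \<in> G j \<Longrightarrow> a * b \<in> G (i + j)" and one_G: "1 \<in> G 0"
    and P_sub: "subspace (P m)" and P_G: "P m \<subseteq> G m"
    and P_mult: "a \<in> G i \<Longrightarrow> b \<in> P j \<Longrightarrow> a * b \<in> P (i + j)"
    and P_prime: "a \<in> G i \<Longrightarrow> b \<in> G j \<Longrightarrow> a * b \<in> P (i + j) \<Longrightarrow> a \<in> P i \<or> b \<in> P j"
    and one_P: "1 \<notin> P 0"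
    and x_G: "x \<in> G 1" and y_G: "y \<in> G 1" and x_P: "x \<notin> P 1" and y_P: "y \<notin> P 1"
    and koszul: "u \<in> G m \<Longrightarrow> w \<in> G m \<Longrightarrow> x * u - y * w \<in> P (m + 1) \<Longrightarrow>
      \<exists>v\<in>G (m - 1). u - y * v \<in> P m \<and> w - x * v \<in> P m"
    and primary: "r0 \<le> m \<Longrightarrow> v \<in> G m \<Longrightarrow> \<exists>u\<in>G (m - 1). \<exists>w\<in>G (m - 1). v - (x * u + y * w) \<in> P m"
begin

definition gmod :: "(int \<Rightarrow> 's set) \<Rightarrow> bool" where
  "gmod M \<longleftrightarrow> (\<forall>m. subspace (M m) \<and> P m \<subseteq> M m \<and> M m \<subseteq> G m
     \<and> (\<forall>i a u. a \<in> G i \<longrightarrow> u \<in> M m \<longrightarrow> a * u \<in> M (i + m)))"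

lemma gmodD:
  assumes "gmod M"
  shows "subspace (M m)" "P m \<subseteq> M m" "M m \<subseteq> G m" "fin_dim (M m)"
    and "a \<in> G i \<Longrightarrow> u \<in> M m \<Longrightarrow> a * u \<in> M (i + m)"
  using assms fin_dim_mono[OF G_fin] unfolding gmod_def by blast+

lemma gmod_G: "gmod G" unfolding gmod_def using G_sub P_G G_mult by blast

text \<open>The Hilbert function of \<open>M / P\<close>, with integer values so that differences
  are not truncated.\<close>

definition hf :: "(int \<Rightarrow> 's set) \<Rightarrow> int \<Rightarrow> int" where
  "hf M m = int (dim (M m)) - int (dim (P m))"

lemma hf_nonneg: "gmod M \<Longrightarrow> 0 \<le> hf M m"
  unfolding hf_def using dim_mono_fin_dim gmodD by simp

lemma hf_mono: "gmod N \<Longrightarrow> M m \<subseteq> N m \<Longrightarrow> hf M m \<le> hf N m"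
  unfolding hf_def using dim_mono_fin_dim gmodD by simp

lemma hf_neg: "gmod M \<Longrightarrow> m < 0 \<Longrightarrow> hf M m = 0"
  unfolding hf_def using gmodD(1,2,3)[of M m] G_neg[of m] subspace_0 P_sub[of m]
  by (metis diff_self subset_singletonD subset_antisym insert_subset empty_iff empty_subsetI subset_singleton_iff)

lemma hf_pos:
  assumes "gmod M" "M m \<noteq> P m"
  shows "0 < hf M m"
  unfolding hf_def using dim_psubset_fin_dim[of "P m" "M m"] gmodD[OF assms(1)] P_sub assms(2) by auto

text \<open>Adding \<open>P\<close> makes the product a preimage again; \<open>a\<close> is the
  degree of \<open>f\<close>.\<close>

definition mulM :: "'s \<Rightarrow> int \<Rightarrow> (int \<Rightarrow> 's set) \<Rightarrow> int \<Rightarrow> 's set" where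
  "mulM f a M m = (\<lambda>u. f * u) ` M (m - a) + P m"

lemma mulM_iff: "v \<in> mulM f a M m \<longleftrightarrow> (\<exists>u\<in>M (m - a). v - f * u \<in> P m)"
proof
  assume "v \<in> mulM f a M m"
  then show "\<exists>u\<in>M (m - a). v - f * u \<in> P m"
    unfolding mulM_def by (auto elim!: set_plus_elim intro!: bexI)
next
  assume "\<exists>u\<in>M (m - a). v - f * u \<in> P m"
  then obtain u where u: "u \<in> M (m - a)" "v - f * u \<in> P m" by blast
  have "f * u + (v - f * u) \<in> mulM f a M m" unfolding mulM_def using u by (intro set_plus_intro) auto
  then show "v \<in> mulM f a M m" by simp
qed

lemma mulMI: "u \<in> M m \<Longrightarrow> f * u \<in> mulM f a M (m + a)"
  unfolding mulM_iff using subspace_0[OF P_sub] by (intro bexI[of _ u]) auto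

lemma linear_mult: "Vector_Spaces.linear scale scale (\<lambda>u. f * u)"
  by (rule linear_module_homI) (unfold_locales, auto simp: distrib_left scale_mult)

lemma subspace_mult_image: "subspace V \<Longrightarrow> subspace ((\<lambda>u. f * u) ` V)"
  using linear_mult[of f] by (intro module_hom.subspace_image) (auto simp: Vector_Spaces.linear_def)

lemma gmod_mulM:
  assumes "f \<in> G a" "gmod M"
  shows "gmod (mulM f a M)"
  unfolding gmod_def
proof (intro allI conjI impI)
  fix m
  show "subspace (mulM f a M m)"
    unfolding mulM_def by (intro subspace_plus subspace_mult_image gmodD(1)[OF assms(2)] P_sub)
  show "P m \<subseteq> mulM f a M m"
    using mulM_iff[of _ f a M m] subspace_0[OF gmodD(1)[OF assms(2)]] by force
  show "mulM f a M m \<subseteq> G m"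
  proof
    fix v assume "v \<in> mulM f a M m"
    then obtain u where u: "u \<in> M (m - a)" "v - f * u \<in> P m" unfolding mulM_iff by blast
    have "f * u \<in> G m" using G_mult[OF assms(1), of u "m - a"] u gmodD(3)[OF assms(2)] by auto
    then have "f * u + (v - f * u) \<in> G m" using u P_G subspace_add[OF G_sub] by blast
    then show "v \<in> G m" by simp
  qed
  fix i b v assume b: "b \<in> G i" and "v \<in> mulM f a M m"
  then obtain u where u: "u \<in> M (m - a)" "v - f * u \<in> P m" unfolding mulM_iff by blast
  have "b * v - f * (b * u) = b * (v - f * u)" by (simp add: algebra_simps)
  then have "b * v - f * (b * u) \<in> P (i + m)" using P_mult[OF b u(2)] by simp
  moreover have "b * u \<in> M (i + m - a)" using gmodD(5)[OF assms(2) b u(1)] by (simp add: algebra_simps)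
  ultimately show "b * v \<in> mulM f a M (i + m)" unfolding mulM_iff by blast
qed

lemma P_cancel: "f \<in> G a \<Longrightarrow> f \<notin> P a \<Longrightarrow> u \<in> G m \<Longrightarrow> f * u \<in> P (a + m) \<Longrightarrow> u \<in> P m"
  using P_prime by blast

text \<open>Multiplication by \<open>f\<close> is injective, and its image meets \<open>P\<close>
  only in multiples of elements of \<open>P\<close>, because \<open>P\<close> is prime and does not
  contain \<open>f\<close>. On the quotient it is therefore a mere shift of degrees.\<close>

lemma hf_mulM:
  assumes f: "f \<in> G a" "f \<notin> P a" and M: "gmod M"
  shows "hf (mulM f a M) m = hf M (m - a)"
proof -
  have f0: "f \<noteq> 0" using f(2) subspace_0[OF P_sub] by blast
  have inj: "inj_on (\<lambda>u. f * u) V" for V using f0 by (auto simp: inj_on_def)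
  let ?A = "(\<lambda>u. f * u) ` M (m - a)"
  have Int: "?A \<inter> P m = (\<lambda>u. f * u) ` P (m - a)"
  proof
    show "?A \<inter> P m \<subseteq> (\<lambda>u. f * u) ` P (m - a)"
      using P_cancel[OF f, of _ "m - a"] gmodD(3)[OF M] by fastforce
    show "(\<lambda>u. f * u) ` P (m - a) \<subseteq> ?A \<inter> P m"
      using gmodD(2)[OF M] P_mult[OF f(1), of _ "m - a"] by fastforce
  qed
  have "?A \<subseteq> G m" using G_mult[OF f(1), of _ "m - a"] gmodD(3)[OF M] by fastforce
  then have "dim (?A + P m) + dim (?A \<inter> P m) = dim ?A + dim (P m)"
    using fin_dim_mono[OF G_fin] P_G
    by (intro dim_plus_Int subspace_mult_image gmodD(1)[OF M] P_sub) blast+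
  moreover have "dim ?A = dim (M (m - a))"
    using dim_inj_image[OF linear_mult inj gmodD(1)[OF M]] .
  moreover have "dim ((\<lambda>u. f * u) ` P (m - a)) = dim (P (m - a))"
    using dim_inj_image[OF linear_mult inj P_sub] .
  ultimately show ?thesis unfolding hf_def mulM_def Int by simp
qed

lemma gmod_plus:
  assumes "gmod M" "gmod N"
  shows "gmod (\<lambda>m. M m + N m)"
  unfolding gmod_def
proof (intro allI conjI impI)
  fix m
  show "subspace (M m + N m)" using subspace_plus gmodD assms by blast
  show "P m \<subseteq> M m + N m"
    using subset_plus_left[OF subspace_0[OF gmodD(1)[OF assms(2)]]] gmodD(2)[OF assms(1)] by blast
  show "M m + N m \<subseteq> G m" using gmodD(3) assms subspace_add[OF G_sub] by (fastforce elim!: set_plus_elim)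
  fix i a u assume a: "a \<in> G i" and "u \<in> M m + N m"
  then obtain v w where "u = v + w" "v \<in> M m" "w \<in> N m" by (auto elim: set_plus_elim)
  then show "a * u \<in> M (i + m) + N (i + m)"
    using gmodD(5)[OF assms(1) a] gmodD(5)[OF assms(2) a] by (auto simp: distrib_left intro: set_plus_intro)
qed

lemma gmod_Int: "gmod M \<Longrightarrow> gmod N \<Longrightarrow> gmod (\<lambda>m. M m \<inter> N m)"
  unfolding gmod_def using subspace_inter by blast

lemma hf_plus:
  assumes "gmod M" "gmod N"
  shows "hf (\<lambda>m. M m + N m) m + hf (\<lambda>m. M m \<inter> N m) m = hf M m + hf N m"
  using dim_plus_Int[OF gmodD(1)[OF assms(1)] gmodD(1)[OF assms(2)] gmodD(4)[OF assms(1)] gmodD(4)[OF assms(2)], of m m]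
  unfolding hf_def by simp

lemma subset_plus:
  assumes "gmod M" "gmod N"
  shows "M m \<subseteq> M m + N m" "N m \<subseteq> M m + N m"
  using subset_plus_left subset_plus_right subspace_0 gmodD(1) assms by metis+

lemma plus_subset:
  assumes "gmod L" "M m \<subseteq> L m" "N m \<subseteq> L m"
  shows "M m + N m \<subseteq> L m"
  using assms subspace_add[OF gmodD(1)[OF assms(1)]] by (fastforce elim!: set_plus_elim)

lemma mulM_mono: "M (m - a) \<subseteq> N (m - a) \<Longrightarrow> mulM f a M m \<subseteq> mulM f a N m"
  using mulM_iff by blast

lemma mulM_subset: "gmod M \<Longrightarrow> f \<in> G a \<Longrightarrow> mulM f a M m \<subseteq> M m"
proof
  fix v assume M: "gmod M" and f: "f \<in> G a" and "v \<in> mulM f a M m"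
  then obtain u where u: "u \<in> M (m - a)" "v - f * u \<in> P m" unfolding mulM_iff by blast
  have "f * u \<in> M m" using gmodD(5)[OF M f u(1)] by simp
  then have "f * u + (v - f * u) \<in> M m" using u gmodD(2)[OF M] subspace_add[OF gmodD(1)[OF M]] by blast
  then show "v \<in> M m" by simp
qed

text \<open>No nonzero homogeneous class of \<open>G / M\<close> is killed by both \<open>x\<close>
  and \<open>y\<close>. This one-step condition is the form of saturation that the Koszul relation
  can use.\<close>

definition xysat :: "(int \<Rightarrow> 's set) \<Rightarrow> bool" where
  "xysat M \<longleftrightarrow> (\<forall>m. \<forall>v\<in>G m. x * v \<in> M (m + 1) \<longrightarrow> y * v \<in> M (m + 1) \<longrightarrow> v \<in> M m)"

lemma xysat_G: "xysat G" unfolding xysat_def by blast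

lemma xysat_Int: "xysat M \<Longrightarrow> xysat N \<Longrightarrow> xysat (\<lambda>m. M m \<inter> N m)"
  unfolding xysat_def by blast

abbreviation xyM :: "(int \<Rightarrow> 's set) \<Rightarrow> int \<Rightarrow> 's set" where
  "xyM M m \<equiv> mulM x 1 M m + mulM y 1 M m"

lemma gmod_xyM: "gmod M \<Longrightarrow> gmod (xyM M)"
  using gmod_plus gmod_mulM x_G y_G by blast

lemma xyM_subset: "gmod M \<Longrightarrow> xyM M m \<subseteq> M m"
  by (intro plus_subset mulM_subset x_G y_G)

text \<open>Inclusion and exclusion: by the Koszul relation a common element of \<open>x M\<close>
  and \<open>y M\<close> is \<open>x y t\<close> modulo \<open>P\<close>, and saturation puts
  \<open>t\<close> into \<open>M\<close>.\<close>

lemma hf_xyM: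
  assumes M: "gmod M" and sat: "xysat M"
  shows "hf (xyM M) m = 2 * hf M (m - 1) - hf M (m - 2)"
proof -
  have xy: "x * y \<in> G 2" using G_mult[OF x_G y_G] by simp
  have xyP: "x * y \<notin> P 2" using P_prime[OF x_G y_G] x_P y_P by auto
  have Int: "mulM x 1 M m \<inter> mulM y 1 M m = mulM (x * y) 2 M m"
  proof (intro equalityI subsetI IntI)
    fix v assume "v \<in> mulM x 1 M m \<inter> mulM y 1 M m"
    then obtain u w where u: "u \<in> M (m - 1)" "v - x * u \<in> P m" and w: "w \<in> M (m - 1)" "v - y * w \<in> P m"
      unfolding Int_iff mulM_iff by blast
    have "(v - y * w) - (v - x * u) \<in> P m" using subspace_diff[OF P_sub] u w by blast
    then have "x * u - y * w \<in> P (m - 1 + 1)" by simp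
    then obtain t where t: "t \<in> G (m - 1 - 1)" "u - y * t \<in> P (m - 1)" "w - x * t \<in> P (m - 1)"
      using koszul u w gmodD(3)[OF M] by blast
    have "u - (u - y * t) \<in> M (m - 1)" "w - (w - x * t) \<in> M (m - 1)"
      using t u w gmodD(1,2)[OF M] subspace_diff by blast+
    then have tM: "t \<in> M (m - 2)" using sat t(1) unfolding xysat_def by (simp add: algebra_simps)
    have "x * (u - y * t) \<in> P (1 + (m - 1))" using P_mult[OF x_G t(2)] .
    then have "(v - x * u) + x * (u - y * t) \<in> P m" using u subspace_add[OF P_sub] by simp
    then show "v \<in> mulM (x * y) 2 M m" unfolding mulM_iff using tM by (auto simp: algebra_simps)
  next
    fix v assume "v \<in> mulM (x * y) 2 M m"
    then obtain t where t: "t \<in> M (m - 2)" "v - x * y * t \<in> P m" unfolding mulM_iff by blast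
    have "y * t \<in> M (m - 1)" "x * t \<in> M (m - 1)"
      using gmodD(5)[OF M y_G t(1)] gmodD(5)[OF M x_G t(1)] by simp_all
    moreover have "x * y * t = x * (y * t)" "x * y * t = y * (x * t)" by (simp_all add: mult_ac)
    ultimately show "v \<in> mulM x 1 M m" "v \<in> mulM y 1 M m"
      unfolding mulM_iff using t(2) by metis+
  qed
  have "hf (xyM M) m + hf (\<lambda>m. mulM x 1 M m \<inter> mulM y 1 M m) m = hf (mulM x 1 M) m + hf (mulM y 1 M) m"
    by (rule hf_plus) (use gmod_mulM M x_G y_G in blast)+
  moreover have "hf (\<lambda>m. mulM x 1 M m \<inter> mulM y 1 M m) m = hf (mulM (x * y) 2 M) m"
    unfolding hf_def using Int by simp
  ultimately show ?thesis
    using hf_mulM[OF x_G x_P M, of m] hf_mulM[OF y_G y_P M, of m] hf_mulM[OF xy xyP M, of m] by simp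
qed

lemma hf_convex: "gmod M \<Longrightarrow> xysat M \<Longrightarrow> 2 * hf M (m + 1) \<le> hf M (m + 2) + hf M m"
  using hf_xyM[of M "m + 2"] hf_mono[of M "xyM M" "m + 2"] xyM_subset[of M "m + 2"] by (simp add: algebra_simps)

text \<open>Equality in the convexity estimate leaves no room for new generators in degree
  \<open>m\<close>.\<close>

lemma eq_xyM:
  assumes "gmod M" "xysat M" "2 * hf M (m - 1) = hf M m + hf M (m - 2)"
  shows "M m = xyM M m"
proof (rule ccontr)
  assume "M m \<noteq> xyM M m"
  then have "dim (xyM M m) < dim (M m)"
    using dim_psubset_fin_dim[of "xyM M m" "M m"] xyM_subset[OF assms(1), of m] gmodD[OF assms(1)]
      gmodD(1)[OF gmod_xyM[OF assms(1)]] by blast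
  then show False using hf_xyM[OF assms(1,2), of m] assms(3) unfolding hf_def by simp
qed

lemma G_eq_xyM: "r0 \<le> m \<Longrightarrow> G m = xyM G m"
proof (rule antisym)
  assume r: "r0 \<le> m"
  show "G m \<subseteq> xyM G m"
  proof
    fix v assume "v \<in> G m"
    then obtain u w where uw: "u \<in> G (m - 1)" "w \<in> G (m - 1)" "v - (x * u + y * w) \<in> P m"
      using primary[OF r] by blast
    then have "v - y * w - x * u \<in> P m" by (simp add: algebra_simps)
    then have "v - y * w \<in> mulM x 1 G m" using mulM_iff uw(1) by blast
    moreover have "y * w \<in> mulM y 1 G m" using mulMI[of w G "m - 1" y 1] uw(2) by simp
    ultimately have "v - y * w + y * w \<in> xyM G m" by (rule set_plus_intro)
    then show "v \<in> xyM G m" by simp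
  qed
qed (rule xyM_subset[OF gmod_G])

text \<open>From degree \<open>max r0 0\<close> on the second differences of \<open>hf G\<close>
  vanish, so two values there determine the Hilbert polynomial.\<close>

definition dg :: int where "dg = hf G (max r0 0 + 1) - hf G (max r0 0)"
definition cR :: int where "cR = hf G (max r0 0) - dg * max r0 0"

lemma hf_G_large:
  assumes "max r0 0 \<le> m"
  shows "hf G m = dg * m + cR"
proof -
  have "hf G m = dg * m + cR \<and> hf G (m + 1) = dg * (m + 1) + cR"
    using assms
  proof (induction m rule: int_ge_induct)
    case (step m)
    have "hf G (m + 2) = 2 * hf G (m + 1) - hf G m"
      using hf_xyM[OF gmod_G xysat_G, of "m + 2"] G_eq_xyM[of "m + 2"] step(1) unfolding hf_def
      by (simp add: algebra_simps)
    then show ?case using step by (simp add: algebra_simps)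
  qed (simp add: dg_def cR_def algebra_simps)
  then show ?thesis by blast
qed

text \<open>The slopes of the convex function \<open>hf G\<close> increase. The one at degree 0 is
  at least \<open>hf G 0\<close>, by convexity at degree -1 where the function vanishes, and the
  unit makes \<open>hf G 0\<close> positive.\<close>

lemma dg_pos: "1 \<le> dg"
proof -
  have "hf G (0 + 1) - hf G 0 \<le> hf G (max r0 0 + 1) - hf G (max r0 0)"
  proof (rule int_mono_from_step[where f = "\<lambda>m. hf G (m + 1) - hf G m" and k = 0])
    fix m show "hf G (m + 1) - hf G m \<le> hf G (m + 1 + 1) - hf G (m + 1)"
      using hf_convex[OF gmod_G xysat_G, of m] by (simp add: add.assoc)
  qed auto
  moreover have "2 * hf G 0 \<le> hf G 1"
    using hf_convex[OF gmod_G xysat_G, of "-1"] hf_neg[OF gmod_G, of "-1"] by simp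
  moreover have "0 < hf G 0" using hf_pos[OF gmod_G, of 0] one_G one_P by blast
  ultimately show ?thesis unfolding dg_def by simp
qed

lemma hf_G_bound: "\<exists>C\<ge>0. \<forall>m\<ge>0. \<bar>hf G m - dg * m\<bar> \<le> C"
proof -
  define C where "C = \<bar>cR\<bar> + (\<Sum>m\<in>{0..max r0 0}. \<bar>hf G m - dg * m\<bar>)"
  have "\<bar>hf G m - dg * m\<bar> \<le> C" if "0 \<le> m" for m
  proof (cases "m \<le> max r0 0")
    case True
    then have "\<bar>hf G m - dg * m\<bar> \<le> (\<Sum>m\<in>{0..max r0 0}. \<bar>hf G m - dg * m\<bar>)"
      using that by (intro member_le_sum) auto
    then show ?thesis unfolding C_def by simp
  next
    case False
    then have "\<bar>hf G m - dg * m\<bar> = \<bar>cR\<bar>" using hf_G_large[of m] by (simp add: max_def split: if_splits)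
    then show ?thesis unfolding C_def by (simp add: sum_nonneg)
  qed
  moreover have "0 \<le> C" unfolding C_def by (simp add: sum_nonneg)
  ultimately show ?thesis by blast
qed

end

section \<open>Regularity of saturated submodules\<close>

context graded_surface
begin

definition hC :: int where "hC = (SOME C. 0 \<le> C \<and> (\<forall>m\<ge>0. \<bar>hf G m - dg * m\<bar> \<le> C))"

lemma hC: "0 \<le> hC" "0 \<le> m \<Longrightarrow> \<bar>hf G m - dg * m\<bar> \<le> hC"
proof -
  have "\<exists>C. 0 \<le> C \<and> (\<forall>m\<ge>0. \<bar>hf G m - dg * m\<bar> \<le> C)" using hf_G_bound by blast
  then have "0 \<le> hC \<and> (\<forall>m\<ge>0. \<bar>hf G m - dg * m\<bar> \<le> hC)" unfolding hC_def by (rule someI_ex)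
  then show "0 \<le> hC" "0 \<le> m \<Longrightarrow> \<bar>hf G m - dg * m\<bar> \<le> hC" by blast+
qed

text \<open>The error constant of \<open>convex_growth\<close> for \<open>H = hf G\<close>. It
  depends on the ring alone and therefore bounds errors uniformly over all submodules.\<close>

definition reg :: int where "reg = 2 * hC + dg"

lemma reg_nonneg: "0 \<le> reg" unfolding reg_def using hC(1) dg_pos by simp

definition nonzero :: "(int \<Rightarrow> 's set) \<Rightarrow> bool" where
  "nonzero M \<longleftrightarrow> (\<exists>m. \<exists>v\<in>M m. v \<notin> P m)"

lemma first_degree:
  assumes "gmod M" "nonzero M"
  obtains m0 s where "0 \<le> m0" "s \<in> M m0" "s \<notin> P m0" "\<And>m. m < m0 \<Longrightarrow> M m = P m"
proof -
  have neg: "M m = P m" if "m < 0" for m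
  proof -
    have "P m \<subseteq> M m" "M m \<subseteq> {0}" "0 \<in> P m"
      using gmodD(2,3)[OF assms(1), of m] G_neg[OF that] subspace_0[OF P_sub, of m] by simp_all
    then show ?thesis by auto
  qed
  obtain m v where v: "v \<in> M m" "v \<notin> P m" using assms(2) unfolding nonzero_def by blast
  have "0 \<le> m" using neg v by force
  then have ex: "M (int (nat m)) \<noteq> P (int (nat m))" using v by auto
  define n where "n = (LEAST n. M (int n) \<noteq> P (int n))"
  have n: "M (int n) \<noteq> P (int n)" unfolding n_def by (rule LeastI[of _ "nat m"]) (rule ex)
  have "M k = P k" if "k < int n" for k
  proof (cases "k < 0")
    case False
    then have "nat k < n" using that by simp
    then show ?thesis using not_less_Least[of "nat k" "\<lambda>n. M (int n) \<noteq> P (int n)"] False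
      unfolding n_def by simp
  qed (rule neg)
  moreover obtain s where "s \<in> M (int n)" "s \<notin> P (int n)" using n gmodD(2)[OF assms(1)] by blast
  ultimately show ?thesis using that[of "int n" s] by simp
qed

lemma mulM_element_subset: "gmod M \<Longrightarrow> s \<in> M k \<Longrightarrow> mulM s k G m \<subseteq> M m"
proof
  fix v assume M: "gmod M" and s: "s \<in> M k" and "v \<in> mulM s k G m"
  then obtain u where u: "u \<in> G (m - k)" "v - s * u \<in> P m" unfolding mulM_iff by blast
  have "u * s \<in> M m" using gmodD(5)[OF M u(1) s] by simp
  then have "u * s + (v - s * u) \<in> M m" using u gmodD(2)[OF M] subspace_add[OF gmodD(1)[OF M]] by blast
  then show "v \<in> M m" by (simp add: algebra_simps)
qed

text \<open>An element \<open>s\<close> of least degree outside \<open>P\<close> embeds a copy of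
  \<open>G\<close> shifted by \<open>m0\<close>; together with the inclusion of \<open>M\<close> in
  \<open>G\<close> and convexity this is the situation of \<open>convex_growth\<close>. The error
  \<open>reg\<close> is the same for every \<open>M\<close>.\<close>

lemma regularity:
  assumes M: "gmod M" "xysat M" "nonzero M"
  obtains m0 s c where "0 \<le> m0" "s \<in> M m0" "s \<notin> P m0" "\<And>m. m < m0 \<Longrightarrow> M m = P m"
    "\<bar>c + dg * m0\<bar> \<le> reg" "\<And>m. m0 \<le> m \<Longrightarrow> \<bar>hf M m - dg * (m - m0)\<bar> \<le> reg"
    "\<And>m. m0 + reg \<le> m \<Longrightarrow> hf M m = dg * m + c"
proof -
  obtain m0 s where m0: "0 \<le> m0" "s \<in> M m0" "s \<notin> P m0" "\<And>m. m < m0 \<Longrightarrow> M m = P m"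
    using first_degree[OF M(1,3)] by blast
  have s: "s \<in> G m0" using m0 gmodD(3)[OF M(1)] by blast
  have "\<exists>c. \<bar>c + dg * m0\<bar> \<le> 2 * hC + dg \<and> (\<forall>m\<ge>m0. \<bar>hf M m - dg * (m - m0)\<bar> \<le> 2 * hC + dg)
      \<and> (\<forall>m\<ge>m0 + (2 * hC + dg). hf M m = dg * m + c)"
  proof (rule convex_growth[where H = "hf G"])
    fix m show "2 * hf M (m + 1) \<le> hf M (m + 2) + hf M m" using hf_convex M by blast
    show "0 \<le> hf M m" using hf_nonneg M by blast
    show "hf M m \<le> hf G m" using hf_mono[OF gmod_G] gmodD(3) M by blast
    show "hf G (m - m0) \<le> hf M m" if "m0 \<le> m"
      using hf_mulM[OF s m0(3) gmod_G, of m] hf_mono[of M "mulM s m0 G" m] mulM_element_subset[OF M(1) m0(2), of m] M(1) by simp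
    show "hf M m = 0" if "m < m0" using m0(4)[OF that] unfolding hf_def by simp
    show "\<bar>hf G m - dg * m\<bar> \<le> hC" if "0 \<le> m" using hC(2)[OF that] .
  qed (use m0 dg_pos in auto)
  then show ?thesis using that m0 unfolding reg_def by blast
qed

text \<open>\<open>c\<close> is the constant term of the Hilbert polynomial of \<open>M / P\<close>;
  geometrically \<open>c - cR\<close> is the degree of the associated ideal sheaf.\<close>

definition evc :: "(int \<Rightarrow> 's set) \<Rightarrow> int \<Rightarrow> bool" where
  "evc M c \<longleftrightarrow> (\<exists>N. \<forall>m\<ge>N. hf M m = dg * m + c)"

lemma evc_G: "evc G cR" unfolding evc_def using hf_G_large by blast

lemma evc_mono:
  assumes "gmod N" "\<And>m. M m \<subseteq> N m" "evc M c" "evc N c'"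
  shows "c \<le> c'"
proof -
  obtain k l where "\<forall>m\<ge>k. hf M m = dg * m + c" "\<forall>m\<ge>l. hf N m = dg * m + c'"
    using assms(3,4) unfolding evc_def by blast
  then have "hf M (max k l) = dg * max k l + c" "hf N (max k l) = dg * max k l + c'" by (metis max.cobounded1 max.cobounded2)+
  then show ?thesis using hf_mono[OF assms(1), of M "max k l"] assms(2)[of "max k l"] by simp
qed

lemma evc_unique:
  assumes "evc M c" "evc M c'"
  shows "c = c'"
proof -
  obtain k l where "\<forall>m\<ge>k. hf M m = dg * m + c" "\<forall>m\<ge>l. hf M m = dg * m + c'"
    using assms unfolding evc_def by blast
  then have "hf M (max k l) = dg * max k l + c" "hf M (max k l) = dg * max k l + c'" by (metis max.cobounded1 max.cobounded2)+
  then show ?thesis by simp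
qed

lemma evc_mulM:
  assumes "f \<in> G a" "f \<notin> P a" "gmod M" "evc M c"
  shows "evc (mulM f a M) (c - dg * a)"
proof -
  obtain k where "\<forall>m\<ge>k. hf M m = dg * m + c" using assms unfolding evc_def by blast
  then show ?thesis unfolding evc_def hf_mulM[OF assms(1-3)]
    by (intro exI[of _ "k + a"]) (auto simp: algebra_simps)
qed

lemma evc_plus:
  assumes "gmod M" "gmod N" "evc M c1" "evc N c2" "evc (\<lambda>m. M m \<inter> N m) c3"
  shows "evc (\<lambda>m. M m + N m) (c1 + c2 - c3)"
proof -
  obtain k l n where "\<forall>m\<ge>k. hf M m = dg * m + c1" "\<forall>m\<ge>l. hf N m = dg * m + c2"
    "\<forall>m\<ge>n. hf (\<lambda>m. M m \<inter> N m) m = dg * m + c3"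
    using assms unfolding evc_def by blast
  moreover have "hf (\<lambda>m. M m + N m) m = hf M m + hf N m - hf (\<lambda>m. M m \<inter> N m) m" for m
    using hf_plus[OF assms(1,2), of m] by simp
  ultimately show ?thesis unfolding evc_def by (intro exI[of _ "max k (max l n)"]) simp
qed

section \<open>Saturation\<close>

definition sat :: "(int \<Rightarrow> 's set) \<Rightarrow> int \<Rightarrow> 's set" where
  "sat M m = {v \<in> G m. \<exists>t. \<forall>d\<ge>t. \<forall>a\<in>G d. a * v \<in> M (d + m)}"

lemma sat_superset: "gmod M \<Longrightarrow> M m \<subseteq> sat M m"
  unfolding sat_def using gmodD(3,5) by blast

lemma gmod_sat:
  assumes M: "gmod M"
  shows "gmod (sat M)"
  unfolding gmod_def
proof (intro allI conjI impI)
  fix m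
  show "subspace (sat M m)"
  proof (rule subspaceI)
    show "0 \<in> sat M m" using sat_superset[OF M] subspace_0[OF gmodD(1)[OF M]] by blast
  next
    fix u v assume "u \<in> sat M m" "v \<in> sat M m"
    then obtain s t where uv: "u \<in> G m" "v \<in> G m" "\<forall>d\<ge>s. \<forall>a\<in>G d. a * u \<in> M (d + m)" 
      "\<forall>d\<ge>t. \<forall>a\<in>G d. a * v \<in> M (d + m)" unfolding sat_def by blast
    have "\<forall>d\<ge>max s t. \<forall>a\<in>G d. a * (u + v) \<in> M (d + m)"
      using uv subspace_add[OF gmodD(1)[OF M]] by (simp add: distrib_left)
    then show "u + v \<in> sat M m" unfolding sat_def using uv subspace_add[OF G_sub] by blast
  next
    fix c u assume "u \<in> sat M m"
    then obtain s where u: "u \<in> G m" "\<forall>d\<ge>s. \<forall>a\<in>G d. a * u \<in> M (d + m)" unfolding sat_def by blast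
    then have "\<forall>d\<ge>s. \<forall>a\<in>G d. a * scale c u \<in> M (d + m)"
      using subspace_scale[OF gmodD(1)[OF M]] by (simp add: scale_mult)
    then show "scale c u \<in> sat M m" unfolding sat_def using u subspace_scale[OF G_sub] by blast
  qed
  show "P m \<subseteq> sat M m" using sat_superset[OF M] gmodD(2)[OF M] by blast
  show "sat M m \<subseteq> G m" unfolding sat_def by blast
  fix i b u assume b: "b \<in> G i" and "u \<in> sat M m"
  then obtain s where u: "u \<in> G m" "\<And>d a. d \<ge> s \<Longrightarrow> a \<in> G d \<Longrightarrow> a * u \<in> M (d + m)"
    unfolding sat_def by blast
  have "a * (b * u) \<in> M (d + (i + m))" if "s - i \<le> d" "a \<in> G d" for a d
    using u(2)[of "d + i" "a * b"] G_mult[OF that(2) b] that by (simp add: algebra_simps)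
  then show "b * u \<in> sat M (i + m)" unfolding sat_def using u G_mult[OF b] by blast
qed

text \<open>A form \<open>a\<close> of high degree is \<open>x u + y w\<close> modulo
  \<open>P\<close> by \<open>primary\<close>, so \<open>a v\<close> is controlled by
  \<open>x v\<close> and \<open>y v\<close>.\<close>

lemma xysat_sat:
  assumes M: "gmod M"
  shows "xysat (sat M)"
  unfolding xysat_def
proof (intro allI ballI impI)
  fix m v assume v: "v \<in> G m" and "x * v \<in> sat M (m + 1)" "y * v \<in> sat M (m + 1)"
  then obtain s t where st: "\<And>d a. d \<ge> s \<Longrightarrow> a \<in> G d \<Longrightarrow> a * (x * v) \<in> M (d + (m + 1))"
    "\<And>d a. d \<ge> t \<Longrightarrow> a \<in> G d \<Longrightarrow> a * (y * v) \<in> M (d + (m + 1))"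
    unfolding sat_def by blast
  have "a * v \<in> M (d + m)" if d: "max r0 (max s t + 1) \<le> d" and a: "a \<in> G d" for a d
  proof -
    obtain u w where uw: "u \<in> G (d - 1)" "w \<in> G (d - 1)" "a - (x * u + y * w) \<in> P d"
      using primary[of d a] d a by auto
    have "v * (a - (x * u + y * w)) \<in> M (m + d)" using P_mult[OF v uw(3)] gmodD(2)[OF M] by blast
    moreover have "u * (x * v) \<in> M (m + d)" "w * (y * v) \<in> M (m + d)"
      using st(1)[OF _ uw(1)] st(2)[OF _ uw(2)] d by (force simp: add.commute)+
    ultimately have "v * (a - (x * u + y * w)) + (u * (x * v) + w * (y * v)) \<in> M (m + d)"
      using subspace_add[OF gmodD(1)[OF M]] by blast
    then show ?thesis by (simp add: algebra_simps)
  qed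
  then show "v \<in> sat M m" unfolding sat_def using v by blast
qed

lemma nonzero_mono: "nonzero M \<Longrightarrow> (\<And>m. M m \<subseteq> N m) \<Longrightarrow> nonzero N"
  unfolding nonzero_def by blast

lemma nonzero_sat: "gmod M \<Longrightarrow> nonzero M \<Longrightarrow> nonzero (sat M)"
  using nonzero_mono sat_superset by blast

text \<open>From some degree \<open>n\<close> on the Hilbert function of \<open>sat M\<close> is
  linear, so by \<open>eq_xyM\<close> all later degrees are generated by degree \<open>n\<close>.
  That part is finite-dimensional, so a single bound \<open>t\<close> serves all of its
  elements.\<close>

lemma sat_eventually:
  assumes M: "gmod M" "nonzero M"
  obtains N where "\<And>m. N \<le> m \<Longrightarrow> sat M m = M m"
proof -
  define J where "J = sat M"
  note J = gmod_sat[OF M(1), folded J_def] xysat_sat[OF M(1), folded J_def] nonzero_sat[OF M, folded J_def]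
  obtain k c where k: "\<And>m. k \<le> m \<Longrightarrow> hf J m = dg * m + c"
    using regularity[OF J] by metis
  have gen: "J m = xyM J m" if "k + 2 \<le> m" for m
    by (rule eq_xyM[OF J(1,2)]) (use k[of m] k[of "m - 1"] k[of "m - 2"] that in \<open>simp add: algebra_simps\<close>)
  define n where "n = k + 2"
  obtain B where B: "finite B" "span B = J n" using fin_dim_basis[OF gmodD(1,4)[OF J(1)]] by metis
  have "\<forall>v\<in>B. \<exists>t. \<forall>d\<ge>t. \<forall>a\<in>G d. a * v \<in> M (d + n)"
    using B(2) span_superset[of B] unfolding J_def sat_def by blast
  then obtain T where T: "\<And>v d a. v \<in> B \<Longrightarrow> T v \<le> d \<Longrightarrow> a \<in> G d \<Longrightarrow> a * v \<in> M (d + n)" by metis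
  define t where "t = (\<Sum>v\<in>B. \<bar>T v\<bar>)"
  have Tt: "T v \<le> t" if "v \<in> B" for v
  proof -
    have "\<bar>T v\<bar> \<le> t" unfolding t_def by (rule member_le_sum) (use that B in auto)
    then show ?thesis by simp
  qed
  have base: "a * v \<in> M (d + n)" if d: "t \<le> d" "a \<in> G d" and v: "v \<in> J n" for a v d
  proof -
    have "subspace {v. a * v \<in> M (d + n)}"
      using gmodD(1)[OF M(1)] by (intro subspaceI) (auto simp: distrib_left scale_mult subspace_0 subspace_add subspace_scale)
    moreover have "B \<subseteq> {v. a * v \<in> M (d + n)}" using T[OF _ _ d(2)] Tt d(1) by fastforce
    ultimately show ?thesis using span_minimal v B(2) by blast
  qed
  \<comment> \<open>Factors \<open>x\<close> and \<open>y\<close> are moved from \<open>v\<close> to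
    \<open>a\<close>: \<open>d\<close> grows as \<open>j\<close> drops, and only their sum has to
    reach \<open>t\<close>. The case \<open>a = 1\<close>, \<open>d = 0\<close> is the one used in
    the end.\<close>
  have main: "a * v \<in> M (d + (n + int j))" if "t \<le> d + int j" "a \<in> G d" "v \<in> J (n + int j)" for a v d j
    using that
  proof (induction j arbitrary: a v d)
    case 0
    then show ?case using base by simp
  next
    case (Suc j)
    have "v \<in> xyM J (n + int (Suc j))" using gen[of "n + int (Suc j)"] Suc.prems(3) unfolding n_def by simp
    then obtain v1 v2 where v: "v = v1 + v2" "v1 \<in> mulM x 1 J (n + int (Suc j))" "v2 \<in> mulM y 1 J (n + int (Suc j))"
      by (auto elim: set_plus_elim)
    have *: "a * v' \<in> M (d + (n + int (Suc j)))"
      if z: "z \<in> G 1" and v': "v' \<in> mulM z 1 J (n + int (Suc j))" for z v'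
    proof -
      obtain u where u: "u \<in> J (n + int j)" "v' - z * u \<in> P (n + int (Suc j))"
        using v' unfolding mulM_iff by auto
      have "a * (v' - z * u) \<in> M (d + (n + int (Suc j)))"
        using P_mult[OF Suc.prems(2) u(2)] gmodD(2)[OF M(1)] by blast
      moreover have "a * z * u \<in> M ((d + 1) + (n + int j))"
        by (rule Suc.IH) (use Suc.prems G_mult[OF _ z] u in auto)
      then have "a * z * u \<in> M (d + (n + int (Suc j)))" by (simp add: ac_simps)
      ultimately have "a * (v' - z * u) + a * z * u \<in> M (d + (n + int (Suc j)))"
        using subspace_add[OF gmodD(1)[OF M(1)]] by blast
      then show ?thesis by (simp add: algebra_simps)
    qed
    show ?case unfolding v(1) distrib_left
      by (intro subspace_add gmodD(1)[OF M(1)] *[OF x_G v(2)] *[OF y_G v(3)])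
  qed
  have "sat M m = M m" if m: "n + \<bar>t\<bar> \<le> m" for m
  proof
    show "sat M m \<subseteq> M m"
    proof
      fix v assume v: "v \<in> sat M m"
      have "1 * v \<in> M (0 + (n + int (nat (m - n))))"
        by (rule main) (use m v one_G in \<open>auto simp: J_def\<close>)
      moreover have "n + int (nat (m - n)) = m" using m by simp
      ultimately show "v \<in> M m" by simp
    qed
  qed (rule sat_superset[OF M(1)])
  then show ?thesis using that by blast
qed

lemma evc_sat:
  assumes "gmod M" "nonzero M"
  shows "evc M c \<longleftrightarrow> evc (sat M) c"
proof -
  obtain N where N: "\<And>m. N \<le> m \<Longrightarrow> sat M m = M m" using sat_eventually[OF assms] by blast
  then have *: "hf (sat M) m = hf M m" if "N \<le> m" for m using that unfolding hf_def by simp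
  show ?thesis unfolding evc_def
  proof
    assume "\<exists>k. \<forall>m\<ge>k. hf M m = dg * m + c"
    then obtain k where "\<forall>m\<ge>k. hf M m = dg * m + c" by blast
    then show "\<exists>k. \<forall>m\<ge>k. hf (sat M) m = dg * m + c" using * by (intro exI[of _ "max k N"]) simp
  next
    assume "\<exists>k. \<forall>m\<ge>k. hf (sat M) m = dg * m + c"
    then obtain k where "\<forall>m\<ge>k. hf (sat M) m = dg * m + c" by blast
    then show "\<exists>k. \<forall>m\<ge>k. hf M m = dg * m + c" using * by (intro exI[of _ "max k N"]) force
  qed
qed

lemma evc_exists:
  assumes "gmod M" "nonzero M"
  obtains c where "evc M c"
proof -
  obtain c where "evc (sat M) c"
    using regularity[OF gmod_sat[OF assms(1)] xysat_sat[OF assms(1)] nonzero_sat[OF assms]]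
    unfolding evc_def by metis
  then show ?thesis using that evc_sat[OF assms] by blast
qed

abbreviation pr :: "'s \<Rightarrow> int \<Rightarrow> int \<Rightarrow> 's set" where "pr h d \<equiv> mulM h d G"

text \<open>From \<open>x v = h u\<close> and \<open>y v = h w\<close> modulo \<open>P\<close>,
  cancelling \<open>h\<close> gives \<open>x w = y u\<close>. The Koszul relation then yields
  \<open>u = x t\<close>, and cancelling \<open>x\<close> shows \<open>v = h t\<close>.\<close>

lemma xysat_pr:
  assumes h: "h \<in> G d" "h \<notin> P d"
  shows "xysat (pr h d)"
  unfolding xysat_def
proof (intro allI ballI impI)
  fix m v assume v: "v \<in> G m" and "x * v \<in> pr h d (m + 1)" "y * v \<in> pr h d (m + 1)"
  then obtain u w where u: "u \<in> G (m + 1 - d)" "x * v - h * u \<in> P (m + 1)"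
    and w: "w \<in> G (m + 1 - d)" "y * v - h * w \<in> P (m + 1)" unfolding mulM_iff by blast
  have "y * (x * v - h * u) - x * (y * v - h * w) \<in> P (1 + (m + 1))"
    using P_mult[OF y_G u(2)] P_mult[OF x_G w(2)] subspace_diff[OF P_sub] by blast
  then have "h * (x * w - y * u) \<in> P (d + (m + 1 - d + 1))" by (simp add: algebra_simps)
  moreover have "x * w - y * u \<in> G (m + 1 - d + 1)"
    using G_mult[OF x_G w(1)] G_mult[OF y_G u(1)] subspace_diff[OF G_sub] by (simp add: add.commute)
  ultimately have "x * w - y * u \<in> P (m + 1 - d + 1)" using P_cancel[OF h] by blast
  then obtain t where t: "t \<in> G (m + 1 - d - 1)" "u - x * t \<in> P (m + 1 - d)" using koszul[OF w(1) u(1)] by blast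
  have "h * (u - x * t) \<in> P (m + 1)" using P_mult[OF h(1) t(2)] by simp
  then have "(x * v - h * u) + h * (u - x * t) \<in> P (m + 1)" using u(2) subspace_add[OF P_sub] by blast
  then have "x * (v - h * t) \<in> P (1 + m)" by (simp add: algebra_simps)
  moreover have tG: "t \<in> G (m - d)" using t(1) by simp
  moreover have "v - h * t \<in> G m" using v G_mult[OF h(1) tG] subspace_diff[OF G_sub] by simp
  ultimately have "v - h * t \<in> P m" using P_cancel[OF x_G x_P] by blast
  then show "v \<in> pr h d m" unfolding mulM_iff using tG by blast
qed

lemma pow_G: "f \<in> G a \<Longrightarrow> f ^ q \<in> G (int q * a)"
proof (induction q)
  case (Suc q)
  then show ?case using G_mult[of f a "f ^ q" "int q * a"] by (simp add: algebra_simps)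
qed (simp add: one_G)

lemma pow_P: "f \<in> G a \<Longrightarrow> f \<notin> P a \<Longrightarrow> f ^ q \<notin> P (int q * a)"
proof (induction q)
  case (Suc q)
  then show ?case using P_prime[of f a "f ^ q" "int q * a"] pow_G[of f a q] by (auto simp: algebra_simps)
qed (simp add: one_P)

lemma self_pr: "h \<in> pr h d d"
  using mulMI[of 1 G 0 h d] one_G by simp

lemma evc_pr: "h \<in> G d \<Longrightarrow> h \<notin> P d \<Longrightarrow> evc (pr h d) (cR - dg * d)"
  using evc_mulM gmod_G evc_G by blast

lemma mulM_mult:
  assumes "h \<in> G d" "v \<in> mulM k e M m"
  shows "h * v \<in> mulM (h * k) (d + e) M (d + m)"
proof -
  obtain u where u: "u \<in> M (m - e)" "v - k * u \<in> P m" using assms(2) unfolding mulM_iff by blast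
  have "h * v - h * k * u \<in> P (d + m)" using P_mult[OF assms(1) u(2)] by (simp add: algebra_simps)
  then show ?thesis unfolding mulM_iff using u(1) by (auto intro!: bexI[of _ u])
qed

end

section \<open>Ideals generated by powers of two forms\<close>

lemma int_mono_bounded_eventually_const:
  fixes f :: "nat \<Rightarrow> int"
  assumes "\<And>n. f n \<le> f (Suc n)" "\<And>n. f n \<le> b"
  shows "\<exists>k c. \<forall>n\<ge>k. f n = c"
proof -
  obtain k where k: "\<And>n. nat (b - f k) \<le> nat (b - f n)"
    using ex_has_least_nat[of "\<lambda>_. True" _ "\<lambda>n. nat (b - f n)"] by blast
  have "f n = f k" if "k \<le> n" for n
    using k[of n] assms(2)[of n] assms(2)[of k] lift_Suc_mono_le[of f k n] assms(1) that by simp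
  then show ?thesis by blast
qed

locale two_forms = graded_surface scale G P x y r0
  for scale :: "'k::field \<Rightarrow> 's::idom \<Rightarrow> 's" and G P :: "int \<Rightarrow> 's set" and x y :: 's and r0 :: int +
  fixes f g :: 's and a b :: int
  assumes f_G: "f \<in> G a" and f_P: "f \<notin> P a" and g_G: "g \<in> G b" and g_P: "g \<notin> P b"
begin

lemma ab_nonneg: "0 \<le> a" "0 \<le> b"
  using f_G f_P g_G g_P G_neg[of a] G_neg[of b] subspace_0[OF P_sub] by force+

abbreviation fq :: "nat \<Rightarrow> int \<Rightarrow> 's set" where "fq q \<equiv> pr (f ^ q) (int q * a)"
abbreviation gq :: "nat \<Rightarrow> int \<Rightarrow> 's set" where "gq q \<equiv> pr (g ^ q) (int q * b)"

lemmas fq_GP = pow_G[OF f_G] pow_P[OF f_G f_P]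
lemmas gq_GP = pow_G[OF g_G] pow_P[OF g_G g_P]

lemma gmod_fq: "gmod (fq q)" and gmod_gq: "gmod (gq q)"
  using gmod_mulM gmod_G fq_GP gq_GP by blast+

definition Iq :: "nat \<Rightarrow> int \<Rightarrow> 's set" where "Iq q m = fq q m + gq q m"
definition Kq :: "nat \<Rightarrow> int \<Rightarrow> 's set" where "Kq q m = fq q m \<inter> gq q m"

lemma gmod_Iq: "gmod (Iq q)" and gmod_Kq: "gmod (Kq q)"
  unfolding Iq_def Kq_def by (intro gmod_plus gmod_Int gmod_fq gmod_gq)+

lemma fq_Iq: "fq q m \<subseteq> Iq q m" and gq_Iq: "gq q m \<subseteq> Iq q m"
  unfolding Iq_def using subset_plus[OF gmod_fq gmod_gq] by blast+

lemma fpow_Iq: "f ^ q \<in> Iq q (int q * a)" and gpow_Iq: "g ^ q \<in> Iq q (int q * b)"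
  using fq_Iq gq_Iq self_pr by blast+

lemma nonzero_Iq: "nonzero (Iq q)"
  unfolding nonzero_def using fpow_Iq fq_GP by blast

text \<open>Intersections inherit saturation from principal submodules. Regularity thus applies to
  \<open>Kq\<close>, and through \<open>hf_plus\<close> it controls the submodule \<open>Iq\<close>,
  which need not be saturated.\<close>

lemma xysat_Kq: "xysat (Kq q)"
  unfolding Kq_def by (intro xysat_Int xysat_pr fq_GP gq_GP)

lemma fgpow_Kq: "f ^ q * g ^ q \<in> Kq q (int q * (a + b))" "f ^ q * g ^ q \<notin> P (int q * (a + b))"
proof -
  have "f ^ q * g ^ q \<in> fq q (int q * a + int q * b)" 
    using mulMI[of "g ^ q" G "int q * b" "f ^ q" "int q * a"] gq_GP by (simp add: add.commute)
  moreover have "f ^ q * g ^ q \<in> gq q (int q * a + int q * b)"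
    using mulMI[of "f ^ q" G "int q * a" "g ^ q" "int q * b"] fq_GP by (simp add: mult.commute)
  ultimately show "f ^ q * g ^ q \<in> Kq q (int q * (a + b))" unfolding Kq_def by (simp add: distrib_left)
  show "f ^ q * g ^ q \<notin> P (int q * (a + b))"
    using P_prime[OF fq_GP(1)[of q] gq_GP(1)[of q]] fq_GP(2)[of q] gq_GP(2)[of q]
    by (auto simp: distrib_left)
qed

lemma nonzero_Kq: "nonzero (Kq q)"
  unfolding nonzero_def using fgpow_Kq by blast

text \<open>The power \<open>(f, g)^n\<close>, written so that each step adds to
  \<open>f W n\<close> just the one generator \<open>g^(n+1)\<close>.\<close>

primrec W :: "nat \<Rightarrow> int \<Rightarrow> 's set" where
  "W 0 = G"
| "W (Suc n) = (\<lambda>m. mulM f a (W n) m + gq (Suc n) m)"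

lemma gmod_W: "gmod (W n)"
proof (induction n)
  case (Suc n)
  then show ?case unfolding W.simps by (intro gmod_plus gmod_mulM f_G gmod_gq)
qed (simp add: gmod_G)

lemma W_Suc_superset: "mulM f a (W n) m \<subseteq> W (Suc n) m" "gq (Suc n) m \<subseteq> W (Suc n) m"
  unfolding W.simps by (intro subset_plus gmod_mulM f_G gmod_W gmod_gq)+

lemma W_Suc_f: "u \<in> W n m \<Longrightarrow> f * u \<in> W (Suc n) (m + a)"
  using mulMI[of u "W n" m f a] W_Suc_superset(1) by blast

lemma W_gpow: "u \<in> G m \<Longrightarrow> g ^ n * u \<in> W n (m + int n * b)"
proof (cases n)
  case (Suc k)
  assume "u \<in> G m"
  then show ?thesis unfolding Suc
    using mulMI[of u G m "g ^ Suc k" "int (Suc k) * b"] W_Suc_superset(2) by blast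
qed simp

lemma W_Suc_cases:
  assumes "u \<in> W (Suc n) m"
  obtains v w p where "u = f * v + g ^ Suc n * w + p" "v \<in> W n (m - a)" "w \<in> G (m - int (Suc n) * b)" "p \<in> P m"
proof -
  obtain u1 u2 where u: "u = u1 + u2" "u1 \<in> mulM f a (W n) m" "u2 \<in> gq (Suc n) m"
    using assms by (auto elim: set_plus_elim)
  obtain v where v: "v \<in> W n (m - a)" "u1 - f * v \<in> P m" using u(2) unfolding mulM_iff by blast
  obtain w where w: "w \<in> G (m - int (Suc n) * b)" "u2 - g ^ Suc n * w \<in> P m"
    using u(3) unfolding mulM_iff by blast
  show ?thesis
    by (rule that[OF _ v(1) w(1) subspace_add[OF P_sub v(2) w(2)]]) (simp add: u(1))
qed

text \<open>The recursion provides multiplication by \<open>f\<close> only; multiplication by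
  \<open>g\<close> is pushed down to the pure powers by induction.\<close>

lemma W_Suc_g: "u \<in> W n m \<Longrightarrow> g * u \<in> W (Suc n) (m + b)"
proof (induction n arbitrary: u m)
  case 0
  then show ?case using W_gpow[of u m 1] by simp
next
  case (Suc n)
  obtain v w p where u: "u = f * v + g ^ Suc n * w + p" "v \<in> W n (m - a)"
    "w \<in> G (m - int (Suc n) * b)" "p \<in> P m"
    using W_Suc_cases[OF Suc.prems] by blast
  have "f * (g * v) \<in> W (Suc (Suc n)) (m + b)" using W_Suc_f[OF Suc.IH[OF u(2)]] by simp
  moreover have "g ^ Suc (Suc n) * w \<in> W (Suc (Suc n)) (m + b)"
    using W_gpow[OF u(3), of "Suc (Suc n)"] by (simp add: algebra_simps)
  moreover have "g * p \<in> W (Suc (Suc n)) (m + b)"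
    using P_mult[OF g_G u(4)] gmodD(2)[OF gmod_W] by (simp add: add.commute subset_iff del: W.simps)
  ultimately have "f * (g * v) + g ^ Suc (Suc n) * w + g * p \<in> W (Suc (Suc n)) (m + b)"
    using subspace_add[OF gmodD(1)[OF gmod_W]] by blast
  then show ?case unfolding u(1) by (simp add: algebra_simps del: W.simps)
qed

text \<open>A monomial \<open>f^i g^k\<close> with \<open>i + k = n + j + 1\<close> has
  \<open>i > j\<close> or \<open>k > n\<close>. For \<open>j = n\<close> both thresholds become
  \<open>n + 1\<close>.\<close>

lemma W_split:
  "W (n + Suc j) m \<subseteq> mulM (f ^ Suc j) (int (Suc j) * a) (W n) m + mulM (g ^ Suc n) (int (Suc n) * b) (W j) m"
proof (induction j arbitrary: m)
  case (Suc j)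
  define R where "R m = mulM (f ^ Suc (Suc j)) (int (Suc (Suc j)) * a) (W n) m
    + mulM (g ^ Suc n) (int (Suc n) * b) (W (Suc j)) m" for m
  note gm = gmod_mulM[OF fq_GP(1)[of "Suc (Suc j)"] gmod_W[of n]] gmod_mulM[OF gq_GP(1)[of "Suc n"] gmod_W[of "Suc j"]]
  have R: "gmod R" unfolding R_def using gmod_plus[OF gm] .
  have R1: "mulM (f ^ Suc (Suc j)) (int (Suc (Suc j)) * a) (W n) m \<subseteq> R m"
    and R2: "mulM (g ^ Suc n) (int (Suc n) * b) (W (Suc j)) m \<subseteq> R m" for m
    unfolding R_def using subset_plus[OF gm] .
  show ?case
  proof
    fix u assume "u \<in> W (n + Suc (Suc j)) m"
    then have "u \<in> W (Suc (n + Suc j)) m" by (simp del: W.simps)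
    then obtain v w p where u: "u = f * v + g ^ Suc (n + Suc j) * w + p" "v \<in> W (n + Suc j) (m - a)"
      "w \<in> G (m - int (Suc (n + Suc j)) * b)" "p \<in> P m"
      using W_Suc_cases by blast
    obtain v1 v2 where v: "v = v1 + v2" "v1 \<in> mulM (f ^ Suc j) (int (Suc j) * a) (W n) (m - a)"
      "v2 \<in> mulM (g ^ Suc n) (int (Suc n) * b) (W j) (m - a)"
      using set_plus_elim[OF subsetD[OF Suc.IH u(2)]] by metis
    have "f * v1 \<in> R m"
      using mulM_mult[OF f_G v(2)] R1[of m] by (auto simp: algebra_simps)
    moreover have "f * v2 \<in> R m"
    proof -
      obtain t where t: "t \<in> W j (m - a - int (Suc n) * b)" "v2 - g ^ Suc n * t \<in> P (m - a)"
        using v(3) unfolding mulM_iff by blast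
      have "f * t \<in> W (Suc j) (m - int (Suc n) * b)" using W_Suc_f[OF t(1)] by (simp add: algebra_simps del: W.simps)
      moreover have "f * v2 - g ^ Suc n * (f * t) \<in> P m"
        using P_mult[OF f_G t(2)] by (simp add: algebra_simps)
      ultimately show ?thesis using R2 mulM_iff by blast
    qed
    moreover have "g ^ Suc (n + Suc j) * w \<in> R m"
    proof -
      have "m - int (Suc (n + Suc j)) * b + int (Suc j) * b = m - int (Suc n) * b" by (simp add: algebra_simps)
      then have "g ^ Suc j * w \<in> W (Suc j) (m - int (Suc n) * b)" using W_gpow[OF u(3), of "Suc j"] by metis
      from mulMI[of "g ^ Suc j * w" "W (Suc j)", OF this, of "g ^ Suc n" "int (Suc n) * b"]
      have "g ^ Suc n * (g ^ Suc j * w) \<in> R m" using R2[of m] by (simp add: subset_iff del: W.simps power_Suc)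
      then show ?thesis by (simp add: power_add ac_simps)
    qed
    moreover have "p \<in> R m" using u(4) gmodD(2)[OF R] by blast
    ultimately have "f * v1 + f * v2 + g ^ Suc (n + Suc j) * w + p \<in> R m"
      using subspace_add[OF gmodD(1)[OF R]] by blast
    then show "u \<in> mulM (f ^ Suc (Suc j)) (int (Suc (Suc j)) * a) (W n) m
        + mulM (g ^ Suc n) (int (Suc n) * b) (W (Suc j)) m"
      unfolding R_def[symmetric] u(1) v(1) by (simp only: distrib_left)
  qed
qed simp

lemma fpow_W: "f ^ n \<in> W n (int n * a)"
proof (induction n)
  case (Suc n)
  then show ?case using W_Suc_f[OF Suc.IH] by (simp add: algebra_simps del: W.simps)
qed (simp add: one_G)

lemma nonzero_W: "nonzero (W n)"
  unfolding nonzero_def using fpow_W fq_GP by blast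

lemma Iq_W: "Iq n m \<subseteq> W n m"
  unfolding Iq_def
proof (intro plus_subset gmod_W mulM_element_subset fpow_W)
  show "g ^ n \<in> W n (int n * b)" using W_gpow[OF one_G, of n] by simp
qed

text \<open>The colon of \<open>f W n\<close> by \<open>g^(n+1)\<close>.\<close>

definition A :: "nat \<Rightarrow> int \<Rightarrow> 's set" where
  "A n m = {v \<in> G m. g ^ Suc n * v \<in> mulM f a (W n) (m + int (Suc n) * b)}"

lemma gmod_A: "gmod (A n)"
  unfolding gmod_def
proof (intro allI conjI impI)
  fix m
  let ?M = "mulM f a (W n)"
  have M: "gmod ?M" using gmod_mulM[OF f_G gmod_W] .
  show "subspace (A n m)" unfolding A_def
    using subspace_0[OF gmodD(1)[OF M]] subspace_add[OF gmodD(1)[OF M]] subspace_scale[OF gmodD(1)[OF M]]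
      subspace_0[OF G_sub] subspace_add[OF G_sub] subspace_scale[OF G_sub]
    by (intro subspaceI) (simp_all add: distrib_left scale_mult)
  have "g ^ Suc n * p \<in> P (m + int (Suc n) * b)" if "p \<in> P m" for p
    using P_mult[OF gq_GP(1) that, of "Suc n"] by (simp only: add.commute)
  then show "P m \<subseteq> A n m" unfolding A_def using P_G gmodD(2)[OF M] by blast
  show "A n m \<subseteq> G m" unfolding A_def by blast
  fix i c v assume c: "c \<in> G i" and v: "v \<in> A n m"
  have "c * (g ^ Suc n * v) \<in> ?M (i + (m + int (Suc n) * b))"
    using gmodD(5)[OF M c] v unfolding A_def by blast
  moreover have "c * v \<in> G (i + m)" using G_mult[OF c] v unfolding A_def by blast
  ultimately show "c * v \<in> A n (i + m)" unfolding A_def by (simp add: ac_simps)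
qed

lemma nonzero_A: "nonzero (A n)"
proof -
  have "g * g ^ n \<in> W n (b + int n * b)"
    using gmodD(5)[OF gmod_W g_G, of "g ^ n" n "int n * b"] W_gpow[OF one_G, of n] by simp
  then have "g ^ Suc n \<in> W n (int (Suc n) * b)" by (simp add: distrib_right)
  from mulMI[of "g ^ Suc n" "W n", OF this, of f a] have "f \<in> A n a" unfolding A_def using f_G by (simp add: ac_simps)
  then show ?thesis unfolding nonzero_def using f_P by blast
qed

text \<open>Multiplication by \<open>g\<close> carries \<open>f W n\<close> into
  \<open>f W (n + 1)\<close>.\<close>

lemma A_mono: "A n m \<subseteq> A (Suc n) m"
proof
  fix v assume v: "v \<in> A n m"
  then obtain u where u: "u \<in> W n (m + int (Suc n) * b - a)" "g ^ Suc n * v - f * u \<in> P (m + int (Suc n) * b)"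
    unfolding A_def mulM_iff by blast
  have "g * u \<in> W (Suc n) (m + int (Suc (Suc n)) * b - a)"
    using W_Suc_g[OF u(1)] by (simp add: algebra_simps del: W.simps)
  moreover have "g ^ Suc (Suc n) * v - f * (g * u) \<in> P (m + int (Suc (Suc n)) * b)"
    using P_mult[OF g_G u(2)] by (simp add: algebra_simps)
  ultimately show "v \<in> A (Suc n) m" using v unfolding A_def mulM_iff by blast
qed

lemma Int_eq_A: "mulM f a (W n) m \<inter> gq (Suc n) m = mulM (g ^ Suc n) (int (Suc n) * b) (A n) m"
proof (intro equalityI subsetI IntI)
  let ?M = "mulM f a (W n)"
  have M: "gmod ?M" using gmod_mulM[OF f_G gmod_W] .
  fix v assume "v \<in> ?M m \<inter> gq (Suc n) m"
  then obtain u where v: "v \<in> ?M m" and u: "u \<in> G (m - int (Suc n) * b)" "v - g ^ Suc n * u \<in> P m"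
    unfolding Int_iff mulM_iff[of _ "g ^ Suc n"] by blast
  have "v - (v - g ^ Suc n * u) \<in> ?M m" using v u gmodD(1,2)[OF M] subspace_diff by blast
  then have "u \<in> A n (m - int (Suc n) * b)" unfolding A_def using u by simp
  then show "v \<in> mulM (g ^ Suc n) (int (Suc n) * b) (A n) m" unfolding mulM_iff[of _ "g ^ Suc n"] using u by blast
next
  let ?M = "mulM f a (W n)"
  have M: "gmod ?M" using gmod_mulM[OF f_G gmod_W] .
  fix v assume "v \<in> mulM (g ^ Suc n) (int (Suc n) * b) (A n) m"
  then obtain u where u: "u \<in> A n (m - int (Suc n) * b)" "v - g ^ Suc n * u \<in> P m"
    unfolding mulM_iff by blast
  then show "v \<in> gq (Suc n) m" unfolding mulM_iff A_def by blast
  have "g ^ Suc n * u + (v - g ^ Suc n * u) \<in> ?M m"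
    using u gmodD(1,2)[OF M] subspace_add unfolding A_def by fastforce
  then show "v \<in> ?M m" by simp
qed

text \<open>The multiplicity \<open>e\<close> of \<open>(f, g)\<close>: the colengths of its powers grow linearly, since the
  quotients \<open>(f, g)\<^sup>n\<^sup>+\<^sup>1 / f (f, g)\<^sup>n\<close> are cyclic with increasing annihilators \<open>A n\<close>.\<close>

lemma evc_W: "\<exists>w e k n0. (\<forall>n. evc (W n) (w n)) \<and> (\<forall>n\<ge>n0. w n = k - e * int n)"
proof -
  have "\<forall>n. \<exists>c. evc (W n) c" using evc_exists[OF gmod_W nonzero_W] by metis
  then obtain w where w: "\<And>n. evc (W n) (w n)" by metis
  have "\<forall>n. \<exists>c. evc (A n) c" using evc_exists[OF gmod_A nonzero_A] by metis
  then obtain h where h: "\<And>n. evc (A n) (h n)" by metis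
  have rec: "w (Suc n) = w n - dg * a + cR - h n" for n
  proof -
    \<comment> \<open>The shift by the degree of \<open>g^(n+1)\<close> occurs in the generator and
      in the intersection alike and cancels, which leaves a recursion for \<open>w\<close> in terms
      of \<open>h\<close> alone.\<close>
    have "evc (\<lambda>m. mulM f a (W n) m \<inter> gq (Suc n) m) (h n - dg * (int (Suc n) * b))"
      unfolding Int_eq_A by (rule evc_mulM[OF gq_GP gmod_A h])
    then have "evc (W (Suc n)) (w n - dg * a + (cR - dg * (int (Suc n) * b)) - (h n - dg * (int (Suc n) * b)))"
      unfolding W.simps
      by (intro evc_plus gmod_mulM f_G gmod_W gmod_gq evc_mulM f_P w evc_pr gq_GP)
    then show ?thesis using evc_unique[OF w] by fastforce
  qed
  have "h n \<le> h (Suc n)" for n using evc_mono[OF gmod_A A_mono h h] .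
  moreover have "h n \<le> cR" for n using evc_mono[OF gmod_G gmodD(3)[OF gmod_A] h evc_G] .
  ultimately obtain n0 c where c: "\<And>n. n0 \<le> n \<Longrightarrow> h n = c" using int_mono_bounded_eventually_const by metis
  define e where "e = dg * a - cR + c"
  have "w n = w n0 + e * int n0 - e * int n" if "n0 \<le> n" for n
    using that
  proof (induction n rule: dec_induct)
    case (step n)
    then show ?case using rec[of n] c[of n] unfolding e_def by (simp add: algebra_simps)
  qed simp
  then show ?thesis using w by metis
qed

text \<open>The first inclusion bounds \<open>i q\<close> above by \<open>w q\<close>; the product
  formula bounds it below by \<open>w (2 q - 1) - w (q - 1)\<close> up to a constant. Eventual
  linearity of \<open>w\<close> makes both bounds \<open>- e q + O(1)\<close>.\<close>

lemma evc_Iq: "\<exists>i e C. (\<forall>q. evc (Iq q) (i q)) \<and> (\<forall>q. \<bar>i q + e * int q\<bar> \<le> C)"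
proof -
  obtain w e k n0 where w: "\<And>n. evc (W n) (w n)" and wk: "\<And>n. n0 \<le> n \<Longrightarrow> w n = k - e * int n"
    using evc_W by metis
  have "\<forall>q. \<exists>c. evc (Iq q) c" using evc_exists[OF gmod_Iq nonzero_Iq] by metis
  then obtain i where i: "\<And>q. evc (Iq q) (i q)" by metis
  have upper: "i q \<le> w q" for q using evc_mono[OF gmod_W Iq_W i w] .
  have lower: "w (Suc (2 * n)) - w n - reg + 2 * cR \<le> i (Suc n)" for n
  proof -
    define L where "L = sat (W n)"
    note L = gmod_sat[OF gmod_W, of n, folded L_def] xysat_sat[OF gmod_W, of n, folded L_def]
      nonzero_sat[OF gmod_W nonzero_W, of n, folded L_def]
    \<comment> \<open>As \<open>s\<close> has the least degree in \<open>L\<close>, the number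
      \<open>c + dg * m0\<close> is bounded, so \<open>L\<close> and the multiples of
      \<open>s\<close> differ by a bounded amount in high degrees.\<close>
    obtain m0 s c where s: "s \<in> L m0" "s \<notin> P m0" and c: "\<bar>c + dg * m0\<bar> \<le> reg"
      "\<And>m. m0 + reg \<le> m \<Longrightarrow> hf L m = dg * m + c"
      using regularity[OF L] by metis
    have "evc L c" unfolding evc_def using c(2) by blast
    then have cw: "c = w n" using evc_sat[OF gmod_W nonzero_W, of n] w[of n] evc_unique unfolding L_def by blast
    have sG: "s \<in> G m0" using s gmodD(3)[OF L(1)] by blast
    let ?q = "Suc n"
    let ?f = "\<lambda>M. mulM (f ^ ?q) (int ?q * a) M" and ?g = "\<lambda>M. mulM (g ^ ?q) (int ?q * b) M"
    let ?s = "pr s m0" and ?X = "\<lambda>m. ?f L m + ?g L m"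
    have sL: "?s m \<subseteq> L m" for m using mulM_element_subset[OF L(1) s(1)] .
    have gs: "gmod ?s" using gmod_mulM[OF sG gmod_G] .
    have gm: "gmod (?f M)" "gmod (?g M)" if "gmod M" for M
      using gmod_mulM fq_GP gq_GP that by blast+
    have gX: "gmod ?X" using gmod_plus gm L(1) by blast
    have WX: "W (Suc (2 * n)) m \<subseteq> ?X m" for m
    proof -
      have "?f (W n) m + ?g (W n) m \<subseteq> ?X m"
        by (intro set_plus_mono2 mulM_mono) (use sat_superset[OF gmod_W] in \<open>auto simp: L_def\<close>)
      moreover have eq: "Suc (2 * n) = n + Suc n" by simp
      have "W (Suc (2 * n)) m \<subseteq> ?f (W n) m + ?g (W n) m" unfolding eq by (rule W_split)
      ultimately show ?thesis by (rule order_trans[rotated])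
    qed
    have nzX: "nonzero ?X" using nonzero_mono[OF nonzero_W WX] .
    obtain cX where cX: "evc ?X cX" using evc_exists[OF gX nzX] .
    have "w (Suc (2 * n)) \<le> cX" using evc_mono[OF gX WX w cX] .
    \<comment> \<open>Passing from \<open>L\<close> to the multiples of \<open>s\<close> in both
      summands of \<open>?X\<close> costs at most twice the difference of their Hilbert functions,
      and the result lies in \<open>s\<close> times \<open>Iq\<close>, whence the shift by
      \<open>m0\<close>.\<close>
    moreover have "cX \<le> i ?q - dg * m0 + 2 * (c - (cR - dg * m0))"
    proof -
      have sub: "?f ?s m + ?g ?s m \<subseteq> mulM s m0 (Iq ?q) m" for m
      proof (rule plus_subset[OF gmod_mulM[OF sG gmod_Iq]])
        have *: "mulM h d ?s m \<subseteq> mulM s m0 (Iq ?q) m" if h: "h \<in> Iq ?q d" for h d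
        proof
          fix v assume "v \<in> mulM h d ?s m"
          then obtain u where u: "u \<in> ?s (m - d)" "v - h * u \<in> P m" unfolding mulM_iff[of v] by blast
          then obtain t where t: "t \<in> G (m - d - m0)" "u - s * t \<in> P (m - d)" unfolding mulM_iff by blast
          have hG: "h \<in> G d" using h gmodD(3)[OF gmod_Iq] by blast
          have "h * (u - s * t) \<in> P m" using P_mult[OF hG t(2)] by simp
          then have "(v - h * u) + h * (u - s * t) \<in> P m" using u subspace_add[OF P_sub] by blast
          then have "v - s * (t * h) \<in> P m" by (simp add: algebra_simps)
          moreover have "t * h \<in> Iq ?q (m - m0)"
            using gmodD(5)[OF gmod_Iq t(1) h] by simp
          ultimately show "v \<in> mulM s m0 (Iq ?q) m" unfolding mulM_iff by blast
        qed
        show "?f ?s m \<subseteq> mulM s m0 (Iq ?q) m" "?g ?s m \<subseteq> mulM s m0 (Iq ?q) m"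
          using * fpow_Iq gpow_Iq by blast+
      qed
      have bound: "hf ?X m \<le> hf (Iq ?q) (m - m0) + (hf L (m - int ?q * a) - hf G (m - int ?q * a - m0))
          + (hf L (m - int ?q * b) - hf G (m - int ?q * b - m0))" for m
      proof -
        have "hf (\<lambda>m. ?f ?s m \<inter> ?g ?s m) m \<le> hf (\<lambda>m. ?f L m \<inter> ?g L m) m"
          by (rule hf_mono[OF gmod_Int[OF gm[OF L(1)]]]) (use mulM_mono sL in blast)
        moreover have "hf ?X m + hf (\<lambda>m. ?f L m \<inter> ?g L m) m = hf (?f L) m + hf (?g L) m"
          by (rule hf_plus[OF gm[OF L(1)]])
        moreover have "hf (\<lambda>m. ?f ?s m + ?g ?s m) m + hf (\<lambda>m. ?f ?s m \<inter> ?g ?s m) m = hf (?f ?s) m + hf (?g ?s) m"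
          by (rule hf_plus[OF gm[OF gs]])
        moreover have "hf (\<lambda>m. ?f ?s m + ?g ?s m) m \<le> hf (mulM s m0 (Iq ?q)) m"
          using hf_mono[of "mulM s m0 (Iq ?q)" "\<lambda>m. ?f ?s m + ?g ?s m" m] sub[of m] gmod_mulM[OF sG gmod_Iq]
          by blast
        ultimately show ?thesis
          unfolding hf_mulM[OF fq_GP L(1)] hf_mulM[OF gq_GP L(1)] hf_mulM[OF fq_GP gs] hf_mulM[OF gq_GP gs]
            hf_mulM[OF sG s(2) gmod_G] hf_mulM[OF sG s(2) gmod_Iq] by linarith
      qed
      obtain N1 where N1: "\<And>m. N1 \<le> m \<Longrightarrow> hf ?X m = dg * m + cX" using cX unfolding evc_def by blast
      obtain N2 where N2: "\<And>m. N2 \<le> m \<Longrightarrow> hf (Iq ?q) m = dg * m + i ?q" using i[of ?q] unfolding evc_def by blast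
      define m where "m = \<bar>N1\<bar> + \<bar>N2\<bar> + \<bar>m0\<bar> + int ?q * a + int ?q * b + reg + max r0 0"
      have qa: "0 \<le> int ?q * a" "0 \<le> int ?q * b" using ab_nonneg by simp_all
      have "hf ?X m = dg * m + cX" by (rule N1) (use qa reg_nonneg in \<open>unfold m_def, linarith\<close>)
      moreover have "hf (Iq ?q) (m - m0) = dg * (m - m0) + i ?q"
        by (rule N2) (use qa reg_nonneg in \<open>unfold m_def, linarith\<close>)
      moreover have "hf L (m - int ?q * a) = dg * (m - int ?q * a) + c"
        by (rule c(2)) (use qa in \<open>unfold m_def, linarith\<close>)
      moreover have "hf L (m - int ?q * b) = dg * (m - int ?q * b) + c"
        by (rule c(2)) (use qa in \<open>unfold m_def, linarith\<close>)
      moreover have "hf G (m - int ?q * a - m0) = dg * (m - int ?q * a - m0) + cR"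
        by (rule hf_G_large) (use qa reg_nonneg in \<open>unfold m_def, linarith\<close>)
      moreover have "hf G (m - int ?q * b - m0) = dg * (m - int ?q * b - m0) + cR"
        by (rule hf_G_large) (use qa reg_nonneg in \<open>unfold m_def, linarith\<close>)
      ultimately show ?thesis using bound[of m] by (simp add: algebra_simps)
    qed
    ultimately have "w (Suc (2 * n)) \<le> i ?q + dg * m0 + 2 * c - 2 * cR"
      by (simp add: mult.commute)
    then show ?thesis using c(1) cw by linarith
  qed
  \<comment> \<open>The sum covers the finitely many \<open>q\<close> for which \<open>w\<close>
    need not be linear yet.\<close>
  define C where "C = \<bar>k\<bar> + reg + \<bar>2 * cR\<bar> + \<bar>e\<bar> + (\<Sum>q\<in>{..n0}. \<bar>i q + e * int q\<bar>)"
  have "\<bar>i q + e * int q\<bar> \<le> C" for q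
  proof (cases "q \<le> n0")
    case True
    then have "\<bar>i q + e * int q\<bar> \<le> (\<Sum>q\<in>{..n0}. \<bar>i q + e * int q\<bar>)" by (intro member_le_sum) auto
    then show ?thesis unfolding C_def using reg_nonneg by linarith
  next
    case False
    then obtain n where n: "q = Suc n" "n0 \<le> n" by (cases q) auto
    have "w (Suc (2 * n)) = k - e * int (Suc (2 * n))" "w n = k - e * int n" "w q = k - e * int q"
      using wk n by simp_all
    then have "- e * int q - reg + 2 * cR \<le> i q" "i q \<le> k - e * int q"
      using lower[of n] upper[of q] n by (simp_all add: algebra_simps)
    moreover have "0 \<le> (\<Sum>q\<in>{..n0}. \<bar>i q + e * int q\<bar>)" by (rule sum_nonneg) simp
    ultimately show ?thesis unfolding C_def using reg_nonneg by linarith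
  qed
  then show ?thesis using i by blast
qed

end

text \<open>Discrete integration: passing from \<open>z\<close> to \<open>z + d\<close> changes the
  square of \<open>max 0 z\<close> by \<open>2 * d * max 0 z\<close> up to an error between 0 and
  the square of \<open>d\<close>. Nonnegativity of \<open>t\<close> makes the square vanish at
  \<open>n = 0\<close>.\<close>

lemma sum_max_linear:
  fixes d t :: int
  assumes "0 \<le> d" "0 \<le> t"
  shows "\<bar>2 * d * (\<Sum>m<n. max 0 (d * int m - t)) - (max 0 (d * int n - t))\<^sup>2\<bar> \<le> d\<^sup>2 * int n"
proof (induction n)
  case 0
  then show ?case using assms by simp
next
  case (Suc n)
  have step: "0 \<le> (max 0 (z + d))\<^sup>2 - (max 0 z)\<^sup>2 - 2 * d * max 0 z
      \<and> (max 0 (z + d))\<^sup>2 - (max 0 z)\<^sup>2 - 2 * d * max 0 z \<le> d\<^sup>2" for z :: int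
  proof (cases "0 \<le> z")
    case True
    then show ?thesis using assms by (simp add: power2_eq_square algebra_simps)
  next
    case False
    then have "max 0 (z + d) \<le> d" using assms by simp
    then have "(max 0 (z + d))\<^sup>2 \<le> d\<^sup>2" by (intro power_mono) simp_all
    then show ?thesis using False by simp
  qed
  have "d * int (Suc n) - t = (d * int n - t) + d" by (simp add: algebra_simps)
  then show ?case
    using Suc step[of "d * int n - t"] by (simp only: sum.lessThan_Suc) (simp add: distrib_left abs_le_iff)
qed

lemma tendsto_quadratic:
  fixes d t :: int and N :: "nat \<Rightarrow> nat"
  assumes "(\<lambda>q. real (N q) / real q) \<longlonglongrightarrow> l"
  shows "(\<lambda>q. real_of_int ((max 0 (d * int (N q) - t * int q))\<^sup>2) / (real q)\<^sup>2)
    \<longlonglongrightarrow> (max 0 (real_of_int d * l - real_of_int t))\<^sup>2"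
proof -
  have "(\<lambda>q. (max 0 (real_of_int d * (real (N q) / real q) - real_of_int t))\<^sup>2)
      \<longlonglongrightarrow> (max 0 (real_of_int d * l - real_of_int t))\<^sup>2"
    by (intro tendsto_intros assms)
  moreover have "\<forall>\<^sub>F q in sequentially. (max 0 (real_of_int d * (real (N q) / real q) - real_of_int t))\<^sup>2
      = real_of_int ((max 0 (d * int (N q) - t * int q))\<^sup>2) / (real q)\<^sup>2"
    using eventually_gt_at_top[of 0]
  proof eventually_elim
    case (elim q)
    define z where "z = d * int (N q) - t * int q"
    have "real_of_int d * (real (N q) / real q) - real_of_int t = real_of_int z / real q"
      using elim unfolding z_def by (simp add: field_simps)
    moreover have "real_of_int (max 0 z) / real q = max 0 (real_of_int z / real q)"
      using elim by (auto simp: max_def zero_le_divide_iff)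
    ultimately have "real_of_int (max 0 z) / real q = max 0 (real_of_int d * (real (N q) / real q) - real_of_int t)"
      by simp
    then show ?case unfolding z_def[symmetric] of_int_power by (metis power_divide)
  qed
  ultimately show ?thesis by (rule Lim_transform_eventually)
qed

section \<open>Hilbert functions as truncated linear functions\<close>

context graded_surface
begin

text \<open>Since \<open>c + dg * m0\<close> is bounded, \<open>m0\<close> can be eliminated at
  bounded cost, and the Hilbert function is close to a function of \<open>c\<close> alone. Any known
  element outside \<open>P\<close> bounds \<open>m0\<close>, hence also the degree from which the
  linear formula is exact.\<close>

lemma regularity_max:
  assumes M: "gmod M" "xysat M" "nonzero M" and c: "evc M c" and s: "s \<in> M k" "s \<notin> P k"
  shows "0 \<le> m \<Longrightarrow> \<bar>hf M m - max 0 (dg * m + c)\<bar> \<le> 2 * reg"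
    and "k + reg \<le> m \<Longrightarrow> hf M m = dg * m + c"
proof -
  obtain m0 c' where m0: "0 \<le> m0" "\<And>m. m < m0 \<Longrightarrow> M m = P m" and c': "\<bar>c' + dg * m0\<bar> \<le> reg"
    and mid: "\<And>m. m0 \<le> m \<Longrightarrow> \<bar>hf M m - dg * (m - m0)\<bar> \<le> reg"
    and large: "\<And>m. m0 + reg \<le> m \<Longrightarrow> hf M m = dg * m + c'"
    using regularity[OF M] by metis
  have "evc M c'" unfolding evc_def using large by blast
  then have cc: "c' = c" using evc_unique c by blast
  have "m0 \<le> k" using m0(2)[of k] s by force
  then show "k + reg \<le> m \<Longrightarrow> hf M m = dg * m + c" using large[of m] cc by simp
  assume m: "0 \<le> m"
  show "\<bar>hf M m - max 0 (dg * m + c)\<bar> \<le> 2 * reg"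
  proof (cases "m0 \<le> m")
    case True
    have "0 \<le> dg * (m - m0)" using True dg_pos by simp
    then show ?thesis using mid[OF True] c' cc by (simp add: algebra_simps)
  next
    case False
    have "dg * m \<le> dg * m0" using False dg_pos by simp
    then have "dg * m + c \<le> reg" using c' cc by simp
    then show ?thesis using m0(2)[of m] False reg_nonneg unfolding hf_def by simp
  qed
qed

lemma hf_shift_max:
  assumes "0 \<le> t" "0 \<le> m"
  shows "\<bar>hf G (m - t) - max 0 (dg * m - dg * t)\<bar> \<le> reg"
proof (cases "t \<le> m")
  case True
  then have "0 \<le> dg * (m - t)" using dg_pos by simp
  then show ?thesis using hC(2)[of "m - t"] hC(1) dg_pos True unfolding reg_def by (simp add: algebra_simps)
next
  case False
  then have "dg * m \<le> dg * t" using dg_pos by simp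
  then show ?thesis using hf_neg[OF gmod_G, of "m - t"] False reg_nonneg by simp
qed

end

context two_forms
begin

text \<open>The number of degrees that contribute grows linearly in \<open>q\<close>, so errors
  bounded in each degree add up to \<open>O(q)\<close> and vanish after division by the square of
  \<open>q\<close>. All natural \<open>q\<close> are allowed, in any characteristic.\<close>

theorem colength_asymptotics:
  "\<exists>L\<in>\<rat>. \<exists>N. (\<forall>q m. int (N q) \<le> m \<longrightarrow> sat (Iq q) m = Iq q m) \<and>
    (\<lambda>q. real_of_int (\<Sum>m<N q. hf (sat (Iq q)) (int m) - hf (Iq q) (int m)) / (real q)\<^sup>2) \<longlonglongrightarrow> L"
proof -
  obtain i e C where i: "\<And>q. evc (Iq q) (i q)" and ie: "\<And>q. \<bar>i q + e * int q\<bar> \<le> C" using evc_Iq by metis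
  define J where "J q = sat (Iq q)" for q
  have J: "gmod (J q)" "xysat (J q)" "nonzero (J q)" for q
    unfolding J_def by (intro gmod_sat xysat_sat nonzero_sat gmod_Iq nonzero_Iq)+
  have evJ: "evc (J q) (i q)" for q using i evc_sat[OF gmod_Iq nonzero_Iq] unfolding J_def by blast
  \<comment> \<open>This value is forced by \<open>hf_plus\<close>: the constants of the two
    principal submodules are \<open>cR - dg * (q * a)\<close> and
    \<open>cR - dg * (q * b)\<close>.\<close>
  define k where "k q = 2 * cR - dg * (int q * (a + b)) - i q" for q
  have split: "hf (Iq q) m = hf G (m - int q * a) + hf G (m - int q * b) - hf (Kq q) m" for q m
    using hf_plus[OF gmod_fq[of q] gmod_gq[of q], of m] hf_mulM[OF fq_GP gmod_G, of q m] hf_mulM[OF gq_GP gmod_G, of q m]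
    unfolding Iq_def Kq_def by simp
  have evK: "evc (Kq q) (k q)" for q
  proof -
    obtain c where c: "evc (Kq q) c" using evc_exists[OF gmod_Kq nonzero_Kq] by blast
    have "evc (Iq q) ((cR - dg * (int q * a)) + (cR - dg * (int q * b)) - c)"
      using evc_plus[OF gmod_fq gmod_gq evc_pr[OF fq_GP] evc_pr[OF gq_GP] c[unfolded Kq_def]] unfolding Iq_def .
    then have "c = k q" using evc_unique[OF i] unfolding k_def by (fastforce simp: algebra_simps)
    then show ?thesis using c by simp
  qed
  define e' where "e' = dg * (a + b) - e"
  have C0: "0 \<le> C" using ie[of 0] by linarith
  have ke: "\<bar>k q + e' * int q\<bar> \<le> C + \<bar>2 * cR\<bar>" for q
    using ie[of q] unfolding k_def e'_def by (simp add: algebra_simps)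
  \<comment> \<open>If \<open>- r * q\<close> stays bounded above for all \<open>q\<close>, then
    \<open>r\<close> is nonnegative. The bound comes from \<open>cR\<close>, the constant of
    \<open>G\<close> itself; nonnegative offsets are required by
    \<open>sum_max_linear\<close>.\<close>
  have e_nonneg: "0 \<le> r" if r: "\<And>q. - r * int q \<le> B" for r B :: int
  proof (rule ccontr)
    assume "\<not> 0 \<le> r"
    then have "int (nat (\<bar>B\<bar> + 1)) \<le> - r * int (nat (\<bar>B\<bar> + 1))"
      using mult_right_mono[of 1 "- r" "int (nat (\<bar>B\<bar> + 1))"] by simp
    then show False using r[of "nat (\<bar>B\<bar> + 1)"] by simp
  qed
  have "- e * int q \<le> cR + C" for q
    using evc_mono[OF gmod_G gmodD(3)[OF gmod_Iq] i evc_G, of q] ie[of q] by simp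
  then have e0: "0 \<le> e" using e_nonneg by blast
  have "- e' * int q \<le> cR + C + \<bar>2 * cR\<bar>" for q
    using evc_mono[OF gmod_G gmodD(3)[OF gmod_Kq] evK evc_G, of q] ke[of q] by simp
  then have e0': "0 \<le> e'" using e_nonneg by blast
  \<comment> \<open>\<open>f^q * g^q\<close> lies in \<open>Kq q\<close> in degree
    \<open>q * (a + b)\<close>, and \<open>f^q\<close> in the saturation in a lower or equal degree.
    Beyond \<open>reg\<close> and \<open>r0\<close> all Hilbert functions involved are thus given by
    their polynomials, whose constants cancel.\<close>
  define N where "N q = nat (int q * (a + b) + reg + max r0 0)" for q
  have ab: "0 \<le> int q * a" "0 \<le> int q * b" for q using ab_nonneg by simp_all
  have N: "int (N q) = int q * (a + b) + reg + max r0 0" for q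
    unfolding N_def using ab[of q] reg_nonneg by (simp add: distrib_left)
  define D where "D q m = hf (J q) m - hf (Iq q) m" for q m
  have fJ: "f ^ q \<in> J q (int q * a)" for q
    using fpow_Iq[of q] sat_superset[OF gmod_Iq] unfolding J_def by blast
  have D_large: "D q m = 0" if "int (N q) \<le> m" for q m
  proof -
    have ge: "int q * a + int q * b + reg + max r0 0 \<le> m" using that N[of q] by (simp add: distrib_left)
    have "hf (J q) m = dg * m + i q"
      by (rule regularity_max(2)[OF J evJ fJ fq_GP(2)]) (use ge ab[of q] in linarith)
    moreover have "hf (Kq q) m = dg * m + k q"
      by (rule regularity_max(2)[OF gmod_Kq xysat_Kq nonzero_Kq evK fgpow_Kq])
        (use ge ab[of q] in \<open>simp add: distrib_left\<close>)
    moreover have "hf G (m - int q * a) = dg * (m - int q * a) + cR"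
      by (rule hf_G_large) (use ge ab[of q] reg_nonneg in linarith)
    moreover have "hf G (m - int q * b) = dg * (m - int q * b) + cR"
      by (rule hf_G_large) (use ge ab[of q] reg_nonneg in linarith)
    ultimately show ?thesis unfolding D_def split k_def by (simp add: algebra_simps)
  qed
  have sat_eq: "sat (Iq q) m = Iq q m" if "int (N q) \<le> m" for q m
  proof (rule ccontr)
    assume "sat (Iq q) m \<noteq> Iq q m"
    then have "dim (Iq q m) < dim (sat (Iq q) m)"
      using dim_psubset_fin_dim[OF gmodD(1)[OF gmod_Iq], of q m "sat (Iq q) m"]
        sat_superset[OF gmod_Iq, of q m] gmodD(4)[OF J(1)[of q], of m] unfolding J_def by blast
    then show False using D_large[OF that] unfolding D_def J_def hf_def by simp
  qed
  define T where "T q t = (\<Sum>m<N q. max 0 (dg * int m - t * int q))" for q t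
  \<comment> \<open>Twice \<open>2 * reg\<close> from \<open>J q\<close> and \<open>Kq q\<close>,
    twice \<open>reg\<close> from the shifts of \<open>G\<close>, and the deviations of
    \<open>i q\<close> and \<open>k q\<close> from their linear parts.\<close>
  define B where "B = 6 * reg + 2 * C + \<bar>2 * cR\<bar>"
  have D_max: "\<bar>D q (int m) - (max 0 (dg * int m - e * int q) + max 0 (dg * int m - e' * int q)
      - max 0 (dg * int m - dg * a * int q) - max 0 (dg * int m - dg * b * int q))\<bar> \<le> B" for q m
  proof -
    have lip: "\<bar>max 0 u - max 0 v\<bar> \<le> \<bar>u - v\<bar>" for u v :: int by linarith
    have "\<bar>hf (J q) (int m) - max 0 (dg * int m + i q)\<bar> \<le> 2 * reg"
      by (rule regularity_max(1)[OF J evJ fJ fq_GP(2)]) simp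
    moreover have "\<bar>hf (Kq q) (int m) - max 0 (dg * int m + k q)\<bar> \<le> 2 * reg"
      by (rule regularity_max(1)[OF gmod_Kq xysat_Kq nonzero_Kq evK fgpow_Kq]) simp
    moreover have "\<bar>hf G (int m - int q * a) - max 0 (dg * int m - dg * a * int q)\<bar> \<le> reg"
      using hf_shift_max[of "int q * a" "int m"] ab[of q] by (simp add: ac_simps)
    moreover have "\<bar>hf G (int m - int q * b) - max 0 (dg * int m - dg * b * int q)\<bar> \<le> reg"
      using hf_shift_max[of "int q * b" "int m"] ab[of q] by (simp add: ac_simps)
    moreover have "\<bar>max 0 (dg * int m + i q) - max 0 (dg * int m - e * int q)\<bar> \<le> C"
      using ie[of q] lip[of "dg * int m + i q" "dg * int m - e * int q"] by simp
    moreover have "\<bar>max 0 (dg * int m + k q) - max 0 (dg * int m - e' * int q)\<bar> \<le> C + \<bar>2 * cR\<bar>"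
      using ke[of q] lip[of "dg * int m + k q" "dg * int m - e' * int q"] by simp
    moreover have "\<bar>x1 - (x3 + x4 - x2) - (z1 + z2 - z3 - z4)\<bar> \<le> 6 * reg + 2 * C + \<bar>2 * cR\<bar>"
      if "\<bar>x1 - y1\<bar> \<le> 2 * reg" "\<bar>x2 - y2\<bar> \<le> 2 * reg" "\<bar>x3 - z3\<bar> \<le> reg" "\<bar>x4 - z4\<bar> \<le> reg"
        "\<bar>y1 - z1\<bar> \<le> C" "\<bar>y2 - z2\<bar> \<le> C + \<bar>2 * cR\<bar>" for x1 x2 x3 x4 y1 y2 z1 z2 z3 z4
      using that unfolding abs_le_iff by linarith
    ultimately show ?thesis unfolding D_def split B_def by blast
  qed
  define F where "F q = (\<Sum>m<N q. D q (int m))" for q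
  have F1: "\<bar>F q - (T q e + T q e' - T q (dg * a) - T q (dg * b))\<bar> \<le> B * int (N q)" for q
  proof -
    have "\<bar>F q - (T q e + T q e' - T q (dg * a) - T q (dg * b))\<bar>
      = \<bar>\<Sum>m<N q. D q (int m) - (max 0 (dg * int m - e * int q) + max 0 (dg * int m - e' * int q)
      - max 0 (dg * int m - dg * a * int q) - max 0 (dg * int m - dg * b * int q))\<bar>"
      unfolding F_def T_def by (simp add: sum_subtractf sum.distrib)
    also have "\<dots> \<le> (\<Sum>m<N q. B)" by (rule order_trans[OF sum_abs]) (rule sum_mono, rule D_max)
    finally show ?thesis by (simp add: mult.commute)
  qed
  define Q where "Q q t = (max 0 (dg * int (N q) - t * int q))\<^sup>2" for q t
  have TQ: "\<bar>2 * dg * T q t - Q q t\<bar> \<le> dg\<^sup>2 * int (N q)" if "0 \<le> t" for q t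
    unfolding T_def Q_def by (rule sum_max_linear) (use dg_pos that in auto)
  define E where "E = 2 * dg * B + 4 * dg\<^sup>2"
  have F2: "\<bar>2 * dg * F q - (Q q e + Q q e' - Q q (dg * a) - Q q (dg * b))\<bar> \<le> E * int (N q)" for q
  proof -
    have "\<bar>2 * dg * (F q - (T q e + T q e' - T q (dg * a) - T q (dg * b)))\<bar> \<le> 2 * dg * (B * int (N q))"
      using mult_left_mono[OF F1[of q], of "2 * dg"] dg_pos by (simp add: abs_mult)
    moreover have "0 \<le> dg * a" "0 \<le> dg * b" using ab_nonneg dg_pos by simp_all
    ultimately show ?thesis
      using TQ[OF e0, of q] TQ[OF e0', of q] TQ[of "dg * a" q] TQ[of "dg * b" q]
      unfolding E_def by (simp add: algebra_simps)
  qed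
  define l where "l = real_of_int (a + b)"
  have Nl: "(\<lambda>q. real (N q) / real q) \<longlonglongrightarrow> l"
  proof -
    define c where "c = real_of_int (reg + max r0 0)"
    have "(\<lambda>q. l + c * (1 / real q)) \<longlonglongrightarrow> l + c * 0"
      by (intro tendsto_intros lim_const_over_n)
    moreover have "\<forall>\<^sub>F q in sequentially. l + c * (1 / real q) = real (N q) / real q"
      using eventually_gt_at_top[of 0]
    proof eventually_elim
      case (elim q)
      have "real (N q) = real_of_int (int (N q))" by simp
      also have "\<dots> = real q * l + c" unfolding N l_def c_def by simp
      finally show ?case using elim by (simp add: add_divide_distrib)
    qed
    ultimately have "(\<lambda>q. real (N q) / real q) \<longlonglongrightarrow> l + c * 0" by (rule Lim_transform_eventually)
    then show ?thesis by simp
  qed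
  let ?p = "\<lambda>t. (max 0 (real_of_int dg * l - real_of_int t))\<^sup>2"
  let ?Q = "\<lambda>q. Q q e + Q q e' - Q q (dg * a) - Q q (dg * b)"
  have Q: "(\<lambda>q. real_of_int (Q q t) / (real q)\<^sup>2) \<longlonglongrightarrow> ?p t" for t
    unfolding Q_def by (rule tendsto_quadratic[OF Nl])
  have Qlim: "(\<lambda>q. real_of_int (?Q q) / (real q)\<^sup>2) \<longlonglongrightarrow> ?p e + ?p e' - ?p (dg * a) - ?p (dg * b)"
    unfolding of_int_add of_int_diff add_divide_distrib diff_divide_distrib by (intro tendsto_intros Q)
  have "(\<lambda>q. real_of_int (2 * dg * F q - ?Q q) / (real q)\<^sup>2) \<longlonglongrightarrow> 0"
  proof -
    let ?b = "\<lambda>q. real_of_int E * (real (N q) / real q) * (1 / real q)"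
    have bound: "norm (real_of_int (2 * dg * F q - ?Q q) / (real q)\<^sup>2) \<le> norm (?b q) * 1" for q
    proof -
      define z where "z = 2 * dg * F q - ?Q q"
      have "real_of_int \<bar>z\<bar> \<le> real_of_int (E * int (N q))"
        using F2[of q] unfolding z_def of_int_le_iff .
      then have "\<bar>real_of_int z\<bar> \<le> real_of_int E * real (N q)" by simp
      then have "norm (real_of_int (2 * dg * F q - ?Q q) / (real q)\<^sup>2) \<le> ?b q"
        unfolding z_def[symmetric] by (simp add: power2_eq_square divide_right_mono)
      also have "?b q \<le> norm (?b q) * 1" unfolding real_norm_def mult_1_right by (rule abs_ge_self)
      finally show ?thesis .
    qed
    have "?b \<longlonglongrightarrow> real_of_int E * l * 0"
      by (intro tendsto_intros Nl lim_const_over_n)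
    then have "?b \<longlonglongrightarrow> 0" by simp
    then show ?thesis by (rule tendsto_0_le[where K = 1]) (rule always_eventually, rule allI, rule bound)
  qed
  from tendsto_add[OF this Qlim]
  have "(\<lambda>q. 2 * real_of_int dg * (real_of_int (F q) / (real q)\<^sup>2)) \<longlonglongrightarrow> ?p e + ?p e' - ?p (dg * a) - ?p (dg * b)"
    by (simp add: diff_divide_distrib)
  from tendsto_mult_left[OF this, of "1 / (2 * real_of_int dg)"]
  have "(\<lambda>q. real_of_int (F q) / (real q)\<^sup>2)
      \<longlonglongrightarrow> 1 / (2 * real_of_int dg) * (?p e + ?p e' - ?p (dg * a) - ?p (dg * b))"
    using dg_pos by simp
  \<comment> \<open>All parameters are integers, including \<open>e\<close> and
    \<open>e'\<close>.\<close>
  moreover have "1 / (2 * real_of_int dg) * (?p e + ?p e' - ?p (dg * a) - ?p (dg * b)) \<in> \<rat>"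
    unfolding l_def by (auto simp: max_def intro!: Rats_mult Rats_add Rats_diff Rats_divide Rats_power)
  ultimately show ?thesis using sat_eq unfolding F_def D_def J_def by blast
qed

end

section \<open>Irreducible polynomials in three variables are prime\<close>

definition rhom :: "('a::comm_ring_1 \<Rightarrow> 'b::comm_ring_1) \<Rightarrow> bool" where
  "rhom h \<longleftrightarrow> h 1 = 1 \<and> (\<forall>a b. h (a + b) = h a + h b) \<and> (\<forall>a b. h (a * b) = h a * h b)"

lemma rhomD:
  assumes "rhom h"
  shows "h 1 = 1" "h (a + b) = h a + h b" "h (a * b) = h a * h b" "h 0 = 0"
    "h (- a) = - h a" "h (a - b) = h a - h b" "h (a ^ n) = h a ^ n"
proof -
  show 1: "h 1 = 1" and add: "h (a + b) = h a + h b" and mult: "h (a * b) = h a * h b" for a b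
    using assms unfolding rhom_def by blast+
  show 0: "h 0 = 0" using add[of 0 0] by simp
  show neg: "h (- a) = - h a" for a using add[of a "- a"] 0 by (simp add: eq_neg_iff_add_eq_0 add.commute)
  show "h (a - b) = h a - h b" using add[of a "- b"] neg[of b] by simp
  show "h (a ^ n) = h a ^ n" by (induction n) (simp_all add: 1 mult)
qed

lemma rhom_comp: "rhom h \<Longrightarrow> rhom k \<Longrightarrow> rhom (\<lambda>x. k (h x))"
  unfolding rhom_def by simp

lemma rhom_pconst: "rhom (\<lambda>c. [:c:])"
  unfolding rhom_def by (simp add: one_pCons)

lemma rhom_poly: "rhom (\<lambda>p. poly p c)"
  unfolding rhom_def by simp

lemma rhom_eval:
  assumes h: "rhom h"
  shows "rhom (\<lambda>p. poly (map_poly h p) c)"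
proof -
  note h0 = rhomD(4)[OF h]
  have pc: "map_poly h (pCons a p) = pCons (h a) (map_poly h p)" for a p
    using h0 by (rule map_poly_pCons)
  have add: "map_poly h (p + q) = map_poly h p + map_poly h q" for p q
    by (rule poly_eqI) (simp add: coeff_map_poly h0 rhomD[OF h])
  have smult: "map_poly h (smult a p) = smult (h a) (map_poly h p)" for a p
    by (rule poly_eqI) (simp add: coeff_map_poly h0 rhomD[OF h])
  have mult: "map_poly h (p * q) = map_poly h p * map_poly h q" for p q
    by (induction p) (simp_all add: pc add smult h0)
  show ?thesis unfolding rhom_def using add mult by (simp add: rhomD[OF h])
qed

lemma eval_pCons: "rhom h \<Longrightarrow> poly (map_poly h (pCons a p)) c = h a + c * poly (map_poly h p) c"
  by (simp add: map_poly_pCons rhomD)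

lemma UNIV_3': "(UNIV :: 3 set) = {0, 1, 2}"
proof -
  have "(0::3) \<noteq> 1" "(0::3) \<noteq> 2" "(1::3) \<noteq> 2" by simp_all
  then have "card {0, 1, 2 :: 3} = 3" by simp
  then show ?thesis by (intro card_subset_eq[symmetric]) simp_all
qed

abbreviation cst :: "'k::comm_ring_1 \<Rightarrow> 'k poly3" where "cst c \<equiv> Poly_Mapping.single 0 c"

abbreviation mon :: "(3 \<Rightarrow>\<^sub>0 nat) \<Rightarrow> 'k::comm_ring_1 \<Rightarrow> 'k poly3" where "mon m c \<equiv> Poly_Mapping.single m c"

definition var :: "3 \<Rightarrow> 'k::comm_ring_1 poly3" where
  "var i = mon (Poly_Mapping.single i 1) 1"

lemma rhom_cst: "rhom cst"
  unfolding rhom_def by (simp add: single_add mult_single)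

lemma var_power: "var i ^ n = mon (Poly_Mapping.single i n) 1"
  by (induction n) (simp_all add: var_def mult_single flip: single_add)

lemma prod_mon: "finite A \<Longrightarrow> (\<Prod>i\<in>A. mon (f i) 1) = mon (\<Sum>i\<in>A. f i) (1 :: 'k::comm_ring_1)"
  by (induction A rule: finite_induct) (simp_all add: mult_single)

lemma sum_single: "(\<Sum>i\<in>UNIV. Poly_Mapping.single i (Poly_Mapping.lookup m i)) = (m :: 3 \<Rightarrow>\<^sub>0 nat)"
  by (rule poly_mapping_eqI) (simp add: lookup_sum lookup_single when_def)

lemma mon_eq: "mon m c = cst c * (\<Prod>i\<in>UNIV. var i ^ Poly_Mapping.lookup m i)"
  by (simp add: var_power prod_mon sum_single mult_single)

lemma poly3_expand: "f = (\<Sum>m\<in>Poly_Mapping.keys f. mon m (Poly_Mapping.lookup f m))"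
  by (rule poly_mapping_eqI) (simp add: lookup_sum lookup_single when_def in_keys_iff)

lemma poly3_induct [case_names mon add]:
  assumes mon: "\<And>m c. Q (mon m c)" and add: "\<And>f g. Q f \<Longrightarrow> Q g \<Longrightarrow> Q (f + g)"
  shows "Q (f :: 'k::comm_ring_1 poly3)"
proof -
  have "Q (\<Sum>m\<in>A. mon m (Poly_Mapping.lookup f m))" if "finite A" for A
    using that
  proof (induction A rule: finite_induct)
    case empty
    then show ?case using mon[of 0 0] by simp
  qed (simp add: add mon)
  from this[of "Poly_Mapping.keys f"] show ?thesis by (subst poly3_expand) simp
qed

lemma poly3_ring_induct [case_names cst var add mult]:
  assumes c: "\<And>c. Q (cst c)" and v: "\<And>i. Q (var i)"
    and add: "\<And>f g. Q f \<Longrightarrow> Q g \<Longrightarrow> Q (f + g)" and mult: "\<And>f g. Q f \<Longrightarrow> Q g \<Longrightarrow> Q (f * g)"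
  shows "Q (f :: 'k::comm_ring_1 poly3)"
proof (induction f rule: poly3_induct)
  case (mon m b)
  have one: "Q 1" using c[of 1] by simp
  have pow: "Q (var i ^ n)" for i n by (induction n) (simp_all add: one v mult)
  have "Q (\<Prod>i\<in>A. var i ^ Poly_Mapping.lookup m i)" if "finite A" for A
    using that by (induction A rule: finite_induct) (simp_all add: one pow mult)
  then show ?case by (subst mon_eq) (intro mult c, simp)
qed (rule add)

lemma rhom_agree:
  fixes h k :: "'k::comm_ring_1 poly3 \<Rightarrow> 'b::comm_ring_1"
  assumes "rhom h" "rhom k" "\<And>c. h (cst c) = k (cst c)" "\<And>i. h (var i) = k (var i)"
  shows "h f = k f"
  by (induction f rule: poly3_ring_induct) (simp_all add: assms(3,4) rhomD[OF assms(1)] rhomD[OF assms(2)])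

definition ev :: "('k::comm_ring_1 \<Rightarrow> 'b::comm_ring_1) \<Rightarrow> (3 \<Rightarrow> 'b) \<Rightarrow> 'k poly3 \<Rightarrow> 'b" where
  "ev h s f = (\<Sum>m\<in>Poly_Mapping.keys f. h (Poly_Mapping.lookup f m) * (\<Prod>i\<in>UNIV. s i ^ Poly_Mapping.lookup m i))"

context
  fixes h :: "'k::comm_ring_1 \<Rightarrow> 'b::comm_ring_1" and s :: "3 \<Rightarrow> 'b"
  assumes h: "rhom h"
begin

lemma ev_superset:
  assumes "finite A" "Poly_Mapping.keys f \<subseteq> A"
  shows "ev h s f = (\<Sum>m\<in>A. h (Poly_Mapping.lookup f m) * (\<Prod>i\<in>UNIV. s i ^ Poly_Mapping.lookup m i))"
  unfolding ev_def
  by (rule sum.mono_neutral_left[OF assms]) (use rhomD(4)[OF h] in \<open>auto simp: in_keys_iff\<close>)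

lemma ev_mon: "ev h s (mon m c) = h c * (\<Prod>i\<in>UNIV. s i ^ Poly_Mapping.lookup m i)"
  by (subst ev_superset[of "{m}"]) auto

lemma ev_add: "ev h s (f + g) = ev h s f + ev h s g"
proof -
  let ?A = "Poly_Mapping.keys f \<union> Poly_Mapping.keys g"
  show ?thesis
    using keys_add[of f g]
    by (simp add: ev_superset[of ?A] lookup_add rhomD[OF h] distrib_right sum.distrib)
qed

lemma rhom_ev: "rhom (ev h s)"
  unfolding rhom_def
proof (intro conjI allI ev_add)
  show "ev h s 1 = 1" using ev_mon[of 0 1] rhomD(1)[OF h] by simp
  fix f g
  show "ev h s (f * g) = ev h s f * ev h s g"
  proof (induction f rule: poly3_induct)
    case (mon m c)
    show ?case
      by (induction g rule: poly3_induct)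
        (simp_all add: mult_single ev_mon ev_add lookup_add power_add prod.distrib rhomD[OF h] algebra_simps)
  qed (simp add: distrib_right ev_add)
qed

lemma ev_cst: "ev h s (cst c) = h c"
  by (simp add: ev_mon)

lemma ev_var: "ev h s (var i) = s i"
proof -
  have "(\<Prod>j\<in>UNIV. s j ^ Poly_Mapping.lookup (Poly_Mapping.single i (1::nat)) j) = (\<Prod>j\<in>UNIV. if j = i then s i else 1)"
    by (rule prod.cong) (auto simp: lookup_single when_def)
  then show ?thesis by (simp add: var_def ev_mon rhomD(1)[OF h])
qed

end

text \<open>A copy of the field \<open>'a\<close> with trivial gcds, so that iterated polynomials over it
  are instances of the factorial classes.\<close>

typedef (overloaded) 'a gcd_field = "UNIV :: 'a::field set" by simp

setup_lifting type_definition_gcd_field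

instantiation gcd_field :: (field) field
begin

lift_definition zero_gcd_field :: "'a gcd_field" is 0 .
lift_definition one_gcd_field :: "'a gcd_field" is 1 .
lift_definition plus_gcd_field :: "'a gcd_field \<Rightarrow> 'a gcd_field \<Rightarrow> 'a gcd_field" is "(+)" .
lift_definition times_gcd_field :: "'a gcd_field \<Rightarrow> 'a gcd_field \<Rightarrow> 'a gcd_field" is "(*)" .
lift_definition minus_gcd_field :: "'a gcd_field \<Rightarrow> 'a gcd_field \<Rightarrow> 'a gcd_field" is "(-)" .
lift_definition uminus_gcd_field :: "'a gcd_field \<Rightarrow> 'a gcd_field" is uminus .
lift_definition inverse_gcd_field :: "'a gcd_field \<Rightarrow> 'a gcd_field" is inverse .
lift_definition divide_gcd_field :: "'a gcd_field \<Rightarrow> 'a gcd_field \<Rightarrow> 'a gcd_field" is "(/)" .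

instance
  by standard (transfer, simp add: algebra_simps divide_inverse)+

end

instantiation gcd_field :: (field)
  "{unique_euclidean_ring, normalization_euclidean_semiring, normalization_semidom_multiplicative}"
begin

definition [simp]: "normalize_gcd_field = (normalize_field :: 'a gcd_field \<Rightarrow> _)"
definition [simp]: "unit_factor_gcd_field = (unit_factor_field :: 'a gcd_field \<Rightarrow> _)"
definition [simp]: "modulo_gcd_field = (mod_field :: 'a gcd_field \<Rightarrow> _)"
definition [simp]: "euclidean_size_gcd_field = (euclidean_size_field :: 'a gcd_field \<Rightarrow> _)"
definition [simp]: "division_segment (x :: 'a gcd_field) = 1"

instance
  by standard (simp_all add: dvd_field_iff field_split_simps split: if_splits)

end

instantiation gcd_field :: (field) euclidean_ring_gcd
begin

definition gcd_gcd_field :: "'a gcd_field \<Rightarrow> 'a gcd_field \<Rightarrow> 'a gcd_field" where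
  "gcd_gcd_field = Euclidean_Algorithm.gcd"
definition lcm_gcd_field :: "'a gcd_field \<Rightarrow> 'a gcd_field \<Rightarrow> 'a gcd_field" where
  "lcm_gcd_field = Euclidean_Algorithm.lcm"
definition Gcd_gcd_field :: "'a gcd_field set \<Rightarrow> 'a gcd_field" where
  "Gcd_gcd_field = Euclidean_Algorithm.Gcd"
definition Lcm_gcd_field :: "'a gcd_field set \<Rightarrow> 'a gcd_field" where
  "Lcm_gcd_field = Euclidean_Algorithm.Lcm"

instance
  by standard (simp_all add: gcd_gcd_field_def lcm_gcd_field_def Gcd_gcd_field_def Lcm_gcd_field_def)

end

instance gcd_field :: (field) field_gcd ..

lemma rhom_Abs_gcd_field: "rhom Abs_gcd_field"
  unfolding rhom_def
  by (simp add: one_gcd_field_def plus_gcd_field_def times_gcd_field_def Abs_gcd_field_inverse)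

lemma rhom_Rep_gcd_field: "rhom Rep_gcd_field"
  unfolding rhom_def by (simp add: one_gcd_field.rep_eq plus_gcd_field.rep_eq times_gcd_field.rep_eq)

section \<open>Comparison with iterated univariate polynomials\<close>

definition to_poly :: "'k::field poly3 \<Rightarrow> 'k gcd_field poly poly poly" where
  "to_poly = ev (\<lambda>c. [:[:[:Abs_gcd_field c:]:]:])
     (\<lambda>i. if i = 0 then [:0, 1:] else if i = 1 then [:[:0, 1:]:] else [:[:[:0, 1:]:]:])"

definition from_poly1 :: "'k::field gcd_field poly \<Rightarrow> 'k poly3" where
  "from_poly1 p = poly (map_poly (\<lambda>c. cst (Rep_gcd_field c)) p) (var 2)"
definition from_poly2 :: "'k::field gcd_field poly poly \<Rightarrow> 'k poly3" where
  "from_poly2 p = poly (map_poly from_poly1 p) (var 1)"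
definition from_poly :: "'k::field gcd_field poly poly poly \<Rightarrow> 'k poly3" where
  "from_poly p = poly (map_poly from_poly2 p) (var 0)"

lemma rhom_coeff: "rhom (\<lambda>c. [:[:[:Abs_gcd_field c:]:]:])"
  by (intro rhom_comp[OF _ rhom_pconst] rhom_Abs_gcd_field)

lemma rhom_coeff': "rhom (\<lambda>c. cst (Rep_gcd_field c))"
  by (rule rhom_comp[OF rhom_Rep_gcd_field rhom_cst])

lemma rhom_to_poly: "rhom to_poly"
  unfolding to_poly_def by (rule rhom_ev[OF rhom_coeff])

lemma rhom_from_poly1: "rhom from_poly1"
  unfolding from_poly1_def using rhom_eval[OF rhom_coeff'] .
lemma rhom_from_poly2: "rhom from_poly2"
  unfolding from_poly2_def using rhom_eval[OF rhom_from_poly1] .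
lemma rhom_from_poly: "rhom from_poly"
  unfolding from_poly_def using rhom_eval[OF rhom_from_poly2] .

lemma to_poly_simps:
  "to_poly (cst c) = [:[:[:Abs_gcd_field c:]:]:]"
  "to_poly (var 0) = [:0, 1:]" "to_poly (var 1) = [:[:0, 1:]:]" "to_poly (var 2) = [:[:[:0, 1:]:]:]"
  unfolding to_poly_def ev_cst[OF rhom_coeff] ev_var[OF rhom_coeff] by simp_all

lemma from_poly1_pCons: "from_poly1 (pCons a p) = cst (Rep_gcd_field a) + var 2 * from_poly1 p"
  unfolding from_poly1_def using eval_pCons[OF rhom_coeff'] .
lemma from_poly2_pCons: "from_poly2 (pCons q r) = from_poly1 q + var 1 * from_poly2 r"
  unfolding from_poly2_def using eval_pCons[OF rhom_from_poly1] .
lemma from_poly_pCons: "from_poly (pCons t u) = from_poly2 t + var 0 * from_poly u"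
  unfolding from_poly_def using eval_pCons[OF rhom_from_poly2] .

lemma to_from_poly: "to_poly (from_poly t) = (t :: 'k::field gcd_field poly poly poly)"
proof -
  note hom = rhomD[OF rhom_to_poly]
  have 1: "to_poly (from_poly1 p) = [:[:p:]:]" for p :: "'k::field gcd_field poly"
  proof (induction p)
    case 0
    then show ?case by (simp add: rhomD(4)[OF rhom_from_poly1] hom(4))
  next
    case (pCons a p)
    then show ?case by (simp add: from_poly1_pCons hom to_poly_simps Rep_gcd_field_inverse)
  qed
  have 2: "to_poly (from_poly2 p) = [:p:]" for p :: "'k::field gcd_field poly poly"
  proof (induction p)
    case 0
    then show ?case by (simp add: rhomD(4)[OF rhom_from_poly2] hom(4))
  next
    case (pCons a p)
    then show ?case by (simp add: from_poly2_pCons hom to_poly_simps 1)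
  qed
  show ?thesis
  proof (induction t)
    case 0
    then show ?case by (simp add: rhomD(4)[OF rhom_from_poly] hom(4))
  next
    case (pCons a p)
    then show ?case by (simp add: from_poly_pCons hom to_poly_simps 2)
  qed
qed

lemma from_to_poly: "from_poly (to_poly f) = (f :: 'k::field poly3)"
proof -
  have 0: "from_poly1 0 = 0" "from_poly2 0 = 0" "from_poly 0 = 0"
    using rhomD(4)[OF rhom_from_poly1] rhomD(4)[OF rhom_from_poly2] rhomD(4)[OF rhom_from_poly] by blast+
  have 1: "from_poly1 1 = 1" "from_poly2 1 = 1" "from_poly 1 = 1"
    using rhomD(1)[OF rhom_from_poly1] rhomD(1)[OF rhom_from_poly2] rhomD(1)[OF rhom_from_poly] by blast+
  note s = from_poly1_pCons from_poly2_pCons from_poly_pCons 0 1 to_poly_simps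
  show ?thesis
  proof (rule rhom_agree[OF rhom_comp[OF rhom_to_poly rhom_from_poly]])
    show "rhom (\<lambda>f. f)" unfolding rhom_def by simp
    show "from_poly (to_poly (cst c)) = (cst c :: 'k poly3)" for c by (simp add: s Abs_gcd_field_inverse)
    have R: "Rep_gcd_field (0 :: 'k gcd_field) = 0" "Rep_gcd_field (1 :: 'k gcd_field) = 1"
      using rhomD(1,4)[OF rhom_Rep_gcd_field] by blast+
    show "from_poly (to_poly (var i)) = (var i :: 'k poly3)" for i
      using UNIV_3' by (cases "i = 0"; cases "i = 1"; cases "i = 2") (auto simp: s R)
  qed
qed

text \<open>By Gauss's lemma irreducible elements of the iterated polynomial ring are prime;
  \<open>to_poly\<close> and \<open>from_poly\<close> are inverse homomorphisms, so divisibility and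
  irreducibility can be moved across.\<close>

lemma irreducible_imp_prime_poly3:
  fixes F :: "'k::field poly3"
  assumes "Factorial_Ring.irreducible F"
  shows "prime_elem F"
proof -
  note hom = rhomD[OF rhom_to_poly] and hom' = rhomD[OF rhom_from_poly]
  have dvd: "to_poly p dvd to_poly q \<longleftrightarrow> p dvd q" for p q :: "'k poly3"
  proof
    assume "to_poly p dvd to_poly q"
    then obtain t where "to_poly q = to_poly p * t" by blast
    then have "from_poly (to_poly q) = from_poly (to_poly p * t)" by simp
    then show "p dvd q" unfolding hom' from_to_poly by simp
  next
    assume "p dvd q"
    then show "to_poly p dvd to_poly q" by (auto simp: hom)
  qed
  have "Factorial_Ring.irreducible (to_poly F)"
  proof (rule irreducibleI)
    show "to_poly F \<noteq> 0"
      using assms from_to_poly[of F] hom'(4) unfolding Factorial_Ring.irreducible_def by metis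
    show "\<not> is_unit (to_poly F)" using dvd[of F 1] assms unfolding Factorial_Ring.irreducible_def hom(1) by blast
    fix a b assume "to_poly F = a * b"
    then have "F = from_poly a * from_poly b" by (metis from_to_poly hom'(3))
    then have "from_poly a dvd 1 \<or> from_poly b dvd 1"
      using assms unfolding Factorial_Ring.irreducible_def by blast
    then show "is_unit a \<or> is_unit b" using dvd[of _ 1] hom(1) to_from_poly by metis
  qed
  then have prime: "prime_elem (to_poly F)" by (rule irreducible_imp_prime_poly)
  show ?thesis
  proof (rule prime_elemI)
    show "F \<noteq> 0" "\<not> F dvd 1" using assms unfolding Factorial_Ring.irreducible_def by blast+
    fix a b assume "F dvd a * b"
    then have "to_poly F dvd to_poly a * to_poly b" using dvd hom(3) by metis
    then show "F dvd a \<or> F dvd b" using prime_elem_dvd_multD[OF prime] dvd by blast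
  qed
qed

text \<open>Over a finite field, one plus the product of all \<open>X - a\<close> has no
  root.\<close>

lemma infinite_alg_closed: "infinite (UNIV :: 'k::alg_closed_field set)"
proof
  assume fin: "finite (UNIV :: 'k set)"
  define p where "p = (\<Prod>a\<in>(UNIV :: 'k set). [:- a, 1:]) + 1"
  have val: "poly p c = 1" for c
  proof -
    have "poly (\<Prod>a\<in>(UNIV :: 'k set). [:- a, 1:]) c = 0"
      unfolding poly_prod using fin by (intro prod_zero) auto
    then show ?thesis unfolding p_def by simp
  qed
  have "degree (\<Prod>a\<in>(UNIV :: 'k set). [:- a, 1:]) = card (UNIV :: 'k set)"
    by (subst degree_prod_eq_sum_degree) auto
  moreover have "0 < card (UNIV :: 'k set)" using fin by (simp add: card_gt_0_iff)
  ultimately have "0 < degree p" unfolding p_def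
    by (metis add.commute degree_1 degree_add_eq_right)
  then obtain c where "poly p c = 0" using alg_closed_imp_poly_has_root by blast
  then show False using val by simp
qed

lemma exists_nonroot:
  assumes "infinite A" "(p :: 'a::idom poly) \<noteq> 0"
  obtains c where "c \<in> A" "poly p c \<noteq> 0"
  using poly_roots_finite[OF assms(2)] assms(1) by (metis (mono_tags, lifting) finite_subset mem_Collect_eq subsetI)

text \<open>The variables are specialised one at a time. A nonzero polynomial over a domain has
  finitely many roots, so among the infinitely many constants of the ground field one is not a
  root.\<close>

lemma exists_point_off:
  fixes F :: "'k::field poly3"
  assumes "infinite (UNIV :: 'k set)" "F \<noteq> 0"
  obtains s where "ev (\<lambda>c. c) s F \<noteq> 0"
proof -
  have inf: "infinite (range (Abs_gcd_field :: 'k \<Rightarrow> _))"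
    using assms(1) finite_imageD[of Abs_gcd_field "UNIV :: 'k set"] by (metis Abs_gcd_field_inject UNIV_I injI)
  have inf1: "infinite (range (\<lambda>c :: 'k. [:Abs_gcd_field c:]))"
    using inf finite_imageD[of "\<lambda>c. [:c:]" "range (Abs_gcd_field :: 'k \<Rightarrow> _)"]
    by (auto simp: image_image inj_on_def)
  have inf2: "infinite (range (\<lambda>c :: 'k. [:[:Abs_gcd_field c:]:]))"
    using inf1 finite_imageD[of "\<lambda>c. [:c:]" "range (\<lambda>c :: 'k. [:Abs_gcd_field c:])"]
    by (auto simp: image_image inj_on_def)
  have "to_poly F \<noteq> 0" using assms(2) from_to_poly rhomD(4)[OF rhom_from_poly] by metis
  then obtain c0 where c0: "poly (to_poly F) [:[:Abs_gcd_field c0:]:] \<noteq> 0"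
    using exists_nonroot[OF inf2] by blast
  then obtain c1 where c1: "poly (poly (to_poly F) [:[:Abs_gcd_field c0:]:]) [:Abs_gcd_field c1:] \<noteq> 0"
    using exists_nonroot[OF inf1] by blast
  then obtain c2 where c2: "poly (poly (poly (to_poly F) [:[:Abs_gcd_field c0:]:]) [:Abs_gcd_field c1:]) (Abs_gcd_field c2) \<noteq> 0"
    using exists_nonroot[OF inf] by blast
  define s :: "3 \<Rightarrow> 'k" where "s i = (if i = 0 then c0 else if i = 1 then c1 else c2)" for i
  define E where "E f = Rep_gcd_field (poly (poly (poly (to_poly f) [:[:Abs_gcd_field c0:]:]) [:Abs_gcd_field c1:]) (Abs_gcd_field c2))" for f
  have id: "rhom (\<lambda>c :: 'k. c)" unfolding rhom_def by simp
  have "E f = ev (\<lambda>c. c) s f" for f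
  proof (rule rhom_agree)
    show "rhom E" unfolding E_def by (intro rhom_comp[OF _ rhom_Rep_gcd_field] rhom_comp[OF _ rhom_poly] rhom_to_poly)
    show "rhom (ev (\<lambda>c. c) s)" by (rule rhom_ev[OF id])
    show "E (cst c) = ev (\<lambda>c. c) s (cst c)" for c
      unfolding E_def ev_cst[OF id] by (simp add: to_poly_simps Abs_gcd_field_inverse)
    show "E (var i) = ev (\<lambda>c. c) s (var i)" for i
      unfolding ev_var[OF id] using UNIV_3'
      by (cases "i = 0"; cases "i = 1"; cases "i = 2")
        (auto simp: E_def s_def to_poly_simps Abs_gcd_field_inverse)
  qed
  moreover have "E F \<noteq> 0" unfolding E_def using c2 rhomD(4)[OF rhom_Rep_gcd_field] Rep_gcd_field_inject by metis
  ultimately show ?thesis using that by metis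
qed

section \<open>The graded domain of a plane curve\<close>

definition mdeg :: "(3 \<Rightarrow>\<^sub>0 nat) \<Rightarrow> nat" where "mdeg m = (\<Sum>i\<in>UNIV. Poly_Mapping.lookup m i)"

lemma homogeneous_iff: "homogeneous d f \<longleftrightarrow> (\<forall>m\<in>Poly_Mapping.keys f. mdeg m = d)"
  unfolding homogeneous_def mdeg_def ..

lemma mdeg_eq_0: "mdeg m = 0 \<longleftrightarrow> m = 0"
  unfolding mdeg_def by (auto intro: poly_mapping_eqI)

lemma mdeg_add: "mdeg (m + n) = mdeg m + mdeg n"
  by (simp add: mdeg_def lookup_add sum.distrib)

lemma homogeneous_0 [simp]: "homogeneous d 0"
  unfolding homogeneous_iff by simp

lemma homogeneous_add: "homogeneous d f \<Longrightarrow> homogeneous d g \<Longrightarrow> homogeneous d (f + g)"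
  unfolding homogeneous_iff using keys_add[of f g] by blast

lemma homogeneous_mult:
  "homogeneous d f \<Longrightarrow> homogeneous e g \<Longrightarrow> homogeneous (d + e) (f * g :: 'k::comm_ring_1 poly3)"
  unfolding homogeneous_iff using keys_mult[of f g] mdeg_add by fastforce

lemma homogeneous_cst: "homogeneous 0 (cst c)"
  unfolding homogeneous_iff by (simp add: mdeg_def)

lemma homogeneous_1: "homogeneous 0 (1 :: 'k::comm_ring_1 poly3)"
  using homogeneous_cst[of 1] by simp

lemma homogeneous_cst_mult: "homogeneous d f \<Longrightarrow> homogeneous d (cst c * f :: 'k::comm_ring_1 poly3)"
  using homogeneous_mult[OF homogeneous_cst] by fastforce

lemma homogeneous_diff: "homogeneous d f \<Longrightarrow> homogeneous d g \<Longrightarrow> homogeneous d (f - g :: 'k::comm_ring_1 poly3)"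
  using homogeneous_add[of d f "cst (-1) * g"] homogeneous_cst_mult[of d g "-1"] by (simp add: single_uminus)

lemma homogeneous_var: "homogeneous 1 (var i)"
proof -
  have "(\<Sum>j\<in>UNIV. Poly_Mapping.lookup (Poly_Mapping.single i (1::nat)) j) = (\<Sum>j\<in>UNIV. if j = i then 1 else 0)"
    by (rule sum.cong) (auto simp: lookup_single when_def)
  then show ?thesis unfolding homogeneous_iff mdeg_def var_def by (simp add: when_def)
qed

lemma homogeneous_power: "homogeneous d f \<Longrightarrow> homogeneous (n * d) (f ^ n :: 'k::comm_ring_1 poly3)"
  by (induction n) (simp_all add: homogeneous_1 homogeneous_mult)

text \<open>Integer degrees with vanishing negative components free the shift in
  \<open>comp_mult\<close> from side conditions.\<close>

definition comp :: "int \<Rightarrow> 'k::comm_ring_1 poly3 \<Rightarrow> 'k poly3" where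
  "comp d f = (\<Sum>m\<in>{m \<in> Poly_Mapping.keys f. int (mdeg m) = d}. mon m (Poly_Mapping.lookup f m))"

lemma lookup_comp: "Poly_Mapping.lookup (comp d f) m = (if int (mdeg m) = d then Poly_Mapping.lookup f m else 0)"
  unfolding comp_def by (simp add: lookup_sum lookup_single when_def in_keys_iff)

lemma comp_add: "comp d (f + g) = comp d f + comp d g"
  by (rule poly_mapping_eqI) (simp add: lookup_comp lookup_add)

lemma comp_diff: "comp d (f - g) = comp d f - comp d g"
  by (rule poly_mapping_eqI) (simp add: lookup_comp lookup_minus)

lemma comp_0 [simp]: "comp d 0 = 0"
  by (rule poly_mapping_eqI) (simp add: lookup_comp)

lemma comp_sum: "comp d (sum f A) = (\<Sum>i\<in>A. comp d (f i))"
  by (induction A rule: infinite_finite_induct) (auto simp: comp_add)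

lemma comp_neg: "d < 0 \<Longrightarrow> comp d f = 0"
  by (rule poly_mapping_eqI) (auto simp: lookup_comp)

lemma comp_homogeneous: "homogeneous e f \<Longrightarrow> comp d f = (if d = int e then f else 0)"
  by (rule poly_mapping_eqI) (auto simp: lookup_comp homogeneous_iff in_keys_iff)

lemma homogeneous_comp: "homogeneous (nat d) (comp d f)"
  unfolding homogeneous_iff by (auto simp: lookup_comp in_keys_iff split: if_splits)

definition maxdeg :: "'k::zero poly3 \<Rightarrow> nat" where
  "maxdeg f = (\<Sum>m\<in>Poly_Mapping.keys f. mdeg m)"

lemma le_maxdeg: "m \<in> Poly_Mapping.keys f \<Longrightarrow> mdeg m \<le> maxdeg f"
  unfolding maxdeg_def by (rule member_le_sum) auto

lemma sum_comp:
  assumes "maxdeg f \<le> n"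
  shows "(\<Sum>d\<le>n. comp (int d) f) = f"
proof (rule poly_mapping_eqI)
  fix m
  have "Poly_Mapping.lookup (\<Sum>d\<le>n. comp (int d) f) m = (\<Sum>d\<le>n. if mdeg m = d then Poly_Mapping.lookup f m else 0)"
    by (simp add: lookup_sum lookup_comp)
  also have "\<dots> = Poly_Mapping.lookup f m"
    using le_maxdeg[of m f] assms by (cases "Poly_Mapping.lookup f m = 0") (auto simp: in_keys_iff)
  finally show "Poly_Mapping.lookup (\<Sum>d\<le>n. comp (int d) f) m = Poly_Mapping.lookup f m" .
qed

lemma comp_mult:
  assumes "homogeneous d f"
  shows "comp (e + int d) (f * g) = f * comp e g"
proof -
  have "comp (e + int d) (f * g) = (\<Sum>i\<le>maxdeg g. comp (e + int d) (f * comp (int i) g))"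
    by (subst (1) sum_comp[OF order_refl, of g, symmetric]) (simp add: sum_distrib_left comp_sum)
  also have "\<dots> = (\<Sum>i\<le>maxdeg g. if e = int i then f * comp (int i) g else 0)"
  proof (rule sum.cong[OF refl])
    fix i
    have "homogeneous (d + i) (f * comp (int i) g)"
      using homogeneous_mult[OF assms homogeneous_comp[of "int i" g]] by simp
    then show "comp (e + int d) (f * comp (int i) g) = (if e = int i then f * comp (int i) g else 0)"
      by (simp add: comp_homogeneous)
  qed
  also have "\<dots> = (\<Sum>i\<le>maxdeg g. f * comp e (comp (int i) g))"
    by (rule sum.cong) (auto simp: comp_homogeneous[OF homogeneous_comp])
  also have "\<dots> = f * comp e g"
    by (simp add: comp_sum[symmetric] sum_distrib_left[symmetric] sum_comp)
  finally show ?thesis .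
qed

lemma comp_dvd: "homogeneous d f \<Longrightarrow> f dvd g \<Longrightarrow> f dvd comp e g"
  using comp_mult[of d f "e - int d"] by (auto elim!: dvdE)

definition hpart :: "int \<Rightarrow> 'k::comm_ring_1 poly3 set" where
  "hpart d = (if d < 0 then {0} else {f. homogeneous (nat d) f})"

lemma hpart_int [simp]: "hpart (int d) = {f. homogeneous d f}"
  unfolding hpart_def by simp

lemma comp_hpart: "comp d f \<in> hpart d"
  unfolding hpart_def by (simp add: comp_neg homogeneous_comp)

lemma hpart_comp: "f \<in> hpart d \<Longrightarrow> comp e f = (if e = d then f else 0)"
  unfolding hpart_def using comp_homogeneous[of "nat d" f e] by (auto split: if_splits)

lemma hpart_mult: "f \<in> hpart d \<Longrightarrow> g \<in> hpart e \<Longrightarrow> f * g \<in> hpart (d + e)"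
  unfolding hpart_def using homogeneous_mult[of "nat d" f "nat e" g]
  by (auto split: if_splits simp: nat_add_distrib)

interpretation poly3: vspace "\<lambda>c f. cst c * (f :: 'k::field poly3)"
  by unfold_locales (simp_all add: distrib_left distrib_right single_add mult_single flip: mult.assoc)

lemma subspace_hpart: "poly3.subspace (hpart d :: 'k::field poly3 set)"
  unfolding hpart_def
  by (auto intro!: poly3.subspaceI homogeneous_add homogeneous_cst_mult)

lemma finite_mdeg: "finite {m. mdeg m \<le> d}"
proof -
  have "finite ((\<lambda>m. Poly_Mapping.lookup m) ` {m :: 3 \<Rightarrow>\<^sub>0 nat. mdeg m \<le> d})"
  proof (rule finite_subset)
    show "(\<lambda>m. Poly_Mapping.lookup m) ` {m :: 3 \<Rightarrow>\<^sub>0 nat. mdeg m \<le> d} \<subseteq> (\<Pi>\<^sub>E i\<in>UNIV. {..d})"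
    proof (rule image_subsetI)
      fix m :: "3 \<Rightarrow>\<^sub>0 nat" assume "m \<in> {m. mdeg m \<le> d}"
      moreover have "Poly_Mapping.lookup m i \<le> mdeg m" for i unfolding mdeg_def by (rule member_le_sum) auto
      ultimately show "Poly_Mapping.lookup m \<in> (\<Pi>\<^sub>E i\<in>UNIV. {..d})"
        by (auto simp: PiE_iff intro: order_trans)
    qed
    show "finite (\<Pi>\<^sub>E i\<in>(UNIV :: 3 set). {..d})" by (rule finite_PiE) simp_all
  qed
  then show ?thesis by (rule finite_imageD) (auto simp: inj_on_def poly_mapping_eqI)
qed

lemma span_mon: "(\<And>m. m \<in> Poly_Mapping.keys f \<Longrightarrow> mon m 1 \<in> B) \<Longrightarrow> f \<in> poly3.span B"
proof -
  assume B: "\<And>m. m \<in> Poly_Mapping.keys f \<Longrightarrow> mon m 1 \<in> B"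
  have "(\<Sum>m\<in>Poly_Mapping.keys f. cst (Poly_Mapping.lookup f m) * mon m 1) \<in> poly3.span B"
    by (intro poly3.span_sum poly3.span_scale poly3.span_base B)
  then show ?thesis using poly3_expand[of f] by (simp add: mult_single)
qed

lemma fin_dim_hpart: "poly3.fin_dim (hpart d :: 'k::field poly3 set)"
proof -
  have "(hpart d :: 'k poly3 set) \<subseteq> poly3.span ((\<lambda>m. mon m 1) ` {m. mdeg m \<le> nat d})"
  proof
    fix f :: "'k poly3" assume "f \<in> hpart d"
    then have "homogeneous (nat d) f" unfolding hpart_def by (auto split: if_splits)
    then show "f \<in> poly3.span ((\<lambda>m. mon m 1) ` {m. mdeg m \<le> nat d})"
      unfolding homogeneous_iff by (intro span_mon) auto
  qed
  then show ?thesis unfolding poly3.fin_dim_def using finite_mdeg by blast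
qed

section \<open>Linear parameters of a plane curve\<close>

lemma rhom_id: "rhom (\<lambda>c. c)"
  unfolding rhom_def by simp

lemma ev_scale:
  assumes "homogeneous d f"
  shows "ev h (\<lambda>i. t * s i) f = t ^ d * ev h s f"
proof -
  have "(\<Prod>i\<in>UNIV. (t * s i) ^ Poly_Mapping.lookup m i) = t ^ d * (\<Prod>i\<in>UNIV. s i ^ Poly_Mapping.lookup m i)"
    if "m \<in> Poly_Mapping.keys f" for m
    using assms that unfolding homogeneous_iff mdeg_def
    by (auto simp: power_mult_distrib prod.distrib power_sum)
  then show ?thesis unfolding ev_def sum_distrib_left by (intro sum.cong) (auto simp: ac_simps)
qed

text \<open>Modulo the ideal \<open>N\<close> the map is the identity on constants and variables,
  hence everywhere. In particular, elements killed by \<open>\<psi>\<close> lie in \<open>N\<close>,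
  which is how kernels of substitutions are computed below.\<close>

lemma endo_diff:
  fixes \<psi> :: "'k::comm_ring_1 poly3 \<Rightarrow> 'k poly3"
  assumes \<psi>: "rhom \<psi>" "\<And>c. \<psi> (cst c) = cst c" and v: "\<And>i. var i - \<psi> (var i) \<in> N"
    and N: "0 \<in> N" "\<And>a b. a \<in> N \<Longrightarrow> b \<in> N \<Longrightarrow> a + b \<in> N" "\<And>a b. b \<in> N \<Longrightarrow> a * b \<in> N"
  shows "f - \<psi> f \<in> N"
proof (induction f rule: poly3_ring_induct)
  case (add f g)
  then have "(f - \<psi> f) + (g - \<psi> g) \<in> N" using N by blast
  then show ?case by (simp add: rhomD(2)[OF \<psi>(1)] algebra_simps)
next
  case (mult f g)
  then have "f * (g - \<psi> g) + \<psi> g * (f - \<psi> f) \<in> N" using N by blast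
  then show ?case by (simp add: rhomD(3)[OF \<psi>(1)] algebra_simps)
qed (simp_all add: \<psi>(2) v N(1))

text \<open>The point \<open>p\<close> lies off the curve, so two independent lines through
  \<open>p\<close> have no common point on the curve: \<open>l1\<close> and \<open>l2\<close> become
  the linear parameters. By \<open>p i0 = 1\<close>, the variable \<open>var i0\<close> is a
  coordinate on the line spanned by \<open>p\<close>.\<close>

locale plane_curve =
  fixes F :: "'k::field poly3" and d :: nat and p :: "3 \<Rightarrow> 'k" and i0 i1 i2 :: 3
  assumes F_hom: "homogeneous d F" and F_prime: "prime_elem F"
    and F_p: "ev (\<lambda>c. c) p F \<noteq> 0" and p_i0: "p i0 = 1"
    and UNIV_i: "UNIV = {i0, i1, i2}" and i_neq: "i0 \<noteq> i1" "i0 \<noteq> i2" "i1 \<noteq> i2"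
begin

definition l1 :: "'k poly3" where "l1 = var i1 - cst (p i1) * var i0"
definition l2 :: "'k poly3" where "l2 = var i2 - cst (p i2) * var i0"

lemma l_hom: "homogeneous 1 l1" "homogeneous 1 l2"
  unfolding l1_def l2_def by (intro homogeneous_diff homogeneous_cst_mult homogeneous_var)+

lemma lookup_var: "Poly_Mapping.lookup (var i :: 'k poly3) (Poly_Mapping.single j 1) = (if i = j then 1 else 0)"
proof -
  have "Poly_Mapping.single i (1::nat) = Poly_Mapping.single j 1 \<longleftrightarrow> i = j"
    by (metis lookup_single_eq lookup_single_not_eq zero_neq_one)
  then show ?thesis unfolding var_def by (auto simp: lookup_single when_def)
qed

lemma lookup_cst_var:
  "Poly_Mapping.lookup (cst c * var i :: 'k poly3) (Poly_Mapping.single j 1) = (if i = j then c else 0)"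
proof -
  have "Poly_Mapping.single i (1::nat) = Poly_Mapping.single j 1 \<longleftrightarrow> i = j"
    by (metis lookup_single_eq lookup_single_not_eq zero_neq_one)
  then show ?thesis unfolding var_def by (auto simp: mult_single lookup_single when_def)
qed

lemma l_nonzero: "l1 \<noteq> 0" "l2 \<noteq> 0"
proof -
  have "Poly_Mapping.lookup l1 (Poly_Mapping.single i1 1) = 1" "Poly_Mapping.lookup l2 (Poly_Mapping.single i2 1) = 1"
    unfolding l1_def l2_def lookup_minus lookup_var lookup_cst_var using i_neq by simp_all
  then show "l1 \<noteq> 0" "l2 \<noteq> 0" by auto
qed

text \<open>Restriction to the line through the point \<open>p\<close>; its kernel is the ideal \<open>(l1, l2)\<close>.\<close>

definition \<theta> :: "'k poly3 \<Rightarrow> 'k poly3" where "\<theta> = ev cst (\<lambda>i. var i0 * cst (p i))"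

lemma rhom_\<theta>: "rhom \<theta>"
  unfolding \<theta>_def by (rule rhom_ev[OF rhom_cst])

lemma \<theta>_homogeneous: "homogeneous e f \<Longrightarrow> \<theta> f = var i0 ^ e * cst (ev (\<lambda>c. c) p f)"
proof -
  assume f: "homogeneous e f"
  have "ev cst (\<lambda>i. cst (p i)) g = cst (ev (\<lambda>c. c) p g)" for g
    by (rule rhom_agree[OF rhom_ev[OF rhom_cst] rhom_comp[OF rhom_ev[OF rhom_id] rhom_cst]])
      (simp_all add: ev_cst[OF rhom_cst] ev_var[OF rhom_cst] ev_cst[OF rhom_id] ev_var[OF rhom_id])
  then show ?thesis unfolding \<theta>_def ev_scale[OF f] by simp
qed

lemma var_nonzero: "var i \<noteq> (0 :: 'k poly3)"
  using lookup_var[of i i] by auto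

lemma cst_nonzero: "c \<noteq> 0 \<Longrightarrow> cst c \<noteq> (0 :: 'k poly3)"
  by (metis lookup_single_eq lookup_zero)

lemma \<theta>_F: "\<theta> F \<noteq> 0"
  unfolding \<theta>_homogeneous[OF F_hom] using F_p var_nonzero cst_nonzero by simp

text \<open>\<open>\<theta>\<close> moves every variable by a multiple of \<open>l1\<close> or
  \<open>l2\<close>, so \<open>h - \<theta> h\<close> lies in \<open>(l1, l2)\<close> for all
  \<open>h\<close>.\<close>

lemma \<theta>_kernel:
  assumes "\<theta> h = 0"
  obtains u w where "h = l1 * u + l2 * w"
proof -
  have "h - \<theta> h \<in> {l1 * u + l2 * w | u w. True}"
  proof (rule endo_diff[OF rhom_\<theta>])
    show "\<theta> (cst c) = cst c" for c unfolding \<theta>_def by (rule ev_cst[OF rhom_cst])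
    show "var i - \<theta> (var i) \<in> {l1 * u + l2 * w | u w. True}" for i
    proof -
      have "var i - \<theta> (var i) = var i - cst (p i) * var i0" unfolding \<theta>_def ev_var[OF rhom_cst] by simp
      moreover have "i = i0 \<or> i = i1 \<or> i = i2" using UNIV_i by auto
      moreover have "var i0 - cst (p i0) * var i0 = l1 * 0 + l2 * 0" "l1 = l1 * 1 + l2 * 0" "l2 = l1 * 0 + l2 * 1"
        by (simp_all add: p_i0)
      ultimately show ?thesis unfolding l1_def[symmetric] l2_def[symmetric]
        using l1_def l2_def by (smt (verit, best) mem_Collect_eq)
    qed
    show "0 \<in> {l1 * u + l2 * w | u w. True}" by (auto intro!: exI[of _ 0])
    fix a b assume "b \<in> {l1 * u + l2 * w | u w. True}"
    then obtain u w where b: "b = l1 * u + l2 * w" by blast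
    have "a * b = l1 * (a * u) + l2 * (a * w)" unfolding b by (simp add: algebra_simps)
    then show "a * b \<in> {l1 * u + l2 * w | u w. True}" by blast
    assume "a \<in> {l1 * u + l2 * w | u w. True}"
    then obtain u' w' where a: "a = l1 * u' + l2 * w'" by blast
    have "a + b = l1 * (u' + u) + l2 * (w' + w)" unfolding a b by (simp add: algebra_simps)
    then show "a + b \<in> {l1 * u + l2 * w | u w. True}" by blast
  qed
  then show ?thesis using assms that by auto
qed

text \<open>The substitution \<open>\<psi>\<close> eliminates \<open>var i1\<close>: it kills
  \<open>l1\<close> and fixes \<open>l2\<close>. Since \<open>l2\<close> is nonzero it must kill
  \<open>w\<close>, which is then divisible by \<open>l1\<close>.\<close>

lemma l_regular:
  assumes "l1 * u = l2 * w"
  obtains v where "u = l2 * v" "w = l1 * v"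
proof -
  define \<psi> :: "'k poly3 \<Rightarrow> 'k poly3" where "\<psi> = ev cst (\<lambda>i. if i = i1 then cst (p i1) * var i0 else var i)"
  have \<psi>: "rhom \<psi>" unfolding \<psi>_def by (rule rhom_ev[OF rhom_cst])
  have cst: "\<psi> (cst c) = cst c" for c unfolding \<psi>_def by (rule ev_cst[OF rhom_cst])
  have var: "\<psi> (var i) = (if i = i1 then cst (p i1) * var i0 else var i)" for i
    unfolding \<psi>_def by (rule ev_var[OF rhom_cst])
  have l: "\<psi> l1 = 0" "\<psi> l2 = l2"
    unfolding l1_def l2_def using i_neq by (simp_all add: rhomD[OF \<psi>] cst var)
  have "\<psi> (l1 * u) = \<psi> (l2 * w)" using assms by simp
  then have "\<psi> w = 0" using l l_nonzero by (simp add: rhomD[OF \<psi>])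
  moreover have "w - \<psi> w \<in> {f. l1 dvd f}"
    by (rule endo_diff[OF \<psi> cst]) (auto simp: var l1_def)
  ultimately obtain v where v: "w = l1 * v" by auto
  then have "l1 * u = l1 * (l2 * v)" using assms by (simp add: ac_simps)
  then have "u = l2 * v" using l_nonzero by simp
  then show ?thesis using that v by blast
qed

lemma F_not_unit: "\<not> F dvd 1" using F_prime by (simp add: prime_elem_def)

lemma d_pos: "0 < d"
proof (rule ccontr)
  assume "\<not> 0 < d"
  then have "\<theta> F = cst (ev (\<lambda>c. c) p F)" using \<theta>_homogeneous[OF F_hom] by simp
  have "Poly_Mapping.keys F \<subseteq> {0}"
    using F_hom \<open>\<not> 0 < d\<close> unfolding homogeneous_iff by (auto simp: mdeg_eq_0)
  then have F: "F = cst (Poly_Mapping.lookup F 0)"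
    by (intro poly_mapping_eqI) (auto simp: lookup_single when_def in_keys_iff subset_iff)
  have "Poly_Mapping.lookup F 0 \<noteq> 0" using F F_prime by (metis prime_elem_def single_zero)
  then have "F * cst (inverse (Poly_Mapping.lookup F 0)) = 1" by (subst F) (simp add: mult_single)
  then show False using F_not_unit by (metis dvd_triv_left)
qed

text \<open>A cofactor \<open>h\<close> is killed by \<open>\<theta>\<close>, hence lies in
  \<open>(l1, l2)\<close> and has no constant term; as \<open>d\<close> is positive,
  \<open>F * h\<close> then has no part of degree 1.\<close>

lemma F_not_dvd_linear:
  assumes "\<theta> l = 0" "homogeneous 1 l" "l \<noteq> 0"
  shows "\<not> F dvd l"
proof
  assume "F dvd l"
  then obtain h where h: "l = F * h" by blast
  then have "\<theta> F * \<theta> h = 0" using assms(1) rhomD(3)[OF rhom_\<theta>] by metis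
  then have "\<theta> h = 0" using \<theta>_F by simp
  then obtain u w where uw: "h = l1 * u + l2 * w" using \<theta>_kernel by blast
  have "comp 0 h = 0"
    unfolding uw comp_add using comp_mult[OF l_hom(1), of "-1" u] comp_mult[OF l_hom(2), of "-1" w]
    by (simp add: comp_neg)
  then have "comp (1 - int d) h = 0" using d_pos by (cases "d = 1") (simp_all add: comp_neg)
  then have "comp 1 l = 0" unfolding h using comp_mult[OF F_hom, of "1 - int d" h] by simp
  then show False using comp_homogeneous[OF assms(2), of 1] assms(3) by simp
qed

lemma \<theta>_l: "\<theta> l1 = 0" "\<theta> l2 = 0"
  unfolding l1_def l2_def \<theta>_def
  by (simp_all add: rhomD[OF rhom_ev[OF rhom_cst]] ev_cst[OF rhom_cst] ev_var[OF rhom_cst] p_i0 mult.commute)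

definition Fpart :: "int \<Rightarrow> 'k poly3 set" where "Fpart m = hpart m \<inter> {f. F dvd f}"

text \<open>Modulo \<open>(l1, l2)\<close> the polynomial ring is that of the single variable
  \<open>var i0\<close>, and \<open>F\<close> becomes a nonzero multiple of its \<open>d\<close>-th
  power. So \<open>F\<close> is a nonzerodivisor there, which gives \<open>koszul\<close>, and
  divides every form of degree at least \<open>d\<close>, which gives \<open>primary\<close> with
  bound \<open>d\<close>.\<close>

sublocale graded_surface "\<lambda>c f. cst c * (f :: 'k poly3)" hpart Fpart l1 l2 "int d"
proof unfold_locales
  fix a b u v w :: "'k poly3" and c :: 'k and i j m :: int
  show "a * (cst c * b) = cst c * (a * b)" by (simp add: ac_simps)
  show "poly3.subspace (hpart m)" by (rule subspace_hpart)
  show "poly3.fin_dim (hpart m)" by (rule fin_dim_hpart)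
  show "hpart m = {0}" if "m < 0" using that unfolding hpart_def by simp
  show "a * b \<in> hpart (i + j)" if "a \<in> hpart i" "b \<in> hpart j" using hpart_mult that by blast
  show "1 \<in> hpart 0" using homogeneous_1 unfolding hpart_def by simp
  show "poly3.subspace (Fpart m)" unfolding Fpart_def
    by (intro poly3.subspace_inter subspace_hpart) (auto intro!: poly3.subspaceI)
  show "Fpart m \<subseteq> hpart m" unfolding Fpart_def by blast
  show "a * b \<in> Fpart (i + j)" if "a \<in> hpart i" "b \<in> Fpart j"
    using that hpart_mult unfolding Fpart_def by auto
  show "a \<in> Fpart i \<or> b \<in> Fpart j" if "a \<in> hpart i" "b \<in> hpart j" "a * b \<in> Fpart (i + j)"
    using that prime_elem_dvd_multD[OF F_prime] unfolding Fpart_def by blast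
  show "1 \<notin> Fpart 0" using F_not_unit unfolding Fpart_def by blast
  show "l1 \<in> hpart 1" "l2 \<in> hpart 1" using l_hom unfolding hpart_def by simp_all
  show "l1 \<notin> Fpart 1" "l2 \<notin> Fpart 1"
    using F_not_dvd_linear \<theta>_l l_hom l_nonzero unfolding Fpart_def by blast+
next
  fix u w :: "'k poly3" and m :: int
  assume u: "u \<in> hpart m" and w: "w \<in> hpart m" and "l1 * u - l2 * w \<in> Fpart (m + 1)"
  then obtain h where h: "l1 * u - l2 * w = F * h" unfolding Fpart_def by auto
  \<comment> \<open>The cofactor \<open>h\<close> lies in \<open>(l1, l2)\<close>; its two parts are
    absorbed into \<open>u\<close> and \<open>w\<close>, after which \<open>l_regular\<close>
    applies to an exact equation.\<close>
  then have "\<theta> (l1 * u - l2 * w) = \<theta> (F * h)" by simp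
  then have "\<theta> F * \<theta> h = 0" unfolding rhomD[OF rhom_\<theta>] \<theta>_l by simp
  then have "\<theta> h = 0" using \<theta>_F by simp
  then obtain h1 h2 where h12: "h = l1 * h1 + l2 * h2" using \<theta>_kernel by blast
  have "l1 * (u - F * h1) = l2 * (w + F * h2)" using h unfolding h12 by (simp add: algebra_simps)
  then obtain v where v: "u - F * h1 = l2 * v" "w + F * h2 = l1 * v" using l_regular by blast
  \<comment> \<open>\<open>v\<close> need not be homogeneous; its component of degree
    \<open>m - 1\<close> is the witness.\<close>
  have lc: "comp m (l2 * v) = l2 * comp (m - 1) v" "comp m (l1 * v) = l1 * comp (m - 1) v"
    using comp_mult[OF l_hom(2), of "m - 1" v] comp_mult[OF l_hom(1), of "m - 1" v] by simp_all
  have "u - l2 * comp (m - 1) v = comp m (F * h1)"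
    using arg_cong[OF v(1), of "comp m"] hpart_comp[OF u, of m] lc by (simp add: comp_diff algebra_simps)
  moreover have "l1 * comp (m - 1) v - w = comp m (F * h2)"
    using arg_cong[OF v(2), of "comp m"] hpart_comp[OF w, of m] lc by (simp add: comp_add algebra_simps)
  then have "w - l1 * comp (m - 1) v = - comp m (F * h2)" by (simp add: algebra_simps)
  moreover have "comp m (F * h1) \<in> Fpart m" "- comp m (F * h2) \<in> Fpart m"
    using comp_dvd[OF F_hom, of _ m] comp_hpart[of m] poly3.subspace_neg[OF subspace_hpart]
    unfolding Fpart_def by auto
  ultimately show "\<exists>v\<in>hpart (m - 1). u - l2 * v \<in> Fpart m \<and> w - l1 * v \<in> Fpart m"
    using comp_hpart[of "m - 1" v] by (intro bexI[of _ "comp (m - 1) v"]) auto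
next
  fix v :: "'k poly3" and m :: int
  assume m: "int d \<le> m" and v: "v \<in> hpart m"
  then have hv: "homogeneous (nat m) v" unfolding hpart_def by (auto split: if_splits)
  \<comment> \<open>Chosen so that \<open>F * t\<close> and \<open>v\<close> take the same value at
    \<open>p\<close> and so have the same image under \<open>\<theta>\<close>.\<close>
  define c where "c = ev (\<lambda>c. c) p v / ev (\<lambda>c. c) p F"
  define t where "t = cst c * var i0 ^ (nat m - d)"
  have t: "homogeneous (nat m - d) t"
    unfolding t_def using homogeneous_cst_mult homogeneous_power[OF homogeneous_var, of "nat m - d"] by fastforce
  have "\<theta> t = t"
    unfolding t_def \<theta>_def
    by (simp add: rhomD[OF rhom_ev[OF rhom_cst]] ev_cst[OF rhom_cst] ev_var[OF rhom_cst] p_i0)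
  then have "\<theta> (v - F * t) = var i0 ^ nat m * cst (ev (\<lambda>c. c) p v) - var i0 ^ d * cst (ev (\<lambda>c. c) p F) * t"
    by (simp add: rhomD[OF rhom_\<theta>] \<theta>_homogeneous[OF hv] \<theta>_homogeneous[OF F_hom])
  also have "var i0 ^ d * cst (ev (\<lambda>c. c) p F) * t = (var i0 ^ d * var i0 ^ (nat m - d)) * (cst (ev (\<lambda>c. c) p F) * cst c)"
    unfolding t_def by (simp add: ac_simps)
  also have "var i0 ^ d * var i0 ^ (nat m - d) = (var i0 ^ nat m :: 'k poly3)"
    using m by (simp flip: power_add)
  also have "cst (ev (\<lambda>c. c) p F) * cst c = cst (ev (\<lambda>c. c) p v)"
    unfolding c_def using F_p by (simp add: mult_single)
  finally have "\<theta> (v - F * t) = 0" by simp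
  then obtain u w where uw: "v - F * t = l1 * u + l2 * w" using \<theta>_kernel by blast
  have Ft: "homogeneous (nat m) (F * t)" using homogeneous_mult[OF F_hom t] m by simp
  have "v - F * t = comp m (v - F * t)"
    using comp_homogeneous[OF homogeneous_diff[OF hv Ft], of m] m by simp
  also have "\<dots> = l1 * comp (m - 1) u + l2 * comp (m - 1) w"
    unfolding uw comp_add using comp_mult[OF l_hom(1), of "m - 1" u] comp_mult[OF l_hom(2), of "m - 1" w] by simp
  finally have "v - (l1 * comp (m - 1) u + l2 * comp (m - 1) w) = F * t" by (simp add: algebra_simps)
  moreover have "F * t \<in> Fpart m" using Ft m unfolding Fpart_def hpart_def by simp
  ultimately show "\<exists>u\<in>hpart (m - 1). \<exists>w\<in>hpart (m - 1). v - (l1 * u + l2 * w) \<in> Fpart m"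
    using comp_hpart by metis
qed

end

lemma plane_curve_exists:
  fixes F :: "'k::field poly3"
  assumes "infinite (UNIV :: 'k set)" "homogeneous d F" "Factorial_Ring.irreducible F"
  obtains p i0 i1 i2 where "plane_curve F d p i0 i1 i2"
proof -
  have prime: "prime_elem F" using irreducible_imp_prime_poly3 assms(3) by blast
  then have "F \<noteq> 0" by (simp add: prime_elem_def)
  then obtain s where s: "ev (\<lambda>c. c) s F \<noteq> 0" using exists_point_off[OF assms(1)] by blast
  have "\<exists>t i0. t i0 = 1 \<and> ev (\<lambda>c. c) t F \<noteq> 0"
  proof (cases "\<exists>i. s i \<noteq> 0")
    case True
    then obtain i0 where i0: "s i0 \<noteq> 0" by blast
    have "ev (\<lambda>c. c) (\<lambda>i. inverse (s i0) * s i) F \<noteq> 0"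
      unfolding ev_scale[OF assms(2)] using s i0 by simp
    then show ?thesis using i0 by (intro exI[of _ "\<lambda>i. inverse (s i0) * s i"] exI[of _ i0]) simp
  next
    case False
    \<comment> \<open>If the point found is the origin, writing it as 0 times
      \<open>(1, 1, 1)\<close> shows \<open>d = 0\<close>, and then \<open>F\<close> does not vanish
      at \<open>(1, 1, 1)\<close> either.\<close>
    then have "s = (\<lambda>i. 0 * 1)" by auto
    then have "ev (\<lambda>c. c) s F = 0 ^ d * ev (\<lambda>c. c) (\<lambda>_. 1) F" by (simp only: ev_scale[OF assms(2)])
    then have "d = 0" using s by (metis mult_zero_left power_0_left)
    then have "ev (\<lambda>c. c) (\<lambda>_. 1) F \<noteq> 0" using s \<open>ev (\<lambda>c. c) s F = _\<close> by simp
    then show ?thesis by (intro exI[of _ "\<lambda>_. 1"]) simp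
  qed
  then obtain t i0 where t: "t i0 = 1" "ev (\<lambda>c. c) t F \<noteq> 0" by blast
  have neq: "(0::3) \<noteq> 1" "(0::3) \<noteq> 2" "(1::3) \<noteq> 2" by simp_all
  have "\<exists>i1 i2. UNIV = {i0, i1, i2} \<and> i0 \<noteq> i1 \<and> i0 \<noteq> i2 \<and> i1 \<noteq> i2"
  proof -
    consider "i0 = 0" | "i0 = 1" | "i0 = 2" using UNIV_3' by auto
    then show ?thesis
    proof cases
      case 1
      then show ?thesis using UNIV_3' neq by (intro exI[of _ 1] exI[of _ 2]) simp
    next
      case 2
      then show ?thesis using UNIV_3' neq by (intro exI[of _ 0] exI[of _ 2]) auto
    next
      case 3
      then show ?thesis using UNIV_3' neq by (intro exI[of _ 0] exI[of _ 1]) auto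
    qed
  qed
  then obtain i1 i2 where "UNIV = {i0, i1, i2}" "i0 \<noteq> i1" "i0 \<noteq> i2" "i1 \<noteq> i2" by blast
  then have "plane_curve F d t i0 i1 i2" using assms(2) prime t by unfold_locales auto
  then show ?thesis using that by blast
qed

section \<open>Quotient rings and lengths of modules\<close>

definition sideal :: "'s::comm_ring_1 set \<Rightarrow> bool" where
  "sideal J \<longleftrightarrow> 0 \<in> J \<and> (\<forall>a\<in>J. \<forall>b\<in>J. a + b \<in> J) \<and> (\<forall>a. \<forall>b\<in>J. a * b \<in> J)"

lemma sidealD:
  assumes "sideal J"
  shows "0 \<in> J" "a \<in> J \<Longrightarrow> b \<in> J \<Longrightarrow> a + b \<in> J" "b \<in> J \<Longrightarrow> a * b \<in> J"
    "b \<in> J \<Longrightarrow> - b \<in> J" "a \<in> J \<Longrightarrow> b \<in> J \<Longrightarrow> a - b \<in> J"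
proof -
  show 1: "0 \<in> J" "a \<in> J \<Longrightarrow> b \<in> J \<Longrightarrow> a + b \<in> J" "b \<in> J \<Longrightarrow> a * b \<in> J" for a b
    using assms unfolding sideal_def by blast+
  show 2: "b \<in> J \<Longrightarrow> - b \<in> J" for b using 1(3)[of b "- 1"] by simp
  show "a \<in> J \<Longrightarrow> b \<in> J \<Longrightarrow> a - b \<in> J" using 1(2)[of a "- b"] 2[of b] by simp
qed

lemma sideal_sum: "sideal J \<Longrightarrow> (\<And>i. i \<in> A \<Longrightarrow> f i \<in> J) \<Longrightarrow> sum f A \<in> J"
  by (induction A rule: infinite_finite_induct) (auto intro: sidealD)

text \<open>Elements of quotient rings are cosets. The map \<open>\<pi>\<close> presents such a ring
  by representatives in a type, with kernel \<open>N\<close>, so that ideals, primes and submodules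
  can be handled as sets of representatives.\<close>

locale surj_hom = cring C for C :: "'c ring" (structure) +
  fixes \<pi> :: "'s::comm_ring_1 \<Rightarrow> 'c" and N :: "'s set"
  assumes carrier_eq: "carrier C = range \<pi>"
    and \<pi>_add: "\<pi> (a + b) = \<pi> a \<oplus> \<pi> b" and \<pi>_mult: "\<pi> (a * b) = \<pi> a \<otimes> \<pi> b"
    and \<pi>_one: "\<pi> 1 = \<one>" and \<pi>_eq: "\<pi> a = \<pi> b \<longleftrightarrow> a - b \<in> N"
begin

lemma \<pi>_carrier: "\<pi> a \<in> carrier C"
  unfolding carrier_eq by blast

lemma \<pi>_zero: "\<pi> 0 = \<zero>"
proof -
  have "\<pi> 0 \<oplus> \<pi> 0 = \<pi> 0" using \<pi>_add[of 0 0] by simp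
  then show ?thesis using \<pi>_carrier add.l_cancel_one' by metis
qed

lemma \<pi>_minus: "\<pi> (- a) = \<ominus> \<pi> a"
proof -
  have "\<pi> (- a) \<oplus> \<pi> a = \<zero>" using \<pi>_add[of "- a" a] \<pi>_zero by simp
  then show ?thesis using \<pi>_carrier minus_equality by metis
qed

lemma \<pi>_power: "\<pi> (a ^ n) = \<pi> a [^] n"
  by (induction n) (simp_all add: \<pi>_one \<pi>_mult nat_pow_Suc m_comm \<pi>_carrier)

lemma \<pi>_eq_zero: "\<pi> a = \<zero> \<longleftrightarrow> a \<in> N"
  using \<pi>_eq[of a 0] \<pi>_zero by simp

lemma sideal_pull: "ideal I C \<Longrightarrow> sideal {s. \<pi> s \<in> I}"
  unfolding sideal_def
  using additive_subgroup.zero_closed[OF ideal.axioms(1), of I C] additive_subgroup.a_closed[OF ideal.axioms(1), of I C]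
    ideal.I_l_closed[of I C]
  by (simp add: \<pi>_zero \<pi>_add \<pi>_mult \<pi>_carrier)

lemma N_pull: "ideal I C \<Longrightarrow> N \<subseteq> {s. \<pi> s \<in> I}"
proof (intro subsetI CollectI)
  fix s assume "ideal I C" "s \<in> N"
  then show "\<pi> s \<in> I"
    using \<pi>_eq_zero[of s] additive_subgroup.zero_closed[OF ideal.axioms(1), of I C] by simp
qed

lemma ideal_eq_image: "ideal I C \<Longrightarrow> I = \<pi> ` {s. \<pi> s \<in> I}"
  using ideal.Icarr[of I C] carrier_eq by fastforce

lemma ideal_image:
  assumes "sideal J"
  shows "ideal (\<pi> ` J) C"
proof (rule idealI)
  show "ring C" by (rule ring_axioms)
  show "subgroup (\<pi> ` J) (add_monoid C)"
  proof (rule add.subgroupI)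
    show "\<pi> ` J \<subseteq> carrier C" using \<pi>_carrier by blast
    show "\<pi> ` J \<noteq> {}" using sidealD(1)[OF assms] by blast
    show "\<ominus> a \<in> \<pi> ` J" if "a \<in> \<pi> ` J" for a
      using that sidealD(4)[OF assms] by (auto simp flip: \<pi>_minus)
    show "a \<oplus> b \<in> \<pi> ` J" if "a \<in> \<pi> ` J" "b \<in> \<pi> ` J" for a b
      using that sidealD(2)[OF assms] by (auto simp flip: \<pi>_add)
  qed
  fix a x assume "a \<in> \<pi> ` J" "x \<in> carrier C"
  then obtain s t where st: "a = \<pi> s" "s \<in> J" "x = \<pi> t" unfolding carrier_eq by blast
  have "t * s \<in> J" using sidealD(3)[OF assms st(2)] .
  then show "x \<otimes> a \<in> \<pi> ` J" "a \<otimes> x \<in> \<pi> ` J"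
    unfolding st using \<pi>_mult[of t s] \<pi>_mult[of s t] mult.commute[of s t] by (metis imageI)+
qed

lemma mem_image: "sideal J \<Longrightarrow> N \<subseteq> J \<Longrightarrow> \<pi> s \<in> \<pi> ` J \<longleftrightarrow> s \<in> J"
proof
  assume J: "sideal J" "N \<subseteq> J" and "\<pi> s \<in> \<pi> ` J"
  then obtain t where t: "t \<in> J" "s - t \<in> J" using \<pi>_eq by blast
  then have "(s - t) + t \<in> J" using sidealD(2)[OF J(1)] by blast
  then show "s \<in> J" by simp
qed blast

lemma surj_hom_Quot:
  assumes "ideal I C"
  shows "surj_hom (C Quot I) (\<lambda>s. I +> \<pi> s) {s. \<pi> s \<in> I}"
proof -
  interpret I: ideal I C by fact
  interpret Q: cring "C Quot I" using I.quotient_is_cring[OF cring_axioms] .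
  show ?thesis
  proof unfold_locales
    show "carrier (C Quot I) = range (\<lambda>s. I +> \<pi> s)"
      unfolding FactRing_def A_RCOSETS_def' carrier_eq by auto
    fix a b
    show "I +> \<pi> (a + b) = (I +> \<pi> a) \<oplus>\<^bsub>C Quot I\<^esub> (I +> \<pi> b)"
      using I.rcos_ring_hom by (simp add: ring_hom_add \<pi>_add \<pi>_carrier)
    show "I +> \<pi> (a * b) = (I +> \<pi> a) \<otimes>\<^bsub>C Quot I\<^esub> (I +> \<pi> b)"
      using I.rcos_ring_hom by (simp add: ring_hom_mult \<pi>_mult \<pi>_carrier)
    show "I +> \<pi> 1 = \<one>\<^bsub>C Quot I\<^esub>" using I.rcos_ring_hom by (simp add: ring_hom_one \<pi>_one)
    have "\<pi> a \<ominus> \<pi> b = \<pi> (a - b)" using \<pi>_add[of a "- b"] \<pi>_minus[of b] by (simp add: a_minus_def)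
    then show "I +> \<pi> a = I +> \<pi> b \<longleftrightarrow> a - b \<in> {s. \<pi> s \<in> I}"
      using quotient_eq_iff_same_a_r_cos[OF assms \<pi>_carrier \<pi>_carrier, of a b] by auto
  qed
qed

text \<open>The correspondence theorem; a submodule \<open>H\<close> is recovered from its set
  \<open>K\<close> of representatives.\<close>

lemma submodule_iff:
  assumes I: "ideal I C" and J: "sideal J" "{s. \<pi> s \<in> I} \<subseteq> J"
  defines "\<kappa> \<equiv> \<lambda>s. I +> \<pi> s"
  shows "submodule H C (quot_module C I\<lparr>carrier := \<kappa> ` J\<rparr>) \<longleftrightarrow>
    (\<exists>K. sideal K \<and> {s. \<pi> s \<in> I} \<subseteq> K \<and> K \<subseteq> J \<and> H = \<kappa> ` K)"
proof -
  interpret Q: surj_hom "C Quot I" \<kappa> "{s. \<pi> s \<in> I}"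
    unfolding \<kappa>_def by (rule surj_hom_Quot[OF I])
  let ?M = "quot_module C I\<lparr>carrier := \<kappa> ` J\<rparr>"
  have add: "\<kappa> a \<oplus>\<^bsub>?M\<^esub> \<kappa> b = \<kappa> (a + b)" for a b unfolding quot_module_def by (simp add: Q.\<pi>_add)
  have zero: "\<zero>\<^bsub>?M\<^esub> = \<kappa> 0" unfolding quot_module_def by (simp add: Q.\<pi>_zero)
  have smult: "\<pi> a \<odot>\<^bsub>?M\<^esub> \<kappa> b = \<kappa> (a * b)" for a b
    unfolding quot_module_def by (simp add: Q.\<pi>_mult) (simp add: \<kappa>_def)
  show ?thesis
  proof
    assume "submodule H C ?M"
    then interpret H: submodule H C ?M .
    define K where "K = {s. \<kappa> s \<in> H}"
    have HJ: "H \<subseteq> \<kappa> ` J" using H.subset by simp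
    have "sideal K"
      unfolding sideal_def
    proof (intro conjI ballI allI)
      show "0 \<in> K" using H.one_closed zero unfolding K_def by simp
      show "a + b \<in> K" if "a \<in> K" "b \<in> K" for a b
        using H.m_closed[of "\<kappa> a" "\<kappa> b"] that add[of a b] unfolding K_def by simp
      show "a * b \<in> K" if "b \<in> K" for a b
        using H.smult_closed[of "\<pi> a" "\<kappa> b"] \<pi>_carrier[of a] that smult[of a b] unfolding K_def by simp
    qed
    moreover have "K \<subseteq> J" using HJ Q.mem_image[OF J] unfolding K_def by blast
    moreover have "H = \<kappa> ` K" using HJ unfolding K_def by blast
    moreover have "{s. \<pi> s \<in> I} \<subseteq> K"
    proof
      fix s assume "s \<in> {s. \<pi> s \<in> I}"
      then have "\<kappa> s = \<kappa> 0" using Q.\<pi>_eq[of s 0] by simp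
      then show "s \<in> K" using H.one_closed zero unfolding K_def by simp
    qed
    ultimately show "\<exists>K. sideal K \<and> {s. \<pi> s \<in> I} \<subseteq> K \<and> K \<subseteq> J \<and> H = \<kappa> ` K" by blast
  next
    assume "\<exists>K. sideal K \<and> {s. \<pi> s \<in> I} \<subseteq> K \<and> K \<subseteq> J \<and> H = \<kappa> ` K"
    then obtain K where K: "sideal K" "{s. \<pi> s \<in> I} \<subseteq> K" "K \<subseteq> J" "H = \<kappa> ` K" by blast
    show "submodule H C ?M"
    proof (intro submodule.intro subgroup.intro submodule_axioms.intro)
      show "H \<subseteq> carrier (add_monoid ?M)" using K by auto
      show "x \<otimes>\<^bsub>add_monoid ?M\<^esub> y \<in> H" if "x \<in> H" "y \<in> H" for x y
        using that add sidealD(2)[OF K(1)] unfolding K(4) by auto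
      show "\<one>\<^bsub>add_monoid ?M\<^esub> \<in> H" using zero sidealD(1)[OF K(1)] unfolding K(4) by simp
      show "a \<odot>\<^bsub>?M\<^esub> x \<in> H" if "a \<in> carrier C" "x \<in> H" for a x
        using that smult sidealD(3)[OF K(1)] unfolding K(4) carrier_eq by blast
      fix x assume "x \<in> H"
      then obtain s where s: "x = \<kappa> s" "s \<in> K" unfolding K(4) by blast
      have "inv\<^bsub>add_monoid ?M\<^esub> x = \<kappa> (- s)"
        \<comment> \<open>The record with changed carrier has not been shown to be a group, so the
          inverse is computed from its definition.\<close>
        unfolding m_inv_def
      proof (rule the_equality)
        have sJ: "- s \<in> J" using s sidealD(4)[OF K(1)] K(3) by blast
        show "\<kappa> (- s) \<in> carrier (add_monoid ?M) \<and> x \<otimes>\<^bsub>add_monoid ?M\<^esub> \<kappa> (- s) = \<one>\<^bsub>add_monoid ?M\<^esub>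
            \<and> \<kappa> (- s) \<otimes>\<^bsub>add_monoid ?M\<^esub> x = \<one>\<^bsub>add_monoid ?M\<^esub>"
          using sJ add[of s "- s"] add[of "- s" s] zero unfolding s(1) by simp
        fix y assume y: "y \<in> carrier (add_monoid ?M) \<and> x \<otimes>\<^bsub>add_monoid ?M\<^esub> y = \<one>\<^bsub>add_monoid ?M\<^esub>
            \<and> y \<otimes>\<^bsub>add_monoid ?M\<^esub> x = \<one>\<^bsub>add_monoid ?M\<^esub>"
        then obtain t where t: "y = \<kappa> t" by auto
        have "\<kappa> (s + t) = \<kappa> 0" using y add[of s t] zero unfolding s(1) t by simp
        then show "y = \<kappa> (- s)" unfolding t Q.\<pi>_eq by (simp add: add.commute)
      qed
      then show "inv\<^bsub>add_monoid ?M\<^esub> x \<in> H" using s sidealD(4)[OF K(1)] unfolding K(4) by blast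
    qed
  qed
qed

lemma module_length_eq:
  assumes I: "ideal I C" and J: "sideal J" "{s. \<pi> s \<in> I} \<subseteq> J"
    and upper: "\<And>n K. (\<And>i. i \<le> n \<Longrightarrow> sideal (K i) \<and> {s. \<pi> s \<in> I} \<subseteq> K i \<and> K i \<subseteq> J) \<Longrightarrow>
      (\<And>i. i < n \<Longrightarrow> K i \<subset> K (Suc i)) \<Longrightarrow> n \<le> l"
    and lower: "\<exists>K. (\<forall>i\<le>l. sideal (K i) \<and> {s. \<pi> s \<in> I} \<subseteq> K i \<and> K i \<subseteq> J) \<and> (\<forall>i<l. K i \<subset> K (Suc i))"
  shows "module_length C (quot_module C I\<lparr>carrier := (\<lambda>s. I +> \<pi> s) ` J\<rparr>) = enat l"
proof -
  define \<kappa> where "\<kappa> = (\<lambda>s. I +> \<pi> s)"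
  interpret Q: surj_hom "C Quot I" \<kappa> "{s. \<pi> s \<in> I}"
    unfolding \<kappa>_def by (rule surj_hom_Quot[OF I])
  let ?M = "quot_module C I\<lparr>carrier := \<kappa> ` J\<rparr>"
  let ?S = "{enat n |n H. (\<forall>i\<le>n. submodule (H i) C ?M) \<and> (\<forall>i<n. H i \<subset> H (Suc i))}"
  note iff = submodule_iff[OF I J, folded \<kappa>_def]
  have image_less: "\<kappa> ` K \<subset> \<kappa> ` L \<longleftrightarrow> K \<subset> L"
    if K: "sideal K" "{s. \<pi> s \<in> I} \<subseteq> K" and L: "sideal L" "{s. \<pi> s \<in> I} \<subseteq> L" for K L
  proof -
    have sub: "\<kappa> ` K \<subseteq> \<kappa> ` L \<longleftrightarrow> K \<subseteq> L" if "sideal K" "{s. \<pi> s \<in> I} \<subseteq> K" "sideal L" "{s. \<pi> s \<in> I} \<subseteq> L" for K L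
    proof
      assume KL: "\<kappa> ` K \<subseteq> \<kappa> ` L"
      show "K \<subseteq> L"
      proof
        fix s assume "s \<in> K"
        then have "\<kappa> s \<in> \<kappa> ` L" using KL by blast
        then show "s \<in> L" unfolding Q.mem_image[OF that(3,4)] .
      qed
    qed (rule image_mono)
    show ?thesis unfolding less_le_not_le sub[OF K L] sub[OF L K] ..
  qed
  have "Sup ?S \<le> enat l"
  proof (rule Sup_least)
    fix z assume "z \<in> ?S"
    then obtain n H where z: "z = enat n" and H: "\<And>i. i \<le> n \<Longrightarrow> submodule (H i) C ?M"
      "\<And>i. i < n \<Longrightarrow> H i \<subset> H (Suc i)" by auto
    have "\<forall>i. \<exists>K. i \<le> n \<longrightarrow> sideal K \<and> {s. \<pi> s \<in> I} \<subseteq> K \<and> K \<subseteq> J \<and> H i = \<kappa> ` K"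
    proof
      fix i
      show "\<exists>K. i \<le> n \<longrightarrow> sideal K \<and> {s. \<pi> s \<in> I} \<subseteq> K \<and> K \<subseteq> J \<and> H i = \<kappa> ` K"
      proof (cases "i \<le> n")
        case True
        then show ?thesis using H(1)[OF True, unfolded iff] by metis
      qed simp
    qed
    then obtain K where K: "\<And>i. i \<le> n \<Longrightarrow> sideal (K i) \<and> {s. \<pi> s \<in> I} \<subseteq> K i \<and> K i \<subseteq> J \<and> H i = \<kappa> ` K i"
      by metis
    have "n \<le> l"
    proof (rule upper)
      show "sideal (K i) \<and> {s. \<pi> s \<in> I} \<subseteq> K i \<and> K i \<subseteq> J" if "i \<le> n" for i using K[OF that] by blast
      show "K i \<subset> K (Suc i)" if "i < n" for i
        using H(2)[OF that] K[of i] K[of "Suc i"] that image_less[of "K i" "K (Suc i)"] by simp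
    qed
    then show "z \<le> enat l" unfolding z by simp
  qed
  moreover have "enat l \<le> Sup ?S"
  proof (rule Sup_upper)
    obtain K where K: "\<And>i. i \<le> l \<Longrightarrow> sideal (K i) \<and> {s. \<pi> s \<in> I} \<subseteq> K i \<and> K i \<subseteq> J"
      "\<And>i. i < l \<Longrightarrow> K i \<subset> K (Suc i)" using lower by blast
    have "submodule (\<kappa> ` K i) C ?M" if "i \<le> l" for i unfolding iff using K(1)[OF that] by blast
    moreover have "\<kappa> ` K i \<subset> \<kappa> ` K (Suc i)" if "i < l" for i
      using image_less[of "K i" "K (Suc i)"] K(1)[of i] K(1)[of "Suc i"] K(2)[OF that] that by simp
    ultimately show "enat l \<in> ?S" by (intro CollectI exI[of _ l] exI[of _ "\<lambda>i. \<kappa> ` K i"]) simp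
  qed
  ultimately show ?thesis unfolding module_length_def \<kappa>_def[symmetric] by (rule antisym)
qed

end

lemma surj_hom_type: "surj_hom (ring_of_type_algebra :: 's::comm_ring_1 ring) (\<lambda>s. s) {0}"
proof -
  interpret cring "ring_of_type_algebra :: 's ring" by (rule cring_from_type_algebra)
  show ?thesis by unfold_locales (simp_all add: ring_of_type_algebra_def)
qed

definition cproj :: "'k::field poly3 \<Rightarrow> 'k poly3 \<Rightarrow> 'k poly3 set" where
  "cproj F s = PIdl\<^bsub>ring_of_type_algebra\<^esub> F +>\<^bsub>ring_of_type_algebra\<^esub> s"

lemma surj_hom_coord_ring: "surj_hom (coord_ring F) (cproj F) {s. F dvd s}"
proof -
  interpret A: surj_hom "ring_of_type_algebra :: 'a poly3 ring" "\<lambda>s. s" "{0}" by (rule surj_hom_type)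
  have "ideal (PIdl\<^bsub>ring_of_type_algebra\<^esub> F) (ring_of_type_algebra :: 'a poly3 ring)"
    by (rule A.cgenideal_ideal) (simp add: ring_of_type_algebra_def)
  note Q = A.surj_hom_Quot[OF this]
  have "PIdl\<^bsub>ring_of_type_algebra\<^esub> F = {s. F dvd s}"
    unfolding cgenideal_def ring_of_type_algebra_def by (auto simp: mult.commute)
  then have "{s. s \<in> PIdl\<^bsub>ring_of_type_algebra\<^esub> F} = {s. F dvd s}" by simp
  then show ?thesis using Q unfolding coord_ring_def cproj_def[abs_def] by simp
qed

section \<open>Local cohomology and lengths in terms of forms\<close>

text \<open>Represents the \<open>t\<close>-th power of the irrelevant ideal, as
  \<open>irrelevant_power\<close> shows.\<close>

definition zpart :: "nat \<Rightarrow> 'k::comm_ring_1 poly3 set" where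
  "zpart t = {r. \<forall>m\<in>Poly_Mapping.keys r. t \<le> mdeg m}"

lemma sideal_zpart: "sideal (zpart t)"
  unfolding sideal_def
proof (intro conjI ballI allI)
  fix a b :: "'a poly3"
  show "0 \<in> zpart t" unfolding zpart_def by simp
  show "a + b \<in> zpart t" if "a \<in> zpart t" "b \<in> zpart t"
    using that keys_add[of a b] unfolding zpart_def by blast
  show "a * b \<in> zpart t" if "b \<in> zpart t"
    using that keys_mult[of a b] unfolding zpart_def by (fastforce simp: mdeg_add)
qed

lemma zpart_mult: "a \<in> zpart s \<Longrightarrow> b \<in> zpart t \<Longrightarrow> a * b \<in> zpart (s + t)"
  using keys_mult[of a b] unfolding zpart_def by (fastforce simp: mdeg_add intro: add_mono)

lemma zpart_0: "zpart 0 = UNIV" unfolding zpart_def by simp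

lemma zpart_mon: "t \<le> mdeg m \<Longrightarrow> mon m c \<in> zpart t" unfolding zpart_def by simp

lemma homogeneous_zpart: "homogeneous d f \<Longrightarrow> t \<le> d \<Longrightarrow> f \<in> zpart t"
  unfolding zpart_def homogeneous_iff by simp

lemma zpart_comp: "r \<in> zpart t \<Longrightarrow> e < int t \<Longrightarrow> comp e r = 0"
  unfolding zpart_def by (intro poly_mapping_eqI) (force simp: lookup_comp simp flip: not_in_keys_iff_lookup_eq_zero)

lemma zpart_sum: "r \<in> zpart t \<Longrightarrow> maxdeg r \<le> n \<Longrightarrow> r = (\<Sum>d\<in>{t..n}. comp (int d) r)"
proof -
  assume r: "r \<in> zpart t" and n: "maxdeg r \<le> n"
  have "r = (\<Sum>d\<le>n. comp (int d) r)" using sum_comp[OF n] by simp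
  also have "\<dots> = (\<Sum>d\<in>{t..n}. comp (int d) r)"
    by (rule sum.mono_neutral_right) (use zpart_comp[OF r] in auto)
  finally show ?thesis .
qed

definition graded :: "'k::comm_ring_1 poly3 set \<Rightarrow> bool" where
  "graded J \<longleftrightarrow> sideal J \<and> (\<forall>s\<in>J. \<forall>e. comp e s \<in> J)"

lemma gradedD: "graded J \<Longrightarrow> sideal J" "graded J \<Longrightarrow> s \<in> J \<Longrightarrow> comp e s \<in> J"
  unfolding graded_def by blast+

lemma comp_0_cst: "comp 0 a = cst (Poly_Mapping.lookup a 0)"
  by (rule poly_mapping_eqI) (auto simp: lookup_comp lookup_single when_def mdeg_eq_0)

lemma hpart_zpart: "f \<in> hpart d \<Longrightarrow> int t \<le> d \<Longrightarrow> f \<in> zpart t"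
  unfolding hpart_def using homogeneous_zpart[of "nat d" f t] by (auto split: if_splits)

lemma minus_comp_0_zpart: "a - comp 0 a \<in> zpart 1"
proof -
  have "Poly_Mapping.lookup (a - comp 0 a) m = 0" if "mdeg m = 0" for m
    using that by (simp add: lookup_minus lookup_comp)
  then show ?thesis unfolding zpart_def by (fastforce simp: in_keys_iff intro: Suc_leI)
qed

text \<open>A finite-dimensional window: lengths of quotients that vanish from degree
  \<open>n\<close> on are read off as dimensions inside it.\<close>

definition upart :: "nat \<Rightarrow> 'k::comm_ring_1 poly3 set" where
  "upart n = {s. \<forall>m\<in>Poly_Mapping.keys s. mdeg m < n}"

lemma subspace_upart: "poly3.subspace (upart n :: 'k::field poly3 set)"
proof (rule poly3.subspaceI)
  fix a b :: "'k poly3" and c :: 'k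
  show "0 \<in> (upart n :: 'k poly3 set)" unfolding upart_def by simp
  show "a + b \<in> upart n" if "a \<in> upart n" "b \<in> upart n"
    using that keys_add[of a b] unfolding upart_def by blast
  show "cst c * a \<in> upart n" if "a \<in> upart n"
    using that keys_mult[of "cst c" a] unfolding upart_def
    by (auto simp: subset_iff split: if_splits)
qed

lemma fin_dim_upart: "poly3.fin_dim (upart n :: 'k::field poly3 set)"
proof -
  have "(upart n :: 'k poly3 set) \<subseteq> poly3.span ((\<lambda>m. mon m 1) ` {m. mdeg m \<le> n})"
    unfolding upart_def by (intro subsetI span_mon) auto
  then show ?thesis unfolding poly3.fin_dim_def using finite_mdeg by blast
qed

lemma comp_upart: "s \<in> upart n \<Longrightarrow> int n \<le> e \<Longrightarrow> comp e s = 0"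
  unfolding upart_def by (intro poly_mapping_eqI) (force simp: lookup_comp simp flip: not_in_keys_iff_lookup_eq_zero)

lemma hpart_upart: "f \<in> hpart d \<Longrightarrow> d < int n \<Longrightarrow> f \<in> upart n"
  unfolding hpart_def upart_def by (auto simp: homogeneous_iff split: if_splits)

lemma low_upart: "(\<Sum>d<n. comp (int d) s) \<in> (upart n :: 'k::field poly3 set)"
proof (rule poly3.subspace_sum[OF subspace_upart])
  fix d assume "d \<in> {..<n}"
  then show "comp (int d) s \<in> upart n" using hpart_upart[OF comp_hpart, of "int d" n s] by simp
qed

lemma minus_low_zpart: "s - (\<Sum>d<n. comp (int d) s) \<in> zpart n"
proof -
  have "Poly_Mapping.lookup (s - (\<Sum>d<n. comp (int d) s)) m = 0" if "mdeg m < n" for m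
    using that by (simp add: lookup_minus lookup_sum lookup_comp)
  then show ?thesis unfolding zpart_def by (fastforce simp: in_keys_iff not_less)
qed

lemma sideal_subspace: "sideal (J :: 'k::field poly3 set) \<Longrightarrow> poly3.subspace J"
  unfolding sideal_def by (auto intro!: poly3.subspaceI)

lemma dim_graded:
  assumes J: "graded (J :: 'k::field poly3 set)"
  shows "poly3.dim (J \<inter> upart n) = (\<Sum>m<n. poly3.dim (J \<inter> hpart (int m)))"
proof (induction n)
  case 0
  have "(upart 0 :: 'k poly3 set) = {0}" unfolding upart_def by (auto simp flip: keys_eq_empty)
  then have "J \<inter> upart 0 \<subseteq> poly3.span {}" by simp
  then show ?case using poly3.dim_le_card[of "J \<inter> upart 0" "{}"] by simp
next
  case (Suc n)
  note sJ = sideal_subspace[OF gradedD(1)[OF J]]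
  have eq: "J \<inter> upart (Suc n) = (J \<inter> upart n) + (J \<inter> hpart (int n))"
  proof
    show "J \<inter> upart (Suc n) \<subseteq> (J \<inter> upart n) + (J \<inter> hpart (int n))"
    proof
      fix s assume s: "s \<in> J \<inter> upart (Suc n)"
      have "s - comp (int n) s \<in> upart n"
        unfolding upart_def
      proof (intro CollectI ballI)
        fix m assume "m \<in> Poly_Mapping.keys (s - comp (int n) s)"
        then have "Poly_Mapping.lookup s m \<noteq> 0" "mdeg m \<noteq> n"
          by (auto simp: in_keys_iff lookup_minus lookup_comp split: if_splits)
        then show "mdeg m < n" using s unfolding upart_def by (auto simp: in_keys_iff less_Suc_eq)
      qed
      moreover have "comp (int n) s \<in> J" "s - comp (int n) s \<in> J"
        using s gradedD[OF J] sidealD(5) by blast+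
      ultimately have "(s - comp (int n) s) + comp (int n) s \<in> (J \<inter> upart n) + (J \<inter> hpart (int n))"
        using comp_hpart by (intro set_plus_intro) blast+
      then show "s \<in> (J \<inter> upart n) + (J \<inter> hpart (int n))" by simp
    qed
    have "upart n \<subseteq> (upart (Suc n) :: 'k poly3 set)" unfolding upart_def by (auto simp: less_Suc_eq)
    moreover have "hpart (int n) \<subseteq> (upart (Suc n) :: 'k poly3 set)" using hpart_upart by fastforce
    ultimately show "(J \<inter> upart n) + (J \<inter> hpart (int n)) \<subseteq> J \<inter> upart (Suc n)"
      by (intro poly3.plus_subspace_subset poly3.subspace_inter sJ subspace_upart Int_mono order_refl)
  qed
  have "(J \<inter> upart n) \<inter> (J \<inter> hpart (int n)) \<subseteq> poly3.span {}"
  proof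
    fix s assume s: "s \<in> (J \<inter> upart n) \<inter> (J \<inter> hpart (int n))"
    then have "comp (int n) s = 0" "comp (int n) s = s" using comp_upart[of s n "int n"] hpart_comp[of s "int n"] by auto
    then show "s \<in> poly3.span {}" by simp
  qed
  then have "poly3.dim ((J \<inter> upart n) \<inter> (J \<inter> hpart (int n))) = 0"
    using poly3.dim_le_card[of "(J \<inter> upart n) \<inter> (J \<inter> hpart (int n))" "{}"] by simp
  moreover have "poly3.dim (J \<inter> upart (Suc n)) + poly3.dim ((J \<inter> upart n) \<inter> (J \<inter> hpart (int n)))
      = poly3.dim (J \<inter> upart n) + poly3.dim (J \<inter> hpart (int n))"
    unfolding eq
    by (intro poly3.dim_plus_Int poly3.subspace_inter sJ subspace_upart subspace_hpart
        poly3.fin_dim_mono[OF fin_dim_upart Int_lower2] poly3.fin_dim_mono[OF fin_dim_hpart Int_lower2])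
  ultimately show ?case using Suc by simp
qed

text \<open>A chain of ideals is refined by adjoining an element \<open>s\<close> of maximal degree: all forms of
  positive degree then multiply \<open>s\<close> into the smaller ideal.\<close>

context
  fixes I J :: "'k::field poly3 set" and n :: nat
  assumes I: "graded I" and J: "graded J" and IJ: "I \<subseteq> J"
    and large: "\<And>m. int n \<le> m \<Longrightarrow> J \<inter> hpart m \<subseteq> I"
begin

lemma high_part: "s \<in> J \<Longrightarrow> s \<in> zpart n \<Longrightarrow> s \<in> I"
proof -
  assume s: "s \<in> J" "s \<in> zpart n"
  have "(\<Sum>d\<in>{n..maxdeg s}. comp (int d) s) \<in> I"
  proof (rule sideal_sum[OF gradedD(1)[OF I]])
    fix d assume "d \<in> {n..maxdeg s}"
    then show "comp (int d) s \<in> I"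
      using large[of "int d"] gradedD(2)[OF J s(1), of "int d"] comp_hpart[of "int d" s] by auto
  qed
  then show ?thesis using zpart_sum[OF s(2), of "maxdeg s"] by simp
qed

text \<open>The part of degree at least \<open>n\<close> of an element of \<open>J\<close> already
  lies in \<open>I\<close>. Hence an element of \<open>L\<close> outside \<open>K\<close> can be
  truncated to one inside the window.\<close>

lemma dim_chain_step:
  assumes K: "sideal K" "I \<subseteq> K" "K \<subset> L" "L \<subseteq> J" "sideal L"
  shows "poly3.dim (K \<inter> upart n) < poly3.dim (L \<inter> upart n)"
proof (rule poly3.dim_psubset_fin_dim)
  show "poly3.subspace (K \<inter> upart n)"
    using K sideal_subspace subspace_upart poly3.subspace_inter by blast
  show "poly3.fin_dim (L \<inter> upart n)" using poly3.fin_dim_mono[OF fin_dim_upart] by blast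
  obtain s where s: "s \<in> L" "s \<notin> K" using K by blast
  let ?l = "\<Sum>d<n. comp (int d) s"
  have "?l \<in> J"
    by (rule sideal_sum[OF gradedD(1)[OF J]]) (use gradedD(2)[OF J] s K in blast)
  then have "s - ?l \<in> I" using high_part minus_low_zpart s K sidealD(5)[OF gradedD(1)[OF J]] by blast
  then have "s - ?l \<in> K" "s - ?l \<in> L" using K by blast+
  moreover have "s - (s - ?l) = ?l" by simp
  ultimately have "?l \<in> L" "?l \<notin> K"
    using s sidealD(5)[OF K(5), of s "s - ?l"] sidealD(2)[OF K(1), of "s - ?l" ?l] by auto
  then show "K \<inter> upart n \<subset> L \<inter> upart n" using K(3) low_upart by blast
qed

lemma chain_upper:
  assumes "\<And>i. i \<le> l \<Longrightarrow> sideal (K i) \<and> I \<subseteq> K i \<and> K i \<subseteq> J" "\<And>i. i < l \<Longrightarrow> K i \<subset> K (Suc i)"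
  shows "l \<le> poly3.dim (J \<inter> upart n) - poly3.dim (I \<inter> upart n)"
proof -
  have "i \<le> l \<Longrightarrow> poly3.dim (I \<inter> upart n) + i \<le> poly3.dim (K i \<inter> upart n)" for i
  proof (induction i)
    case 0
    then show ?case using assms(1)[of 0] poly3.dim_mono_fin_dim poly3.fin_dim_mono[OF fin_dim_upart]
      by (metis Int_mono Int_lower2 add_0_right order_refl)
  next
    case (Suc i)
    have "poly3.dim (K i \<inter> upart n) < poly3.dim (K (Suc i) \<inter> upart n)"
      using dim_chain_step[of "K i" "K (Suc i)"] assms(1)[of i] assms(1)[of "Suc i"] assms(2)[of i] Suc.prems by simp
    then show ?case using Suc by simp
  qed
  from this[of l] have "poly3.dim (I \<inter> upart n) + l \<le> poly3.dim (K l \<inter> upart n)" by simp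
  also have "\<dots> \<le> poly3.dim (J \<inter> upart n)"
    using assms(1)[of l] poly3.dim_mono_fin_dim[of "K l \<inter> upart n" "J \<inter> upart n"]
      poly3.fin_dim_mono[OF fin_dim_upart, of "J \<inter> upart n" n] by blast
  finally show ?thesis by simp
qed

lemma adjoin:
  assumes K: "graded K" "I \<subseteq> K" "K \<subset> J"
  obtains L where "graded L" "K \<subset> L" "L \<subseteq> J" "poly3.dim (L \<inter> upart n) = Suc (poly3.dim (K \<inter> upart n))"
proof -
  note sK = gradedD(1)[OF K(1)] and sJ = gradedD(1)[OF J]
  define E where "E = {e. \<not> J \<inter> hpart (int e) \<subseteq> K}"
  have "E \<subseteq> {..<n}"
  proof
    fix e assume "e \<in> E"
    then have "\<not> J \<inter> hpart (int e) \<subseteq> I" using K unfolding E_def by blast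
    then show "e \<in> {..<n}" using large[of "int e"] by (cases "e < n") auto
  qed
  then have fin: "finite E" using finite_subset by blast
  have "E \<noteq> {}"
  proof
    assume "E = {}"
    have "s \<in> K" if "s \<in> J" for s
    proof -
      have "(\<Sum>d\<le>maxdeg s. comp (int d) s) \<in> K"
      proof (rule sideal_sum[OF sK])
        fix d
        have "J \<inter> hpart (int d) \<subseteq> K" using \<open>E = {}\<close> unfolding E_def by blast
        then show "comp (int d) s \<in> K" using gradedD(2)[OF J that] comp_hpart[of "int d" s] by blast
      qed
      then show ?thesis using sum_comp[OF order_refl, of s] by simp
    qed
    then show False using K by blast
  qed
  define e where "e = Max E"
  have e: "e \<in> E" unfolding e_def using fin \<open>E \<noteq> {}\<close> by simp
  then obtain s where s: "s \<in> J" "s \<in> hpart (int e)" "s \<notin> K" unfolding E_def by blast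
  have "e < n" using e \<open>E \<subseteq> {..<n}\<close> by blast
  have socle: "r * s \<in> K" if r: "r \<in> zpart 1" for r
  proof -
    have "comp (int j) r * s \<in> K" if "1 \<le> j" for j
    proof -
      have "j + e \<notin> E" using Max_ge[OF fin, of "j + e"] that unfolding e_def by auto
      moreover have "comp (int j) r * s \<in> hpart (int (j + e))"
        using hpart_mult[OF comp_hpart s(2)] by simp
      ultimately show ?thesis using sidealD(3)[OF sJ s(1)] unfolding E_def by blast
    qed
    then have "(\<Sum>j\<in>{1..maxdeg r}. comp (int j) r * s) \<in> K" by (intro sideal_sum[OF sK]) simp
    then show ?thesis using zpart_sum[OF r order_refl] by (metis sum_distrib_right)
  qed
  define S where "S = poly3.span {s}"
  have S_eq: "S = range (\<lambda>c. cst c * s)" unfolding S_def by (rule poly3.span_singleton)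
  define L where "L = K + S"
  have L_cases: "\<exists>k c. u = k + cst c * s \<and> k \<in> K" if "u \<in> L" for u
  proof -
    obtain k v where "u = k + v" "k \<in> K" "v \<in> S" using \<open>u \<in> L\<close> unfolding L_def by (rule set_plus_elim)
    then show ?thesis unfolding S_eq by blast
  qed
  have SJ: "S \<subseteq> J" unfolding S_eq using sidealD(3)[OF sJ s(1)] by blast
  have KL: "K \<subseteq> L" unfolding L_def
    using poly3.subset_plus_left[of S K] poly3.span_zero[of "{s}"] unfolding S_def by blast
  have SL: "S \<subseteq> L" unfolding L_def using poly3.subset_plus_right[OF sidealD(1)[OF sK]] by blast
  have sS: "s \<in> S" unfolding S_def by (rule poly3.span_base) simp
  have "graded L"
    unfolding graded_def sideal_def
  proof (intro conjI ballI allI)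
    show "0 \<in> L" using KL sidealD(1)[OF sK] by blast
    fix u assume "u \<in> L"
    then obtain k c where u: "u = k + cst c * s" "k \<in> K"
      using L_cases by blast
    have combine: "k' + cst c' * s \<in> L" if "k' \<in> K" for k' c'
      unfolding L_def S_eq using that by (intro set_plus_intro) auto
    show "u + v \<in> L" if "v \<in> L" for v
    proof -
      obtain k' c' where v: "v = k' + cst c' * s" "k' \<in> K"
        using L_cases[OF \<open>v \<in> L\<close>] by blast
      have "u + v = (k + k') + cst (c + c') * s" unfolding u v by (simp add: single_add algebra_simps)
      then show ?thesis using combine sidealD(2)[OF sK u(2) v(2)] by metis
    qed
    show "a * u \<in> L" for a
    proof -
      \<comment> \<open>Modulo \<open>K\<close> only the constant term of \<open>a\<close> acts on
        \<open>s\<close>, so adjoining \<open>s\<close> adds a single dimension.\<close>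
      have "cst c * ((a - comp 0 a) * s) \<in> K" using socle[OF minus_comp_0_zpart] sidealD(3)[OF sK] by blast
      then have "a * k + cst c * ((a - comp 0 a) * s) \<in> K" using sidealD(2)[OF sK] sidealD(3)[OF sK u(2)] by blast
      moreover have "a * u = a * k + cst c * ((a - comp 0 a) * s) + cst (c * Poly_Mapping.lookup a 0) * s"
        unfolding u comp_0_cst by (simp add: algebra_simps mult_single flip: mult.assoc)
      ultimately show ?thesis using combine by metis
    qed
    show "comp i u \<in> L" for i
    proof -
      have cs: "cst c * s \<in> hpart (int e)" using hpart_mult[of "cst c" 0 s "int e"] s(2) homogeneous_cst[of c]
        by (simp add: hpart_def)
      show ?thesis
        using gradedD(2)[OF K(1) u(2), of i] hpart_comp[OF cs, of i] combine[of "comp i k" c] combine[of "comp i k" 0]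
        unfolding u comp_add by (auto split: if_splits)
    qed
  qed
  moreover have "K \<subset> L" using KL SL sS s(3) by blast
  moreover have "L \<subseteq> J" unfolding L_def
    by (rule poly3.plus_subspace_subset[OF sideal_subspace[OF sJ]]) (use K SJ in blast)+
  moreover have "poly3.dim (L \<inter> upart n) = Suc (poly3.dim (K \<inter> upart n))"
  proof -
    have su: "s \<in> upart n" using hpart_upart[OF s(2)] \<open>e < n\<close> by simp
    then have Su: "S \<subseteq> upart n" unfolding S_def using poly3.span_minimal[OF _ subspace_upart, of "{s}" n] by blast
    have eq: "L \<inter> upart n = (K \<inter> upart n) + S"
    proof
      show "L \<inter> upart n \<subseteq> (K \<inter> upart n) + S"
      proof
        fix u assume u: "u \<in> L \<inter> upart n"
        then obtain k v where kv: "u = k + v" "k \<in> K" "v \<in> S" unfolding L_def by (auto elim: set_plus_elim)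
        have "k = u - v" using kv by simp
        then have "k \<in> upart n" using u kv Su poly3.subspace_diff[OF subspace_upart] by blast
        then show "u \<in> (K \<inter> upart n) + S" unfolding kv(1) using kv by (intro set_plus_intro) blast+
      qed
      show "(K \<inter> upart n) + S \<subseteq> L \<inter> upart n"
      proof (rule Int_greatest)
        show "(K \<inter> upart n) + S \<subseteq> L" unfolding L_def by (rule set_plus_mono2) auto
        show "(K \<inter> upart n) + S \<subseteq> upart n" by (rule poly3.plus_subspace_subset[OF subspace_upart _ Su]) simp
      qed
    qed
    have "S \<inter> K \<subseteq> {0}"
    proof
      fix u assume "u \<in> S \<inter> K"
      then obtain c where c: "u = cst c * s" "cst c * s \<in> K" unfolding S_eq by blast
      have "cst (inverse c) * (cst c * s) \<in> K" using sidealD(3)[OF sK c(2)] .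
      then have "c = 0" using s(3) by (cases "c = 0") (simp_all add: mult_single flip: mult.assoc)
      then show "u \<in> {0}" using c by simp
    qed
    then have "poly3.dim ((K \<inter> upart n) \<inter> S) = 0"
      using poly3.dim_le_card[of "(K \<inter> upart n) \<inter> S" "{}"] by auto
    moreover have "poly3.dim ((K \<inter> upart n) + S) + poly3.dim ((K \<inter> upart n) \<inter> S) = poly3.dim (K \<inter> upart n) + poly3.dim S"
      by (rule poly3.dim_plus_Int[OF poly3.subspace_inter[OF sideal_subspace[OF sK] subspace_upart] _
            poly3.fin_dim_mono[OF fin_dim_upart Int_lower2] poly3.fin_dim_mono[OF fin_dim_upart Su]])
        (simp add: S_def)
    moreover have "poly3.dim S = 1"
    proof -
      have "s \<noteq> 0" using s(3) sidealD(1)[OF sK] by blast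
      then have "\<not> poly3.dependent {s}" by simp
      then show ?thesis unfolding S_def using poly3.dim_span_eq_card_independent[of "{s}"] by simp
    qed
    ultimately show ?thesis unfolding eq by simp
  qed
  ultimately show ?thesis using that by blast
qed

lemma chain_lower:
  assumes "graded K" "I \<subseteq> K" "K \<subseteq> J" "poly3.dim (J \<inter> upart n) = poly3.dim (K \<inter> upart n) + l"
  shows "\<exists>c. c 0 = K \<and> (\<forall>i\<le>l. sideal (c i) \<and> I \<subseteq> c i \<and> c i \<subseteq> J) \<and> (\<forall>i<l. c i \<subset> c (Suc i))"
  using assms
proof (induction l arbitrary: K)
  case 0
  then show ?case using gradedD(1) by (intro exI[of _ "\<lambda>_. K"]) simp
next
  case (Suc l)
  have "K \<subset> J" using Suc.prems by auto
  then obtain L where L: "graded L" "K \<subset> L" "L \<subseteq> J" "poly3.dim (L \<inter> upart n) = Suc (poly3.dim (K \<inter> upart n))"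
    using adjoin[OF Suc.prems(1,2)] by blast
  have "\<exists>c. c 0 = L \<and> (\<forall>i\<le>l. sideal (c i) \<and> I \<subseteq> c i \<and> c i \<subseteq> J) \<and> (\<forall>i<l. c i \<subset> c (Suc i))"
    by (rule Suc.IH) (use L Suc.prems in auto)
  then obtain c where c: "c 0 = L" "\<And>i. i \<le> l \<Longrightarrow> sideal (c i) \<and> I \<subseteq> c i \<and> c i \<subseteq> J" "\<And>i. i < l \<Longrightarrow> c i \<subset> c (Suc i)"
    by metis
  define c' where "c' i = (case i of 0 \<Rightarrow> K | Suc j \<Rightarrow> c j)" for i
  have "sideal (c' i) \<and> I \<subseteq> c' i \<and> c' i \<subseteq> J" if "i \<le> Suc l" for i
    using that c(2) Suc.prems gradedD(1) unfolding c'_def by (auto split: nat.split)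
  moreover have "c' i \<subset> c' (Suc i)" if "i < Suc l" for i
    using that c(1,3) L(2) unfolding c'_def by (auto split: nat.split)
  moreover have "c' 0 = K" unfolding c'_def by simp
  ultimately show ?case by blast
qed

end

lemma coord_grading_eq: "coord_grading F e = cproj F ` {f. homogeneous e f}"
  unfolding coord_grading_def cproj_def by blast

section \<open>Powers of the irrelevant ideal and local cohomology\<close>

context plane_curve
begin

definition NF :: "'k poly3 set" where "NF = {s. F dvd s}"

abbreviation CR :: "'k poly3 set ring" where "CR \<equiv> coord_ring F"

sublocale C: surj_hom CR "cproj F" NF
  unfolding NF_def by (rule surj_hom_coord_ring)

lemma graded_NF: "graded NF"
  unfolding graded_def sideal_def NF_def using comp_dvd[OF F_hom] by simp

lemma Fpart_eq: "Fpart m = NF \<inter> hpart m"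
  unfolding Fpart_def NF_def by blast

lemma irrelevant_eq: "irrelevant_ideal CR (coord_grading F) = cproj F ` zpart 1"
proof
  let ?X = "\<Union>d\<in>{1..}. coord_grading F d"
  have sub: "?X \<subseteq> carrier CR" unfolding coord_grading_eq C.carrier_eq by blast
  have "?X \<subseteq> cproj F ` zpart 1"
    unfolding coord_grading_eq using homogeneous_zpart[of _ _ 1] by fastforce
  then show "irrelevant_ideal CR (coord_grading F) \<subseteq> cproj F ` zpart 1"
    unfolding irrelevant_ideal_def using C.genideal_minimal C.ideal_image[OF sideal_zpart] by blast
  have id: "ideal (Idl\<^bsub>CR\<^esub> ?X) CR" by (rule C.genideal_ideal[OF sub])
  note sJ = C.sideal_pull[OF id]
  show "cproj F ` zpart 1 \<subseteq> irrelevant_ideal CR (coord_grading F)"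
    unfolding irrelevant_ideal_def
  proof (rule image_subsetI)
    fix r :: "'k poly3" assume r: "r \<in> zpart 1"
    have "(\<Sum>d\<in>{1..maxdeg r}. comp (int d) r) \<in> {s. cproj F s \<in> Idl\<^bsub>CR\<^esub> ?X}"
    proof (rule sideal_sum[OF sJ])
      fix d assume "d \<in> {1..maxdeg r}"
      then have "cproj F (comp (int d) r) \<in> ?X"
        unfolding coord_grading_eq using homogeneous_comp[of "int d" r] by auto
      then show "comp (int d) r \<in> {s. cproj F s \<in> Idl\<^bsub>CR\<^esub> ?X}" using C.genideal_self[OF sub] by blast
    qed
    then show "cproj F r \<in> Idl\<^bsub>CR\<^esub> ?X" using zpart_sum[OF r order_refl] by simp
  qed
qed

text \<open>A monomial of degree at least \<open>t + 1\<close> is a variable times a monomial of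
  degree at least \<open>t\<close>; the other inclusion is additivity of degrees.\<close>

lemma ideal_prod_zpart: "ideal_prod CR (cproj F ` zpart t) (cproj F ` zpart 1) = cproj F ` zpart (Suc t)"
proof
  let ?I = "cproj F ` zpart t" and ?J = "cproj F ` zpart 1"
  show "ideal_prod CR ?I ?J \<subseteq> cproj F ` zpart (Suc t)"
  proof
    fix z assume "z \<in> ideal_prod CR ?I ?J"
    then show "z \<in> cproj F ` zpart (Suc t)"
    proof (induction rule: ideal_prod.induct)
      case (prod i j)
      then obtain r r' where r: "i = cproj F r" "r \<in> zpart t" "j = cproj F r'" "r' \<in> zpart 1" by blast
      have "r * r' \<in> zpart (Suc t)" using zpart_mult[OF r(2,4)] by simp
      then show ?case unfolding r(1,3) by (simp flip: C.\<pi>_mult)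
    next
      case (sum a b)
      then obtain r r' where r: "a = cproj F r" "r \<in> zpart (Suc t)" "b = cproj F r'" "r' \<in> zpart (Suc t)" by blast
      have "r + r' \<in> zpart (Suc t)" using sidealD(2)[OF sideal_zpart r(2,4)] .
      then show ?case unfolding r(1,3) by (simp flip: C.\<pi>_add)
    qed
  qed
  have id: "ideal (ideal_prod CR ?I ?J) CR"
    by (rule C.ideal_prod_is_ideal) (rule C.ideal_image[OF sideal_zpart])+
  note sJ = C.sideal_pull[OF id]
  show "cproj F ` zpart (Suc t) \<subseteq> ideal_prod CR ?I ?J"
  proof (rule image_subsetI)
    fix r :: "'k poly3" assume r: "r \<in> zpart (Suc t)"
    have "(\<Sum>m\<in>Poly_Mapping.keys r. mon m (Poly_Mapping.lookup r m)) \<in> {s. cproj F s \<in> ideal_prod CR ?I ?J}"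
    proof (rule sideal_sum[OF sJ])
      fix m assume "m \<in> Poly_Mapping.keys r"
      then have m: "Suc t \<le> mdeg m" using r unfolding zpart_def by blast
      then have "\<exists>i. Poly_Mapping.lookup m i \<noteq> 0"
        unfolding mdeg_def by (metis (mono_tags, lifting) not_less_eq_eq sum.neutral zero_le)
      then obtain i where i: "Poly_Mapping.lookup m i \<noteq> 0" by blast
      define k where "k = m - Poly_Mapping.single i 1"
      have mk: "m = k + Poly_Mapping.single i 1"
        unfolding k_def using i
        by (intro poly_mapping_eqI) (auto simp: lookup_add lookup_minus lookup_single when_def)
      have "mdeg (Poly_Mapping.single i (1::nat)) = 1"
        using homogeneous_var[of i] unfolding homogeneous_iff var_def by (metis keys_single singletonI one_neq_zero)
      then have "t \<le> mdeg k" using m unfolding mk mdeg_add by simp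
      then have "mon k (Poly_Mapping.lookup r m) \<in> zpart t" by (rule zpart_mon)
      moreover have "var i \<in> (zpart 1 :: 'k poly3 set)" using homogeneous_zpart[OF homogeneous_var, of 1 i] by simp
      ultimately have "cproj F (mon k (Poly_Mapping.lookup r m)) \<otimes>\<^bsub>CR\<^esub> cproj F (var i) \<in> ideal_prod CR ?I ?J"
        by (intro ideal_prod.prod) blast+
      moreover have "mon m (Poly_Mapping.lookup r m) = mon k (Poly_Mapping.lookup r m) * var i"
        by (subst mk) (simp add: var_def mult_single)
      ultimately show "mon m (Poly_Mapping.lookup r m) \<in> {s. cproj F s \<in> ideal_prod CR ?I ?J}"
        by (simp add: C.\<pi>_mult)
    qed
    then show "cproj F r \<in> ideal_prod CR ?I ?J" using poly3_expand[of r] by simp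
  qed
qed

lemma irrelevant_power:
  "irrelevant_ideal CR (coord_grading F) [^]\<^bsub>ideals_set CR\<^esub> (t :: nat) = cproj F ` zpart t"
proof (induction t)
  case 0
  show ?case using C.carrier_eq by (simp add: zpart_0 ideals_set_def)
next
  case (Suc t)
  have "irrelevant_ideal CR (coord_grading F) [^]\<^bsub>ideals_set CR\<^esub> (Suc t)
      = ideal_prod CR (cproj F ` zpart t) (cproj F ` zpart 1)"
    using Suc unfolding irrelevant_eq by (simp add: ideals_set_def)
  then show ?case unfolding ideal_prod_zpart .
qed

definition gsat :: "'k poly3 set \<Rightarrow> 'k poly3 set" where
  "gsat I = {s. \<exists>t. \<forall>d\<ge>t. \<forall>a\<in>hpart d. a * s \<in> I}"

text \<open>An element of \<open>zpart t\<close> is a sum of forms of degree at least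
  \<open>t\<close>, so testing against all forms of high degree amounts to testing against a power
  of the irrelevant ideal.\<close>

lemma gsat_iff:
  assumes I: "sideal I"
  shows "s \<in> gsat I \<longleftrightarrow> (\<exists>t. \<forall>r\<in>zpart t. r * s \<in> I)"
proof
  assume "s \<in> gsat I"
  then obtain t where t: "\<And>d a. t \<le> d \<Longrightarrow> a \<in> hpart d \<Longrightarrow> a * s \<in> I" unfolding gsat_def by blast
  have "r * s \<in> I" if r: "r \<in> zpart (nat t)" for r
  proof -
    have "(\<Sum>d\<in>{nat t..maxdeg r}. comp (int d) r * s) \<in> I"
      by (rule sideal_sum[OF I], rule t[OF _ comp_hpart]) (simp add: nat_le_iff)
    then show ?thesis using zpart_sum[OF r order_refl] by (metis sum_distrib_right)
  qed
  then show "\<exists>t. \<forall>r\<in>zpart t. r * s \<in> I" by blast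
next
  assume "\<exists>t. \<forall>r\<in>zpart t. r * s \<in> I"
  then obtain t where "\<And>r. r \<in> zpart t \<Longrightarrow> r * s \<in> I" by blast
  then show "s \<in> gsat I" unfolding gsat_def using hpart_zpart[of _ _ t] by blast
qed

lemma H0_eq:
  assumes I: "ideal I CR"
  shows "H0 CR (irrelevant_ideal CR (coord_grading F)) (quot_module CR I)
    = (\<lambda>s. I +>\<^bsub>CR\<^esub> cproj F s) ` gsat {s. cproj F s \<in> I}"
proof -
  define \<kappa> where "\<kappa> = (\<lambda>s. I +>\<^bsub>CR\<^esub> cproj F s)"
  interpret Q: surj_hom "CR Quot I" \<kappa> "{s. cproj F s \<in> I}"
    unfolding \<kappa>_def by (rule C.surj_hom_Quot[OF I])
  have smult: "cproj F a \<odot>\<^bsub>quot_module CR I\<^esub> \<kappa> b = \<kappa> (a * b)" for a b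
    unfolding quot_module_def by (simp add: Q.\<pi>_mult) (simp add: \<kappa>_def)
  have car: "carrier (quot_module CR I) = carrier (CR Quot I)" unfolding quot_module_def by simp
  have zero: "\<zero>\<^bsub>quot_module CR I\<^esub> = \<zero>\<^bsub>CR Quot I\<^esub>" unfolding quot_module_def by simp
  have "\<kappa> s \<in> H0 CR (irrelevant_ideal CR (coord_grading F)) (quot_module CR I) \<longleftrightarrow> s \<in> gsat {s. cproj F s \<in> I}" for s
    unfolding H0_def irrelevant_power gsat_iff[OF C.sideal_pull[OF I]] zero car
    by (simp add: smult Q.\<pi>_eq_zero Q.\<pi>_carrier)
  moreover have "H0 CR (irrelevant_ideal CR (coord_grading F)) (quot_module CR I) \<subseteq> range \<kappa>"
    unfolding H0_def car Q.carrier_eq by blast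
  ultimately show ?thesis unfolding \<kappa>_def[symmetric] by blast
qed

lemma graded_gsat:
  assumes I: "graded I"
  shows "graded (gsat I)"
  unfolding graded_def sideal_def
proof (intro conjI ballI allI)
  note sI = gradedD(1)[OF I]
  show "0 \<in> gsat I" unfolding gsat_def using sidealD(1)[OF sI] by simp
  fix u assume "u \<in> gsat I"
  then obtain s where s: "\<And>d a. s \<le> d \<Longrightarrow> a \<in> hpart d \<Longrightarrow> a * u \<in> I" unfolding gsat_def by blast
  show "u + v \<in> gsat I" if "v \<in> gsat I" for v
  proof -
    obtain t where t: "\<And>d a. t \<le> d \<Longrightarrow> a \<in> hpart d \<Longrightarrow> a * v \<in> I"
      using \<open>v \<in> gsat I\<close> unfolding gsat_def by blast
    have "a * (u + v) \<in> I" if "max s t \<le> d" "a \<in> hpart d" for a d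
      using s[of d a] t[of d a] that sidealD(2)[OF sI] by (simp add: distrib_left)
    then show ?thesis unfolding gsat_def by blast
  qed
  show "b * u \<in> gsat I" for b
  proof -
    have "a * (b * u) \<in> I" if "s \<le> d" "a \<in> hpart d" for a d
      using sidealD(3)[OF sI s[OF that], of b] by (simp add: ac_simps)
    then show ?thesis unfolding gsat_def by blast
  qed
  show "comp e u \<in> gsat I" for e
  proof -
    have "a * comp e u \<in> I" if d: "max s 0 \<le> d" "a \<in> hpart d" for a d
    proof -
      have "homogeneous (nat d) a" using d unfolding hpart_def by simp
      then have "comp (e + d) (a * u) = a * comp e u" using comp_mult[of "nat d" a e u] d by simp
      then show ?thesis using gradedD(2)[OF I s[of d a], of "e + d"] d by simp
    qed
    then show ?thesis unfolding gsat_def by blast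
  qed
qed

lemma gsat_superset: "sideal I \<Longrightarrow> I \<subseteq> gsat I"
  unfolding gsat_def using sidealD(3) by blast

text \<open>Only degrees below \<open>n\<close> contribute, and a chain of ideals can be refined
  until each step has dimension one; the length over the ring is therefore the dimension over the
  field.\<close>

lemma length_H0:
  assumes I: "ideal I CR" and I': "I' = {s. cproj F s \<in> I}" and gr: "graded I'"
    and large: "\<And>m. int n \<le> m \<Longrightarrow> gsat I' \<inter> hpart m \<subseteq> I'"
  shows "module_length CR (quot_module CR I\<lparr>carrier :=
      H0 CR (irrelevant_ideal CR (coord_grading F)) (quot_module CR I)\<rparr>)
    = enat ((\<Sum>m<n. poly3.dim (gsat I' \<inter> hpart (int m))) - (\<Sum>m<n. poly3.dim (I' \<inter> hpart (int m))))"
proof -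
  note J = graded_gsat[OF gr] and IJ = gsat_superset[OF gradedD(1)[OF gr]]
  have "poly3.dim (I' \<inter> upart n) \<le> poly3.dim (gsat I' \<inter> upart n)"
    using IJ by (intro poly3.dim_mono_fin_dim poly3.fin_dim_mono[OF fin_dim_upart Int_lower2]) blast
  then have eq: "poly3.dim (gsat I' \<inter> upart n) = poly3.dim (I' \<inter> upart n)
      + (poly3.dim (gsat I' \<inter> upart n) - poly3.dim (I' \<inter> upart n))" by simp
  show ?thesis
    unfolding H0_eq[OF I, folded I'] dim_graded[OF gr, symmetric] dim_graded[OF J, symmetric]
  proof (rule C.module_length_eq[OF I gradedD(1)[OF J], folded I', OF IJ])
    fix l K
    assume K: "\<And>i. i \<le> l \<Longrightarrow> sideal (K i) \<and> I' \<subseteq> K i \<and> K i \<subseteq> gsat I'" "\<And>i. i < l \<Longrightarrow> K i \<subset> K (Suc i)"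
    show "l \<le> poly3.dim (gsat I' \<inter> upart n) - poly3.dim (I' \<inter> upart n)"
      by (rule chain_upper[where I = I' and J = "gsat I'" and n = n and K = K and l = l]) (fact gr J IJ large K)+
  next
    show "\<exists>c. (\<forall>i\<le>poly3.dim (gsat I' \<inter> upart n) - poly3.dim (I' \<inter> upart n).
        sideal (c i) \<and> I' \<subseteq> c i \<and> c i \<subseteq> gsat I')
      \<and> (\<forall>i<poly3.dim (gsat I' \<inter> upart n) - poly3.dim (I' \<inter> upart n). c i \<subset> c (Suc i))"
    proof -
      have "\<exists>c. c 0 = I' \<and> (\<forall>i\<le>poly3.dim (gsat I' \<inter> upart n) - poly3.dim (I' \<inter> upart n).
          sideal (c i) \<and> I' \<subseteq> c i \<and> c i \<subseteq> gsat I')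
        \<and> (\<forall>i<poly3.dim (gsat I' \<inter> upart n) - poly3.dim (I' \<inter> upart n). c i \<subset> c (Suc i))"
        by (rule chain_lower[where I = I' and J = "gsat I'" and n = n]) (fact gr J IJ large order_refl eq)+
      then show ?thesis by (elim exE conjE) (intro exI conjI)
    qed
  qed
qed

end

lemma CHAR_poly3: "CHAR('k::field poly3) = CHAR('k)"
proof (rule CHAR_eqI)
  have of_nat: "of_nat n = cst (of_nat n :: 'k)" for n by (simp flip: single_of_nat)
  show "of_nat CHAR('k) = (0 :: 'k poly3)" unfolding of_nat by simp
  fix x assume "of_nat x = (0 :: 'k poly3)"
  then have "cst (of_nat x :: 'k) = 0" unfolding of_nat .
  then have "(of_nat x :: 'k) = 0" by (metis lookup_single_eq lookup_zero)
  then show "CHAR('k) dvd x" by (simp add: of_nat_eq_0_iff_char_dvd)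
qed

section \<open>Generators, gradings and Frobenius powers\<close>

context plane_curve
begin

text \<open>\<open>NF\<close> is included, which makes this the preimage of a two-generated ideal of
  the coordinate ring.\<close>

definition gen :: "'k poly3 \<Rightarrow> 'k poly3 \<Rightarrow> 'k poly3 set" where
  "gen f g = {u * f + v * g + w | u v w. w \<in> NF}"

lemma sideal_NF: "sideal NF" using gradedD(1)[OF graded_NF] .

lemma genI: "w \<in> NF \<Longrightarrow> u * f + v * g + w \<in> gen f g"
  unfolding gen_def by blast

lemma genE:
  assumes "s \<in> gen f g"
  obtains u v w where "s = u * f + v * g + w" "w \<in> NF"
  using assms unfolding gen_def by blast

lemma sideal_gen: "sideal (gen f g)"
  unfolding sideal_def
proof (intro conjI ballI allI)
  show "0 \<in> gen f g" using genI[OF sidealD(1)[OF sideal_NF], of 0 f 0 g] by simp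
  fix s assume "s \<in> gen f g"
  then obtain u v w where s: "s = u * f + v * g + w" "w \<in> NF" by (rule genE)
  show "a * s \<in> gen f g" for a
    using genI[OF sidealD(3)[OF sideal_NF s(2), of a], of "a * u" f "a * v" g] unfolding s(1)
    by (simp add: algebra_simps)
  show "s + t \<in> gen f g" if "t \<in> gen f g" for t
  proof -
    obtain u' v' w' where t: "t = u' * f + v' * g + w'" "w' \<in> NF" using \<open>t \<in> gen f g\<close> by (rule genE)
    show ?thesis
      using genI[OF sidealD(2)[OF sideal_NF s(2) t(2)], of "u + u'" f "v + v'" g] unfolding s(1) t(1)
      by (simp add: algebra_simps)
  qed
qed

lemma gen_mem: "f \<in> gen f g" "g \<in> gen f g" "NF \<subseteq> gen f g"
proof -
  note z = sidealD(1)[OF sideal_NF]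
  show "f \<in> gen f g" using genI[OF z, of 1 f 0 g] by simp
  show "g \<in> gen f g" using genI[OF z, of 0 f 1 g] by simp
  show "NF \<subseteq> gen f g" using genI[of _ 0 f 0 g] by auto
qed

lemma gen_least: "sideal J \<Longrightarrow> NF \<subseteq> J \<Longrightarrow> f \<in> J \<Longrightarrow> g \<in> J \<Longrightarrow> gen f g \<subseteq> J"
  unfolding gen_def by (auto intro!: sidealD(2)[of J] sidealD(3)[of J])

lemma graded_gen:
  assumes "homogeneous a f" "homogeneous b g"
  shows "graded (gen f g)"
  unfolding graded_def
proof (intro conjI ballI allI sideal_gen)
  fix s e assume "s \<in> gen f g"
  then obtain u v w where s: "s = u * f + v * g + w" "w \<in> NF" by (rule genE)
  have "comp e (u * f) = comp (e - int a) u * f" "comp e (v * g) = comp (e - int b) v * g"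
    using comp_mult[OF assms(1), of "e - int a" u] comp_mult[OF assms(2), of "e - int b" v]
    by (simp_all add: mult.commute)
  then have "comp e s = comp (e - int a) u * f + comp (e - int b) v * g + comp e w"
    unfolding s(1) comp_add by simp
  then show "comp e s \<in> gen f g" using genI[OF gradedD(2)[OF graded_NF s(2), of e]] by simp
qed

lemma pull_Idl:
  "{s. cproj F s \<in> Idl\<^bsub>CR\<^esub> {cproj F a, cproj F b}} = gen a b"
proof
  have sub: "{cproj F a, cproj F b} \<subseteq> carrier CR" using C.\<pi>_carrier by blast
  have "Idl\<^bsub>CR\<^esub> {cproj F a, cproj F b} \<subseteq> cproj F ` gen a b"
    by (rule C.genideal_minimal[OF C.ideal_image[OF sideal_gen]]) (use gen_mem in blast)
  then show "{s. cproj F s \<in> Idl\<^bsub>CR\<^esub> {cproj F a, cproj F b}} \<subseteq> gen a b"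
    using C.mem_image[OF sideal_gen gen_mem(3)] by blast
  note id = C.genideal_ideal[OF sub]
  show "gen a b \<subseteq> {s. cproj F s \<in> Idl\<^bsub>CR\<^esub> {cproj F a, cproj F b}}"
    by (rule gen_least[OF C.sideal_pull[OF id] C.N_pull[OF id]]) (use C.genideal_self[OF sub] in auto)
qed

text \<open>In characteristic \<open>ch\<close> the \<open>q\<close>-th power is additive, so the
  power of \<open>u * f + v * g + w\<close> is a combination of \<open>f^q\<close> and
  \<open>g^q\<close> modulo \<open>NF\<close>.\<close>

lemma frobenius_pull:
  assumes I: "ideal I CR" "{s. cproj F s \<in> I} = gen f g"
    and ch: "Factorial_Ring.prime ch" "CHAR('k) = ch"
  shows "ideal (frobenius_power CR I (ch ^ n)) CR"
    and "{s. cproj F s \<in> frobenius_power CR I (ch ^ n)} = gen (f ^ (ch ^ n)) (g ^ (ch ^ n))"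
proof -
  let ?q = "ch ^ n" and ?X = "(\<lambda>x. x [^]\<^bsub>CR\<^esub> (ch ^ n)) ` I"
  have IC: "I \<subseteq> carrier CR" using ideal.Icarr[OF I(1)] by blast
  have sub: "?X \<subseteq> carrier CR" using IC by auto
  show id: "ideal (frobenius_power CR I ?q) CR"
    unfolding frobenius_power_def by (rule C.genideal_ideal[OF sub])
  have fr: "(s + t) ^ ?q = s ^ ?q + t ^ ?q" for s t :: "'k poly3"
    by (rule freshmans_dream') (use ch in \<open>simp_all add: CHAR_poly3\<close>)
  have q: "0 < ?q" using ch(1) prime_gt_0_nat by simp
  have "?X \<subseteq> cproj F ` gen (f ^ ?q) (g ^ ?q)"
  proof (rule image_subsetI)
    fix x assume "x \<in> I"
    then have "x \<in> cproj F ` gen f g" using C.ideal_eq_image[OF I(1)] unfolding I(2) by simp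
    then obtain s where s: "x = cproj F s" "s \<in> gen f g" by blast
    then obtain u v w where uvw: "s = u * f + v * g + w" "w \<in> NF" using genE by blast
    have "w ^ ?q \<in> NF" using uvw(2) q unfolding NF_def by (simp add: dvd_power_same dvd_trans dvd_power)
    then have "s ^ ?q \<in> gen (f ^ ?q) (g ^ ?q)" unfolding uvw(1) fr power_mult_distrib by (rule genI)
    then show "x [^]\<^bsub>CR\<^esub> ?q \<in> cproj F ` gen (f ^ ?q) (g ^ ?q)" unfolding s(1) by (simp flip: C.\<pi>_power)
  qed
  then have "frobenius_power CR I ?q \<subseteq> cproj F ` gen (f ^ ?q) (g ^ ?q)"
    unfolding frobenius_power_def by (rule C.genideal_minimal[OF C.ideal_image[OF sideal_gen]])
  moreover have "cproj F (s ^ ?q) \<in> frobenius_power CR I ?q" if "s \<in> gen f g" for s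
    unfolding frobenius_power_def C.\<pi>_power using C.genideal_self[OF sub] that I(2) by blast
  then have "gen (f ^ ?q) (g ^ ?q) \<subseteq> {s. cproj F s \<in> frobenius_power CR I ?q}"
    using gen_mem by (intro gen_least[OF C.sideal_pull[OF id] C.N_pull[OF id]]) auto
  ultimately show "{s. cproj F s \<in> frobenius_power CR I ?q} = gen (f ^ ?q) (g ^ ?q)"
    using C.mem_image[OF sideal_gen gen_mem(3)] by blast
qed

text \<open>\<open>K\<close> collects the polynomials all of whose components lie in the preimage of
  \<open>I\<close>. It is an ideal containing \<open>NF\<close> and the homogeneous elements of the
  preimage, and since the latter generate \<open>I\<close>, it is the whole preimage.\<close>

lemma graded_pull:
  assumes "graded_ideal CR (coord_grading F) I"
  shows "graded {s. cproj F s \<in> I}"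
proof -
  have I: "ideal I CR" and gen: "I = Idl\<^bsub>CR\<^esub> (I \<inter> (\<Union>d. coord_grading F d))"
    using assms unfolding graded_ideal_def by blast+
  note sI = C.sideal_pull[OF I]
  define K where "K = {s. \<forall>e. comp e s \<in> {s. cproj F s \<in> I}}"
  have sK: "sideal K"
    unfolding sideal_def
  proof (intro conjI ballI allI)
    show "0 \<in> K" unfolding K_def using sidealD(1)[OF sI] by simp
    show "a + b \<in> K" if "a \<in> K" "b \<in> K" for a b
      using that sidealD(2)[OF sI] unfolding K_def by (simp add: comp_add)
    fix a b assume b: "b \<in> K"
    have "comp e (a * b) \<in> {s. cproj F s \<in> I}" for e
    proof -
      have "a * b = (\<Sum>i\<le>maxdeg a. comp (int i) a * b)"
        by (metis sum_comp[OF order_refl] sum_distrib_right)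
      then have "comp e (a * b) = (\<Sum>i\<le>maxdeg a. comp e (comp (int i) a * b))" by (simp add: comp_sum)
      also have "\<dots> = (\<Sum>i\<le>maxdeg a. comp (int i) a * comp (e - int i) b)"
      proof (rule sum.cong[OF refl])
        fix i
        show "comp e (comp (int i) a * b) = comp (int i) a * comp (e - int i) b"
          using comp_mult[OF homogeneous_comp[of "int i" a], of "e - int i" b] by simp
      qed
      also have "\<dots> \<in> {s. cproj F s \<in> I}"
        by (rule sideal_sum[OF sI], rule sidealD(3)[OF sI]) (use b in \<open>simp add: K_def\<close>)
      finally show ?thesis .
    qed
    then show "a * b \<in> K" unfolding K_def by blast
  qed
  have "I \<inter> (\<Union>d. coord_grading F d) \<subseteq> cproj F ` K"
  proof
    fix x assume x: "x \<in> I \<inter> (\<Union>d. coord_grading F d)"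
    then obtain d f where f: "x = cproj F f" "homogeneous d f" unfolding coord_grading_eq by blast
    have "f \<in> K" unfolding K_def using x f(1) sidealD(1)[OF sI] by (auto simp: comp_homogeneous[OF f(2)])
    then show "x \<in> cproj F ` K" using f(1) by blast
  qed
  then have "I \<subseteq> cproj F ` K" using gen C.genideal_minimal[OF C.ideal_image[OF sK]] by blast
  moreover have "NF \<subseteq> K"
    unfolding K_def using gradedD(2)[OF graded_NF] C.N_pull[OF I] by blast
  ultimately have "{s. cproj F s \<in> I} \<subseteq> K" using C.mem_image[OF sK] by blast
  then show ?thesis unfolding graded_def using sI unfolding K_def by blast
qed

text \<open>A graded version of Nakayama's lemma: three homogeneous elements that are minimal generators
  successively would be linearly independent modulo \<open>(x, y, z) Q\<close>, but \<open>Q\<close> has two generators.\<close>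

lemma homogeneous_generators:
  assumes Q: "graded Q" "Q = gen a b" and ne: "Q \<noteq> NF"
  obtains f g c e where "homogeneous c f" "homogeneous e g" "f \<notin> NF" "g \<notin> NF" "Q = gen f g"
proof -
  have sQ: "sideal Q" using gradedD(1)[OF Q(1)] .
  have NQ: "NF \<subseteq> Q" using gen_mem(3) Q(2) by blast
  \<comment> \<open>A form of least degree in \<open>Q\<close> outside \<open>J\<close>: below that
    degree every component of an element of \<open>Q\<close> lies in \<open>J\<close>.\<close>
  have minimal: "\<exists>f c. homogeneous c f \<and> f \<in> Q \<and> f \<notin> J \<and> (\<forall>s\<in>Q. \<forall>i<int c. comp i s \<in> J)"
    if J: "sideal J" "\<not> Q \<subseteq> J" for J
  proof -
    obtain s where s: "s \<in> Q" "s \<notin> J" using J by blast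
    have "\<exists>i. comp (int i) s \<notin> J"
    proof (rule ccontr)
      assume "\<not> ?thesis"
      then have "(\<Sum>i\<le>maxdeg s. comp (int i) s) \<in> J" by (intro sideal_sum[OF J(1)]) blast
      then show False using s(2) sum_comp[OF order_refl, of s] by simp
    qed
    then have ex: "\<exists>i. \<exists>s\<in>Q. comp (int i) s \<notin> J" using s(1) by blast
    define c where "c = (LEAST i. \<exists>s\<in>Q. comp (int i) s \<notin> J)"
    obtain t where t: "t \<in> Q" "comp (int c) t \<notin> J" using LeastI_ex[OF ex] unfolding c_def by blast
    have "comp i s \<in> J" if "s \<in> Q" "i < int c" for s i
    proof (cases "0 \<le> i")
      case True
      then have "nat i < c" using that by simp
      then show ?thesis using not_less_Least[of "nat i" "\<lambda>i. \<exists>s\<in>Q. comp (int i) s \<notin> J"] that True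
        unfolding c_def by auto
    qed (simp add: comp_neg sidealD(1)[OF J(1)])
    then show ?thesis using t gradedD(2)[OF Q(1)] homogeneous_comp[of "int c" t]
      by (intro exI[of _ "comp (int c) t"] exI[of _ c]) auto
  qed
  \<comment> \<open>A factor without constant term raises degrees, so components of the product up
    to degree \<open>c\<close> only involve components of \<open>s\<close> below
    \<open>c\<close>.\<close>
  have prod_mem: "comp i (A * s) \<in> J"
    if J: "sideal J" and min: "\<forall>s\<in>Q. \<forall>i<int c. comp i s \<in> J" and A: "A \<in> zpart 1" and s: "s \<in> Q" and i: "i \<le> int c"
    for i A s J c
  proof -
    have "A * s = (\<Sum>j\<in>{1..maxdeg A}. comp (int j) A * s)"
      by (metis zpart_sum[OF A order_refl] sum_distrib_right)
    then have "comp i (A * s) = (\<Sum>j\<in>{1..maxdeg A}. comp i (comp (int j) A * s))" by (simp add: comp_sum)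
    also have "\<dots> = (\<Sum>j\<in>{1..maxdeg A}. comp (int j) A * comp (i - int j) s)"
    proof (rule sum.cong[OF refl])
      fix j
      show "comp i (comp (int j) A * s) = comp (int j) A * comp (i - int j) s"
        using comp_mult[OF homogeneous_comp[of "int j" A], of "i - int j" s] by simp
    qed
    also have "\<dots> \<in> J"
    proof (rule sideal_sum[OF J], rule sidealD(3)[OF J])
      fix j assume "j \<in> {1..maxdeg A}"
      then have "i - int j < int c" using i by simp
      then show "comp (i - int j) s \<in> J" using min s by blast
    qed
    finally show ?thesis .
  qed
  obtain f c where f: "homogeneous c f" "f \<in> Q" "f \<notin> NF" and f_min: "\<forall>s\<in>Q. \<forall>i<int c. comp i s \<in> NF"
    using minimal[OF sideal_NF] ne NQ by blast
  show ?thesis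
  proof (cases "Q \<subseteq> gen f f")
    case True
    \<comment> \<open>A principal ideal is presented with its generator taken twice, so that two
      nonzero forms are always available.\<close>
    then have "Q = gen f f" using gen_least[OF sQ NQ f(2) f(2)] by blast
    then show ?thesis using that[OF f(1,1,3,3)] by blast
  next
    case False
    obtain g e where g: "homogeneous e g" "g \<in> Q" "g \<notin> gen f f" and g_min: "\<forall>s\<in>Q. \<forall>i<int e. comp i s \<in> gen f f"
      using minimal[OF sideal_gen False] by blast
    have gNF: "g \<notin> NF" using g(3) gen_mem(3) by blast
    show ?thesis
    proof (cases "Q \<subseteq> gen f g")
      case True
      then have "Q = gen f g" using gen_least[OF sQ NQ f(2) g(2)] by blast
      then show ?thesis using that[OF f(1) g(1) f(3) gNF] by blast
    next
      case False
      obtain h d' where h: "homogeneous d' h" "h \<in> Q" "h \<notin> gen f g" and h_min: "\<forall>s\<in>Q. \<forall>i<int d'. comp i s \<in> gen f g"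
        using minimal[OF sideal_gen False] by blast
      obtain f1 f2 f3 where f': "f = f1 * a + f2 * b + f3" "f3 \<in> NF" using f(2) unfolding Q(2) by (rule genE)
      obtain g1 g2 g3 where g': "g = g1 * a + g2 * b + g3" "g3 \<in> NF" using g(2) unfolding Q(2) by (rule genE)
      obtain h1 h2 h3 where h': "h = h1 * a + h2 * b + h3" "h3 \<in> NF" using h(2) unfolding Q(2) by (rule genE)
      define z where "z u = Poly_Mapping.lookup u 0" for u :: "'k poly3"
      \<comment> \<open>Three vectors of the plane are dependent. The coefficients are the cross
        product of the two coordinate rows, with separate choices when it vanishes.\<close>
      have dep: "\<exists>x1 x2 x3 :: 'k. (x1 \<noteq> 0 \<or> x2 \<noteq> 0 \<or> x3 \<noteq> 0) \<and> x1 * p1 + x2 * p2 + x3 * p3 = 0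
          \<and> x1 * q1 + x2 * q2 + x3 * q3 = 0" for p1 p2 p3 q1 q2 q3
      proof (cases "p1 * q2 = p2 * q1 \<and> p2 * q3 = p3 * q2 \<and> p3 * q1 = p1 * q3")
        case False
        then show ?thesis
          by (intro exI[of _ "p2 * q3 - p3 * q2"] exI[of _ "p3 * q1 - p1 * q3"] exI[of _ "p1 * q2 - p2 * q1"])
            (auto simp: algebra_simps)
      next
        case True
        consider "p1 = 0" "q1 = 0" | "p1 \<noteq> 0" | "q1 \<noteq> 0" by blast
        then show ?thesis
        proof cases
          case 1
          then show ?thesis by (intro exI[of _ 1] exI[of _ 0]) simp
        next
          case 2
          then show ?thesis using True
            by (intro exI[of _ p2] exI[of _ "- p1"] exI[of _ 0]) (simp add: algebra_simps)
        next
          case 3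
          then show ?thesis using True
            by (intro exI[of _ q2] exI[of _ "- q1"] exI[of _ 0]) (simp add: algebra_simps)
        qed
      qed
      obtain x1 x2 x3 where x: "x1 \<noteq> 0 \<or> x2 \<noteq> 0 \<or> x3 \<noteq> 0"
        and x1: "x1 * z f1 + x2 * z g1 + x3 * z h1 = 0" and x2: "x1 * z f2 + x2 * z g2 + x3 * z h2 = 0"
        using dep by metis
      \<comment> \<open>The coefficients of \<open>a\<close> and \<open>b\<close> in the combination
        \<open>w\<close> of the three generators; by the choice of \<open>x1\<close>,
        \<open>x2\<close>, \<open>x3\<close> their constant terms vanish.\<close>
      define A where "A = cst x1 * f1 + cst x2 * g1 + cst x3 * h1"
      define B where "B = cst x1 * f2 + cst x2 * g2 + cst x3 * h2"
      define w where "w = cst x1 * f + cst x2 * g + cst x3 * h"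
      have cz: "comp 0 (cst u * v) = cst (u * z v)" for u v
        using comp_mult[OF homogeneous_cst, of 0 u v] unfolding comp_0_cst[of v] z_def by (simp add: mult_single)
      have "comp 0 A = 0" "comp 0 B = 0"
        unfolding A_def B_def comp_add cz using x1 x2 by (simp_all flip: single_add)
      then have AB: "A \<in> zpart 1" "B \<in> zpart 1" using minus_comp_0_zpart[of A] minus_comp_0_zpart[of B] by simp_all
      define w' where "w' = cst x1 * f3 + cst x2 * g3 + cst x3 * h3"
      have w': "w' \<in> NF" unfolding w'_def using f'(2) g'(2) h'(2) sidealD(2,3)[OF sideal_NF] by simp
      have w_eq: "w = A * a + B * b + w'"
        unfolding w_def A_def B_def w'_def by (subst f'(1), subst g'(1), subst h'(1)) (simp add: algebra_simps)
      have ab: "a \<in> Q" "b \<in> Q" unfolding Q(2) by (rule gen_mem)+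
      have w_comp: "comp (int i) w \<in> J" if "sideal J" "NF \<subseteq> J" "\<forall>s\<in>Q. \<forall>j<int i. comp j s \<in> J" for J i
        unfolding w_eq comp_add
        using prod_mem[OF that(1,3) AB(1) ab(1) order_refl] prod_mem[OF that(1,3) AB(2) ab(2) order_refl]
          gradedD(2)[OF graded_NF w', of "int i"] that(2) sidealD(2)[OF that(1)] by blast
      have comp_w: "comp (int i) w = (if i = c then cst x1 * f else 0) + (if i = e then cst x2 * g else 0)
          + (if i = d' then cst x3 * h else 0)" for i
        unfolding w_def comp_add
        using comp_homogeneous[OF homogeneous_cst_mult[OF f(1)], of "int i" x1]
          comp_homogeneous[OF homogeneous_cst_mult[OF g(1)], of "int i" x2]
          comp_homogeneous[OF homogeneous_cst_mult[OF h(1)], of "int i" x3] by simp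
      have cancel: "t \<in> J" if J: "sideal J" and "cst u * t \<in> J" "u \<noteq> 0" for J u and t :: "'k poly3"
        using sidealD(3)[OF J that(2), of "cst (inverse u)"] that(3) by (simp add: mult_single flip: mult.assoc)
      have split: "v \<in> J" if "sideal J" "u + v \<in> J" "u \<in> J" for J and u v :: "'k poly3"
        using sidealD(5)[OF that] by simp
      \<comment> \<open>In degree \<open>d'\<close> the combination \<open>w\<close> lies in
        \<open>gen f g\<close> by minimality of \<open>d'\<close>, as \<open>A\<close> and
        \<open>B\<close> have no constant terms; a nonzero \<open>x3\<close> would put
        \<open>h\<close> there as well. The same argument then removes \<open>x2\<close> and
        \<open>x1\<close>.\<close>
      have "x3 = 0"
      proof (rule ccontr)
        assume "x3 \<noteq> 0"
        let ?J = "gen f g"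
        have "(if d' = c then cst x1 * f else 0) + (if d' = e then cst x2 * g else 0) + cst x3 * h \<in> ?J"
          using w_comp[OF sideal_gen gen_mem(3) h_min] unfolding comp_w by simp
        moreover have "(if d' = c then cst x1 * f else 0) + (if d' = e then cst x2 * g else 0) \<in> ?J"
          using sidealD[OF sideal_gen[of f g]] gen_mem(1)[of f g] gen_mem(2)[of g f] by auto
        ultimately have "cst x3 * h \<in> ?J" using split[OF sideal_gen] by blast
        then show False using cancel[OF sideal_gen] \<open>x3 \<noteq> 0\<close> h(3) by blast
      qed
      moreover have "x2 = 0"
      proof (rule ccontr)
        assume "x2 \<noteq> 0"
        let ?J = "gen f f"
        have "(if e = c then cst x1 * f else 0) + cst x2 * g \<in> ?J"
          using w_comp[OF sideal_gen gen_mem(3) g_min] unfolding comp_w \<open>x3 = 0\<close> by (simp split: if_splits)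
        moreover have "(if e = c then cst x1 * f else 0) \<in> ?J"
          using sidealD[OF sideal_gen[of f f]] gen_mem(1)[of f f] by auto
        ultimately have "cst x2 * g \<in> ?J" using split[OF sideal_gen] by blast
        then show False using cancel[OF sideal_gen] \<open>x2 \<noteq> 0\<close> g(3) by blast
      qed
      moreover have "x1 = 0"
      proof (rule ccontr)
        assume "x1 \<noteq> 0"
        have "cst x1 * f \<in> NF"
          using w_comp[OF sideal_NF order_refl f_min] unfolding comp_w \<open>x3 = 0\<close> \<open>x2 = 0\<close> by (simp split: if_splits)
        then show False using cancel[OF sideal_NF] \<open>x1 \<noteq> 0\<close> f(3) by blast
      qed
      ultimately show ?thesis using x by blast
    qed
  qed
qed

end

section \<open>Hilbert-Kunz function in terms of the graded surface\<close>

context plane_curve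
begin

lemma gmod_graded: "graded J \<Longrightarrow> NF \<subseteq> J \<Longrightarrow> gmod (\<lambda>m. J \<inter> hpart m)"
  unfolding gmod_def Fpart_eq
  using sideal_subspace[of J] gradedD(1)[of J] subspace_hpart poly3.subspace_inter sidealD(3)[of J] hpart_mult
  by blast

lemma pr_iff: "s \<in> pr h (int c) m \<longleftrightarrow> (\<exists>u\<in>hpart (m - int c). s - h * u \<in> NF \<inter> hpart m)"
  unfolding mulM_iff Fpart_eq ..

lemma gen_hpart:
  assumes f: "homogeneous c f" and g: "homogeneous e g"
  shows "gen f g \<inter> hpart m = pr f (int c) m + pr g (int e) m"
proof
  have fg: "f \<in> hpart (int c)" "g \<in> hpart (int e)" using f g by simp_all
  have gm: "gmod (\<lambda>m. gen f g \<inter> hpart m)" by (rule gmod_graded[OF graded_gen[OF f g] gen_mem(3)])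
  show "pr f (int c) m + pr g (int e) m \<subseteq> gen f g \<inter> hpart m"
    using mulM_element_subset[OF gm, of f "int c" m] mulM_element_subset[OF gm, of g "int e" m] fg gen_mem(1,2)
    by (intro plus_subset[OF gm]) blast+
  show "gen f g \<inter> hpart m \<subseteq> pr f (int c) m + pr g (int e) m"
  proof
    fix s assume s: "s \<in> gen f g \<inter> hpart m"
    then obtain u v w where uvw: "s = u * f + v * g + w" "w \<in> NF" using genE by blast
    have "s = comp m s" using s hpart_comp by force
    also have "\<dots> = comp (m - int c) u * f + comp (m - int e) v * g + comp m w"
      unfolding uvw(1) comp_add
      using comp_mult[OF f, of "m - int c" u] comp_mult[OF g, of "m - int e" v] by (simp add: mult.commute)
    finally have eq: "s = (f * comp (m - int c) u + comp m w) + g * comp (m - int e) v" by (simp add: ac_simps)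
    have "f * comp (m - int c) u + comp m w \<in> pr f (int c) m"
      unfolding pr_iff using comp_hpart gradedD(2)[OF graded_NF uvw(2)]
      by (intro bexI[of _ "comp (m - int c) u"]) auto
    moreover have "g * comp (m - int e) v \<in> pr g (int e) m"
      unfolding pr_iff using comp_hpart sidealD(1)[OF sideal_NF] comp_hpart[of m "0 :: 'k poly3"]
      by (intro bexI[of _ "comp (m - int e) v"]) auto
    ultimately show "s \<in> pr f (int c) m + pr g (int e) m" by (subst eq) (rule set_plus_intro)
  qed
qed

lemma gsat_hpart:
  assumes "\<And>m. I \<inter> hpart m = M m"
  shows "gsat I \<inter> hpart m = sat M m"
proof -
  have "a * s \<in> I \<longleftrightarrow> a * s \<in> M (d + m)" if "a \<in> hpart d" "s \<in> hpart m" for a s d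
    using hpart_mult[OF that] assms[of "d + m"] by blast
  then have iff: "(\<forall>d\<ge>t. \<forall>a\<in>hpart d. a * s \<in> I) \<longleftrightarrow> (\<forall>d\<ge>t. \<forall>a\<in>hpart d. a * s \<in> M (d + m))"
    if "s \<in> hpart m" for s t using that by simp
  show ?thesis
  proof (rule Set.set_eqI)
    fix s
    show "s \<in> gsat I \<inter> hpart m \<longleftrightarrow> s \<in> sat M m"
      unfolding gsat_def sat_def by (cases "s \<in> hpart m") (simp_all add: iff)
  qed
qed

lemma f_gHK_asymptotics:
  assumes ch: "Factorial_Ring.prime ch" "CHAR('k) = ch"
    and gr: "graded_ideal CR (coord_grading F) I"
    and I2: "\<exists>a\<in>carrier CR. \<exists>b\<in>carrier CR. I = Idl\<^bsub>CR\<^esub> {a, b}"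
  shows "\<exists>L\<in>\<rat>. \<exists>l. (\<forall>n. f_gHK CR (irrelevant_ideal CR (coord_grading F)) ch I n = enat (l n))
    \<and> (\<lambda>n. real (l n) / (real (ch ^ n))\<^sup>2) \<longlonglongrightarrow> L"
proof -
  have I: "ideal I CR" using gr unfolding graded_ideal_def by blast
  define Q where "Q = {s. cproj F s \<in> I}"
  have Q: "graded Q" unfolding Q_def by (rule graded_pull[OF gr])
  obtain a b where Qab: "Q = gen a b" using I2 pull_Idl unfolding Q_def C.carrier_eq by blast
  have len: "f_gHK CR (irrelevant_ideal CR (coord_grading F)) ch I n
      = enat ((\<Sum>m<k. poly3.dim (gsat J \<inter> hpart (int m))) - (\<Sum>m<k. poly3.dim (J \<inter> hpart (int m))))"
    if "J = gen (f ^ (ch ^ n)) (g ^ (ch ^ n))" "Q = gen f g" "graded J"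
      "\<And>m. int k \<le> m \<Longrightarrow> gsat J \<inter> hpart m \<subseteq> J" for n f g J k
    unfolding f_gHK_def Let_def
    using length_H0[OF frobenius_pull(1)[OF I _ ch] _ that(3,4)] frobenius_pull(2)[OF I _ ch] that(1,2)
    unfolding Q_def by simp
  show ?thesis
  proof (cases "Q = NF")
    case True
    \<comment> \<open>The zero ideal of the domain is already saturated, so the local cohomology
      vanishes. This case is split off because \<open>two_forms\<close> asks for forms outside
      \<open>P\<close>.\<close>
    have "f_gHK CR (irrelevant_ideal CR (coord_grading F)) ch I n = enat 0" for n
    proof -
      have q: "0 < ch ^ n" using ch(1) prime_gt_0_nat by simp
      have NF: "gen 0 0 = NF" unfolding gen_def by auto
      have Q0: "Q = gen 0 0" using True NF by simp
      have J: "NF = gen (0 ^ (ch ^ n)) (0 ^ (ch ^ n))" unfolding zero_power[OF q] NF ..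
      have "gsat NF \<inter> hpart m \<subseteq> NF" for m
      proof
        fix s assume s: "s \<in> gsat NF \<inter> hpart m"
        then obtain t where t: "\<And>d a. t \<le> d \<Longrightarrow> a \<in> hpart d \<Longrightarrow> a * s \<in> NF" unfolding gsat_def by blast
        have "l1 ^ nat t * s \<in> NF" by (rule t[of "int (nat t)"]) (use pow_G[OF x_G, of "nat t"] in auto)
        then have "l1 ^ nat t * s \<in> Fpart (int (nat t) * 1 + m)"
          unfolding Fpart_eq using hpart_mult[OF pow_G[OF x_G, of "nat t"]] s by blast
        then have "s \<in> Fpart m" using P_cancel[OF pow_G[OF x_G] pow_P[OF x_G x_P]] s by blast
        then show "s \<in> NF" unfolding Fpart_eq by blast
      qed
      from len[OF J Q0 graded_NF this, of 0] show ?thesis by simp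
    qed
    then show ?thesis by (intro bexI[of _ 0] exI[of _ "\<lambda>_. 0"]) (simp_all add: Rats_0)
  next
    case False
    obtain f g c e where fg: "homogeneous c f" "homogeneous e g" "f \<notin> NF" "g \<notin> NF" "Q = gen f g"
      by (rule homogeneous_generators[OF Q Qab False])
    interpret T: two_forms "\<lambda>c f. cst c * (f :: 'k poly3)" hpart Fpart l1 l2 "int d" f g "int c" "int e"
      by unfold_locales (use fg in \<open>auto simp: Fpart_eq\<close>)
    obtain L N where L: "L \<in> \<rat>" and N': "\<forall>q m. int (N q) \<le> m \<longrightarrow> sat (T.Iq q) m = T.Iq q m"
      and lim: "(\<lambda>q. real_of_int (\<Sum>m<N q. hf (sat (T.Iq q)) (int m) - hf (T.Iq q) (int m)) / (real q)\<^sup>2) \<longlonglongrightarrow> L"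
      using T.colength_asymptotics by (elim bexE exE conjE)
    have N: "sat (T.Iq q) m = T.Iq q m" if "int (N q) \<le> m" for q m using N' that by simp
    define J where "J q = gen (f ^ q) (g ^ q)" for q
    have hom: "homogeneous (q * c) (f ^ q)" "homogeneous (q * e) (g ^ q)" for q
      using fg homogeneous_power by blast+
    have J: "graded (J q)" for q unfolding J_def using graded_gen[OF hom] .
    have JI: "J q \<inter> hpart m = T.Iq q m" for q m
      unfolding J_def gen_hpart[OF hom] T.Iq_def by simp
    have SI: "gsat (J q) \<inter> hpart m = sat (T.Iq q) m" for q m
      by (rule gsat_hpart) (rule JI)
    define l where "l q = (\<Sum>m<N q. poly3.dim (sat (T.Iq q) (int m))) - (\<Sum>m<N q. poly3.dim (T.Iq q (int m)))" for q
    have f: "f_gHK CR (irrelevant_ideal CR (coord_grading F)) ch I n = enat (l (ch ^ n))" for n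
    proof -
      have "gsat (J (ch ^ n)) \<inter> hpart m \<subseteq> J (ch ^ n)" if "int (N (ch ^ n)) \<le> m" for m
        unfolding SI N[OF that] using JI by blast
      from len[OF J_def[of "ch ^ n"] fg(5) J this] show ?thesis unfolding SI JI l_def .
    qed
    have l: "real (l q) = real_of_int (\<Sum>m<N q. hf (sat (T.Iq q)) (int m) - hf (T.Iq q) (int m))" for q
    proof -
      have "(\<Sum>m<N q. poly3.dim (T.Iq q (int m))) \<le> (\<Sum>m<N q. poly3.dim (sat (T.Iq q) (int m)))"
        by (intro sum_mono poly3.dim_mono_fin_dim sat_superset T.gmod_Iq gmodD(4)[OF gmod_sat])
      then have "int (l q) = (\<Sum>m<N q. int (poly3.dim (sat (T.Iq q) (int m)))) - (\<Sum>m<N q. int (poly3.dim (T.Iq q (int m))))"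
        unfolding l_def by (simp add: of_nat_diff)
      also have "\<dots> = (\<Sum>m<N q. hf (sat (T.Iq q)) (int m) - hf (T.Iq q) (int m))"
        unfolding hf_def sum_subtractf[symmetric] by simp
      finally show ?thesis by (metis of_int_of_nat_eq)
    qed
    \<comment> \<open>The limit along all \<open>q\<close> is restricted to the powers of
      \<open>ch\<close>.\<close>
    have "filterlim (\<lambda>n. ch ^ n) at_top at_top"
      using filterlim_subseq[of "\<lambda>n. ch ^ n"] prime_gt_1_nat[OF ch(1)] by (simp add: strict_mono_def power_strict_increasing)
    from filterlim_compose[OF lim this] have "(\<lambda>n. real (l (ch ^ n)) / (real (ch ^ n))\<^sup>2) \<longlonglongrightarrow> L"
      unfolding l .
    then show ?thesis using f by (intro bexI[OF _ L] exI[of _ "\<lambda>n. l (ch ^ n)"] conjI allI)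
  qed
qed

end

section \<open>The Krull dimension of the coordinate ring\<close>

definition sprime :: "'s::comm_ring_1 set \<Rightarrow> bool" where
  "sprime p \<longleftrightarrow> sideal p \<and> 1 \<notin> p \<and> (\<forall>a b. a * b \<in> p \<longrightarrow> a \<in> p \<or> b \<in> p)"

lemma sprimeD: "sprime p \<Longrightarrow> sideal p" "sprime p \<Longrightarrow> 1 \<notin> p" "sprime p \<Longrightarrow> a * b \<in> p \<Longrightarrow> a \<in> p \<or> b \<in> p"
  unfolding sprime_def by blast+

lemma sprime_kernel:
  fixes h :: "'s::comm_ring_1 \<Rightarrow> 'a::idom"
  assumes "rhom h"
  shows "sprime {s. h s = 0}"
  unfolding sprime_def sideal_def by (simp add: rhomD[OF assms])

lemma (in surj_hom) primeideal_image:
  assumes p: "sprime p" "N \<subseteq> p"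
  shows "primeideal (\<pi> ` p) C"
proof (rule primeidealI)
  note sp = sprimeD(1)[OF p(1)]
  show "ideal (\<pi> ` p) C" by (rule ideal_image[OF sp])
  show "cring C" by (rule is_cring)
  show "carrier C \<noteq> \<pi> ` p" using \<pi>_carrier[of 1] mem_image[OF sp p(2), of 1] sprimeD(2)[OF p(1)] by auto
  fix a b assume "a \<in> carrier C" "b \<in> carrier C" and ab: "a \<otimes> b \<in> \<pi> ` p"
  then obtain s t where st: "a = \<pi> s" "b = \<pi> t" unfolding carrier_eq by blast
  then have "s * t \<in> p" using ab mem_image[OF sp p(2)] by (simp flip: \<pi>_mult)
  then show "a \<in> \<pi> ` p \<or> b \<in> \<pi> ` p" unfolding st using sprimeD(3)[OF p(1)] by blast
qed

lemma (in surj_hom) sprime_pull: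
  assumes "primeideal I C"
  shows "sprime {s. \<pi> s \<in> I}"
  unfolding sprime_def
proof (intro conjI allI impI)
  interpret I: primeideal I C by fact
  show "sideal {s. \<pi> s \<in> I}" by (rule sideal_pull) (rule I.is_ideal)
  show "1 \<notin> {s. \<pi> s \<in> I}" using I.one_imp_carrier I.I_notcarr by (auto simp: \<pi>_one)
  show "a \<in> {s. \<pi> s \<in> I} \<or> b \<in> {s. \<pi> s \<in> I}" if "a * b \<in> {s. \<pi> s \<in> I}" for a b
    using that I.I_prime[OF \<pi>_carrier \<pi>_carrier] by (simp add: \<pi>_mult)
qed

text \<open>The Hilbert function of the filtration of \<open>S / p\<close> by degree, for an ideal \<open>p\<close> that need not
  be graded. Passing to a larger prime lowers its order of growth by one.\<close>

definition cdim :: "'k::field poly3 set \<Rightarrow> nat \<Rightarrow> int" where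
  "cdim p n = int (poly3.dim (upart n :: 'k poly3 set)) - int (poly3.dim (p \<inter> upart n))"

lemma upart_mono: "m \<le> n \<Longrightarrow> upart m \<subseteq> upart n"
  unfolding upart_def by fastforce

lemma upart_mult: "a \<in> upart m \<Longrightarrow> b \<in> upart n \<Longrightarrow> a * b \<in> upart (m + n)"
  using keys_mult[of a b] unfolding upart_def by (fastforce simp: mdeg_add intro: add_strict_mono)

lemma mem_upart: "x \<in> upart (Suc (maxdeg x))"
  unfolding upart_def using le_maxdeg by (auto simp: less_Suc_eq_le)

lemma fin_dim_Int_upart: "poly3.fin_dim (p \<inter> upart n)"
  by (rule poly3.fin_dim_mono[OF fin_dim_upart Int_lower2])

lemma cdim_mono:
  fixes p :: "'k::field poly3 set"
  assumes p: "sideal p" and mn: "m \<le> n"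
  shows "cdim p m \<le> cdim p n"
proof -
  have eq: "(p \<inter> upart n) \<inter> upart m = p \<inter> upart m" using upart_mono[OF mn] by blast
  have "poly3.dim ((p \<inter> upart n) + upart m) + poly3.dim ((p \<inter> upart n) \<inter> upart m)
      = poly3.dim (p \<inter> upart n) + poly3.dim (upart m :: 'k poly3 set)"
    by (intro poly3.dim_plus_Int poly3.subspace_inter sideal_subspace[OF p] subspace_upart fin_dim_Int_upart fin_dim_upart)
  moreover have "poly3.dim ((p \<inter> upart n) + upart m) \<le> poly3.dim (upart n :: 'k poly3 set)"
    by (intro poly3.dim_mono_fin_dim poly3.plus_subspace_subset subspace_upart fin_dim_upart upart_mono[OF mn]) simp
  ultimately show ?thesis unfolding cdim_def eq by simp
qed

text \<open>As \<open>p\<close> is prime, multiplication by \<open>x\<close> embeds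
  \<open>S / p\<close> into \<open>p' / p\<close>, and it raises degrees by less than
  \<open>e\<close>.\<close>

lemma cdim_step:
  assumes p: "sprime p" and p': "sideal p'" "p \<subseteq> p'" and x: "x \<in> p'" "x \<notin> p" "x \<in> upart e"
  shows "cdim p' (n + e) \<le> cdim p (n + e) - cdim p n"
proof -
  note sp = sprimeD(1)[OF p]
  let ?V = "(\<lambda>u. x * u) ` upart n"
  have lin: "Vector_Spaces.linear (\<lambda>c f. cst c * f) (\<lambda>c f. cst c * f) (\<lambda>u. x * u)"
    by (rule linear_module_homI) (unfold_locales, simp_all add: distrib_left ac_simps)
  have "x \<noteq> 0" using x(2) sidealD(1)[OF sp] by blast
  then have inj: "inj_on (\<lambda>u. x * u) A" for A by (auto simp: inj_on_def)
  have sV: "poly3.subspace ?V"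
    using lin by (intro module_hom.subspace_image[OF _ subspace_upart]) (simp add: Vector_Spaces.linear_def)
  have VU: "?V \<subseteq> upart (n + e)" using upart_mult[OF x(3), of _ n] by (auto simp: add.commute)
  have Vp': "?V \<subseteq> p'" using sidealD(3)[OF p'(1) x(1)] by (auto simp: mult.commute)
  have Int: "?V \<inter> (p \<inter> upart (n + e)) = (\<lambda>u. x * u) ` (p \<inter> upart n)"
    using sprimeD(3)[OF p, of x] x(2) sidealD(3)[OF sp] VU by blast
  have "poly3.dim (?V + (p \<inter> upart (n + e))) + poly3.dim (?V \<inter> (p \<inter> upart (n + e)))
      = poly3.dim ?V + poly3.dim (p \<inter> upart (n + e))"
    by (intro poly3.dim_plus_Int sV poly3.subspace_inter sideal_subspace[OF sp] subspace_upart
        poly3.fin_dim_mono[OF fin_dim_upart VU] fin_dim_Int_upart)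
  moreover have "poly3.dim ?V = poly3.dim (upart n :: 'a poly3 set)"
    by (rule poly3.dim_inj_image[OF lin inj subspace_upart])
  moreover have "poly3.dim ((\<lambda>u. x * u) ` (p \<inter> upart n)) = poly3.dim (p \<inter> upart n)"
    by (rule poly3.dim_inj_image[OF lin inj]) (intro poly3.subspace_inter sideal_subspace[OF sp] subspace_upart)
  moreover have "poly3.dim (?V + (p \<inter> upart (n + e))) \<le> poly3.dim (p' \<inter> upart (n + e))"
    by (intro poly3.dim_mono_fin_dim poly3.plus_subspace_subset poly3.subspace_inter
        sideal_subspace[OF p'(1)] subspace_upart fin_dim_Int_upart)
      (use Vp' VU p'(2) in blast)+
  ultimately show ?thesis unfolding cdim_def Int by simp
qed

lemma cdim_nonneg: "0 \<le> cdim p n"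
  unfolding cdim_def by (simp add: poly3.dim_mono_fin_dim[OF Int_lower2 fin_dim_upart])

text \<open>Telescoping with step \<open>e\<close>: only the last \<open>e\<close> values of
  \<open>g\<close> survive, up to a nonpositive term.\<close>

lemma sum_cdim:
  assumes "\<And>n. g' (n + e) \<le> g (n + e) - (g n :: int)" and "\<And>m n. m \<le> n \<Longrightarrow> g m \<le> g n" and "\<And>n. 0 \<le> g n"
  shows "(\<Sum>j<n. g' (j + e)) \<le> int e * g (n + e)"
proof -
  have "(\<Sum>j<n. g' (j + e)) + (\<Sum>j<e. g j) \<le> (\<Sum>j<e. g (j + n))"
  proof (induction n)
    case (Suc n)
    have "(\<Sum>j<e. g (j + Suc n)) + g n = (\<Sum>j<Suc e. g (j + n))"
      by (subst sum.lessThan_Suc_shift) simp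
    then have "(\<Sum>j<e. g (j + Suc n)) + g n = (\<Sum>j<e. g (j + n)) + g (e + n)" by simp
    then show ?case using Suc assms(1)[of n] by (simp add: add.commute)
  qed simp
  moreover have "0 \<le> (\<Sum>j<e. g j)" by (intro sum_nonneg assms)
  moreover have "(\<Sum>j<e. g (j + n)) \<le> (\<Sum>j<e. g (n + e))" by (intro sum_mono assms(2)) simp
  ultimately show ?thesis by simp
qed

text \<open>Each of the \<open>n\<close> degrees following \<open>n\<close> contributes at least
  \<open>cdim p' n\<close> to a sum that telescopes to boundedly many values of
  \<open>cdim p\<close>. This is the loss of one power of \<open>n\<close>.\<close>

lemma cdim_less:
  assumes p: "sprime p" and p': "sideal p'" "p \<subset> p'"
  shows "\<exists>e. \<forall>n. int n * cdim p' n \<le> int e * cdim p (2 * n + e)"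
proof -
  obtain x where x: "x \<in> p'" "x \<notin> p" using p' by blast
  define e where "e = Suc (maxdeg x)"
  have "int n * cdim p' n \<le> int e * cdim p (2 * n + e)" for n
  proof -
    have "int n * cdim p' n = (\<Sum>j\<in>{n..<2*n}. cdim p' n)" by simp
    also have "\<dots> \<le> (\<Sum>j\<in>{n..<2*n}. cdim p' (j + e))"
      by (intro sum_mono cdim_mono[OF p'(1)]) simp
    also have "\<dots> \<le> (\<Sum>j<2*n. cdim p' (j + e))"
      by (rule sum_mono2) (auto simp: cdim_nonneg)
    also have "\<dots> \<le> int e * cdim p (2 * n + e)"
    proof (rule sum_cdim[where g = "cdim p" and g' = "cdim p'" and e = e])
      show "cdim p' (m + e) \<le> cdim p (m + e) - cdim p m" for m
        unfolding e_def by (rule cdim_step[OF p p'(1) _ x mem_upart]) (use p'(2) in blast)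
    qed (rule cdim_mono[OF sprimeD(1)[OF p]] cdim_nonneg, assumption?)+
    finally show ?thesis .
  qed
  then show ?thesis by blast
qed

definition growth :: "nat \<Rightarrow> 'k::field poly3 set \<Rightarrow> bool" where
  "growth k p \<longleftrightarrow> (\<exists>c. \<forall>n\<ge>1. cdim p n \<le> c * int n ^ k)"

lemma growth_3: "growth 3 (p :: 'k::field poly3 set)"
proof -
  have "cdim p n \<le> 1 * int n ^ 3" for n
  proof -
    let ?M = "{m :: 3 \<Rightarrow>\<^sub>0 nat. mdeg m < n}"
    have "?M \<subseteq> {m. mdeg m \<le> n}" by auto
    then have fin: "finite ?M" using finite_mdeg finite_subset by blast
    have "(upart n :: 'k poly3 set) \<subseteq> poly3.span ((\<lambda>m. mon m 1) ` ?M)"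
      unfolding upart_def by (intro subsetI span_mon) auto
    then have "poly3.dim (upart n :: 'k poly3 set) \<le> card ((\<lambda>m. mon m (1 :: 'k)) ` ?M)"
      by (rule poly3.dim_le_card) (simp add: fin)
    also have "\<dots> \<le> card ?M" using fin by (rule card_image_le)
    also have "card ?M = card (Poly_Mapping.lookup ` ?M)"
      by (rule card_image[symmetric]) (auto simp: inj_on_def poly_mapping_eqI)
    also have "\<dots> \<le> card ((\<Pi>\<^sub>E i\<in>(UNIV :: 3 set). {..<n}))"
    proof (rule card_mono)
      show "finite (\<Pi>\<^sub>E i\<in>(UNIV :: 3 set). {..<n})" by (rule finite_PiE) simp_all
      have "Poly_Mapping.lookup m i < n" if "m \<in> ?M" for m i
      proof -
        have "Poly_Mapping.lookup m i \<le> mdeg m" unfolding mdeg_def by (rule member_le_sum) auto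
        then show ?thesis using that by simp
      qed
      then show "Poly_Mapping.lookup ` ?M \<subseteq> (\<Pi>\<^sub>E i\<in>UNIV. {..<n})" by (auto simp: PiE_iff)
    qed
    also have "\<dots> = n ^ 3" by (simp add: card_PiE)
    finally have "int (poly3.dim (upart n :: 'k poly3 set)) \<le> int n ^ 3" by (metis of_nat_le_iff of_nat_power)
    then show ?thesis unfolding cdim_def by linarith
  qed
  then show ?thesis unfolding growth_def by blast
qed

lemma growth_bound:
  assumes "sprime p" "sideal p'" "p \<subset> p'" "growth k p"
  shows "\<exists>c. \<forall>n\<ge>1. int n * cdim p' n \<le> c * int n ^ k"
proof -
  obtain e where e: "\<And>n. int n * cdim p' n \<le> int e * cdim p (2 * n + e)" using cdim_less[OF assms(1-3)] by blast
  obtain c where c: "\<And>n. 1 \<le> n \<Longrightarrow> cdim p n \<le> c * int n ^ k" using assms(4) unfolding growth_def by blast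
  have "0 \<le> c" using c[of 1] cdim_nonneg[of p 1] by simp
  have "int n * cdim p' n \<le> int e * (c * int (2 + e) ^ k) * int n ^ k" if n: "1 \<le> n" for n
  proof -
    have "2 * n + e \<le> (2 + e) * n" using n by (simp add: algebra_simps)
    then have "int (2 * n + e) \<le> int (2 + e) * int n" by (metis of_nat_le_iff of_nat_mult)
    then have le: "int (2 * n + e) ^ k \<le> (int (2 + e) * int n) ^ k" by (rule power_mono) simp
    have "int n * cdim p' n \<le> int e * cdim p (2 * n + e)" by (rule e)
    also have "\<dots> \<le> int e * (c * int (2 * n + e) ^ k)" using c[of "2 * n + e"] n by (intro mult_left_mono) auto
    also have "\<dots> \<le> int e * (c * (int (2 + e) * int n) ^ k)" using le \<open>0 \<le> c\<close> by (intro mult_left_mono) auto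
    finally show ?thesis by (simp add: power_mult_distrib ac_simps)
  qed
  then show ?thesis by blast
qed

lemma growth_less:
  assumes "sprime p" "sideal p'" "p \<subset> p'" "growth (Suc k) p"
  shows "growth k p'"
proof -
  obtain c where c: "\<And>n. 1 \<le> n \<Longrightarrow> int n * cdim p' n \<le> c * int n ^ Suc k" using growth_bound[OF assms] by blast
  have "cdim p' n \<le> c * int n ^ k" if n: "1 \<le> n" for n
  proof -
    have "int n * cdim p' n \<le> int n * (c * int n ^ k)" using c[OF n] by (simp add: ac_simps)
    then show ?thesis using n by simp
  qed
  then show ?thesis unfolding growth_def by blast
qed

text \<open>If \<open>cdim p\<close> is bounded and \<open>p'\<close> is strictly larger, then
  \<open>n * cdim p' n\<close> is bounded; but \<open>cdim p' n\<close> is at least 1, because the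
  unit is not in \<open>p'\<close>.\<close>

lemma growth_0_maximal:
  assumes "sprime p" "sprime p'" "growth 0 p"
  shows "\<not> p \<subset> p'"
proof
  assume "p \<subset> p'"
  then obtain c where c: "\<And>n. 1 \<le> n \<Longrightarrow> int n * cdim p' n \<le> c"
    using growth_bound[OF assms(1) sprimeD(1)[OF assms(2)] _ assms(3)] by auto
  define n where "n = nat (\<bar>c\<bar> + 1)"
  have n: "1 \<le> n" "c < int n" unfolding n_def by auto
  have one: "1 \<in> (upart n :: 'a poly3 set)" using n(1) unfolding upart_def by (simp add: mdeg_def)
  have "p' \<inter> upart n \<subset> upart n" using one sprimeD(2)[OF assms(2)] by blast
  then have "poly3.dim (p' \<inter> upart n) < poly3.dim (upart n :: 'a poly3 set)"
    using sideal_subspace[OF sprimeD(1)[OF assms(2)]]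
    by (intro poly3.dim_psubset_fin_dim poly3.subspace_inter subspace_upart fin_dim_upart)
  then have "1 \<le> cdim p' n" unfolding cdim_def by simp
  then have "int n \<le> int n * cdim p' n" using mult_left_mono[of 1 "cdim p' n" "int n"] by simp
  then show False using c[OF n(1)] n(2) by simp
qed

text \<open>The growth exponent is at most 3 at the start of the chain, drops with every inclusion,
  and admits no further inclusion at 0.\<close>

lemma sprime_chain:
  fixes p :: "nat \<Rightarrow> 'k::field poly3 set"
  assumes prime: "\<And>i. i \<le> n \<Longrightarrow> sprime (p i)" and less: "\<And>i. i < n \<Longrightarrow> p i \<subset> p (Suc i)"
  shows "n \<le> 3"
proof (rule ccontr)
  assume "\<not> n \<le> 3"
  then have n: "4 \<le> n" by simp
  have "growth (3 - i) (p i)" if "i \<le> 3" for i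
    using that
  proof (induction i)
    case 0
    show ?case using growth_3 by simp
  next
    case (Suc i)
    then have "growth (3 - i) (p i)" by simp
    moreover have eq: "3 - i = Suc (3 - Suc i)" using Suc.prems by simp
    ultimately have "growth (Suc (3 - Suc i)) (p i)" by (simp only: eq)
    then show ?case
      by (rule growth_less[rotated -1]) (use prime[of i] prime[of "Suc i"] less[of i] sprimeD(1) Suc.prems n in auto)
  qed
  from this[of 3] have "growth 0 (p 3)" by simp
  then show False using growth_0_maximal[of "p 3" "p (Suc 3)"] prime[of 3] prime[of "Suc 3"] less[of 3] n by simp
qed

section \<open>Bounds for the dimension of the coordinate ring\<close>

context plane_curve
begin

lemma krull_dim_le: "krull_dim CR \<le> enat 3"
  unfolding krull_dim_def
proof (rule Sup_least)
  fix z assume "z \<in> {enat n |n P. (\<forall>i\<le>n. primeideal (P i) CR) \<and> (\<forall>i<n. P i \<subset> P (Suc i))}"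
  then obtain n P where z: "z = enat n" and P: "\<And>i. i \<le> n \<Longrightarrow> primeideal (P i) CR" "\<And>i. i < n \<Longrightarrow> P i \<subset> P (Suc i)"
    by auto
  have "n \<le> 3"
  proof (rule sprime_chain)
    show "sprime {s. cproj F s \<in> P i}" if "i \<le> n" for i using C.sprime_pull[OF P(1)[OF that]] .
    show "{s. cproj F s \<in> P i} \<subset> {s. cproj F s \<in> P (Suc i)}" if "i < n" for i
    proof -
      have "ideal (P i) CR" "ideal (P (Suc i)) CR"
        using P(1)[of i] P(1)[of "Suc i"] that by (simp_all add: primeideal.axioms(1))
      then have "{s. cproj F s \<in> P i} \<noteq> {s. cproj F s \<in> P (Suc i)}"
        using C.ideal_eq_image[of "P i"] C.ideal_eq_image[of "P (Suc i)"] P(2)[OF that] by auto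
      then show ?thesis using P(2)[OF that] by blast
    qed
  qed
  then show "z \<le> enat 3" unfolding z by simp
qed

text \<open>The line \<open>l2 = 0\<close> joins \<open>p\<close> to the \<open>i1\<close>-th
  coordinate point. On it \<open>F\<close> is a polynomial in \<open>t\<close> with coefficient
  \<open>F(p)\<close> at \<open>t^d\<close>, so it has positive degree and a root.\<close>

lemma point_on_curve:
  assumes inf: "infinite (UNIV :: 'k set)" and alg: "\<And>q :: 'k poly. 0 < degree q \<Longrightarrow> \<exists>t. poly q t = 0"
  obtains Q where "ev (\<lambda>c. c) Q F = 0" "ev (\<lambda>c. c) Q l2 = 0" "\<exists>i. Q i \<noteq> 0"
proof -
  define e where "e i = (if i = i1 then 1 else 0 :: 'k)" for i
  have ev_line: "poly (ev (\<lambda>c. [:c:]) (\<lambda>i. [:u i, v i:]) f) t = ev (\<lambda>c. c) (\<lambda>i. u i + t * v i) f" for u v f t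
    by (rule rhom_agree[OF rhom_comp[OF rhom_ev[OF rhom_pconst] rhom_poly] rhom_ev[OF rhom_id]])
      (simp_all add: ev_cst[OF rhom_pconst] ev_var[OF rhom_pconst] ev_cst[OF rhom_id] ev_var[OF rhom_id])
  have "\<exists>t. ev (\<lambda>c. c) (\<lambda>i. e i + t * p i) F = 0"
  proof (rule ccontr)
    assume no: "\<not> ?thesis"
    define q where "q = ev (\<lambda>c. [:c:]) (\<lambda>i. [:e i, p i:]) F"
    have "degree q = 0" using alg[of q] no ev_line[of e p F] unfolding q_def by fastforce
    then obtain \<kappa> where \<kappa>: "q = [:\<kappa>:]" by (rule degree_eq_zeroE)
    \<comment> \<open>The leading coefficient is reached by reversal: if \<open>q\<close> were the
      constant \<open>\<kappa>\<close>, homogeneity would give the value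
      \<open>\<kappa> * s^d\<close> at \<open>p + s e\<close>, and \<open>s = 0\<close> would make
      \<open>F\<close> vanish at \<open>p\<close>.\<close>
    define r where "r = ev (\<lambda>c. [:c:]) (\<lambda>i. [:p i, e i:]) F - Polynomial.monom \<kappa> d"
    have "poly r s = 0" if "s \<noteq> 0" for s
    proof -
      have "ev (\<lambda>c. c) (\<lambda>i. p i + s * e i) F = ev (\<lambda>c. c) (\<lambda>i. s * (e i + inverse s * p i)) F"
        using that by (intro arg_cong[where f = "\<lambda>u. ev (\<lambda>c. c) u F"]) (auto simp: field_simps)
      also have "\<dots> = s ^ d * poly q (inverse s)" unfolding q_def ev_line by (rule ev_scale[OF F_hom])
      finally show ?thesis unfolding r_def \<kappa> by (simp add: ev_line poly_monom)
    qed
    then have "UNIV - {0} \<subseteq> {s. poly r s = 0}" by blast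
    moreover have "infinite (UNIV - {0 :: 'k})" using inf by simp
    ultimately have "r = 0" using poly_roots_finite[of r] finite_subset by blast
    then have "poly r 0 = 0" by simp
    then show False unfolding r_def using F_p d_pos by (simp add: ev_line poly_monom)
  qed
  then obtain t where t: "ev (\<lambda>c. c) (\<lambda>i. e i + t * p i) F = 0" by blast
  have "ev (\<lambda>c. c) (\<lambda>i. e i + t * p i) l2 = 0"
    unfolding l2_def using i_neq
    by (simp add: rhomD[OF rhom_ev[OF rhom_id]] ev_cst[OF rhom_id] ev_var[OF rhom_id] e_def p_i0)
  moreover have "\<exists>i. e i + t * p i \<noteq> 0"
  proof (cases "t = 0")
    case True
    then show ?thesis by (intro exI[of _ i1]) (simp add: e_def)
  next
    case False
    then show ?thesis using i_neq by (intro exI[of _ i0]) (simp add: e_def p_i0)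
  qed
  ultimately show ?thesis using that t by blast
qed

text \<open>The chain consists of the zero ideal, the homogeneous ideal of a point \<open>Q\<close>
  of the curve on the line \<open>l2 = 0\<close>, and the irrelevant ideal. Here \<open>h\<close>
  restricts to the line spanned by \<open>Q\<close> and \<open>h0\<close> to the origin;
  \<open>l2\<close> and a variable nonzero at \<open>Q\<close> make the inclusions strict.\<close>

lemma krull_dim_ge:
  assumes inf: "infinite (UNIV :: 'k set)" and alg: "\<And>q :: 'k poly. 0 < degree q \<Longrightarrow> \<exists>t. poly q t = 0"
  shows "enat 2 \<le> krull_dim CR"
proof -
  obtain Q where Q: "ev (\<lambda>c. c) Q F = 0" "ev (\<lambda>c. c) Q l2 = 0" and "\<exists>i. Q i \<noteq> 0"
    using point_on_curve[OF inf alg] by blast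
  then obtain j where j: "Q j \<noteq> 0" by blast
  define h where "h = ev (\<lambda>c :: 'k. [:c:]) (\<lambda>i. [:0, 1:] * [:Q i:])"
  have h: "rhom h" unfolding h_def by (rule rhom_ev[OF rhom_pconst])
  define h0 where "h0 = ev (\<lambda>c :: 'k. c) (\<lambda>i. 0)"
  have h0: "rhom h0" unfolding h0_def by (rule rhom_ev[OF rhom_id])
  have h_hom: "h f = [:0, 1:] ^ e * [:ev (\<lambda>c. c) Q f:]" if "homogeneous e f" for e f
  proof -
    have "ev (\<lambda>c. [:c:]) (\<lambda>i. [:Q i:]) g = [:ev (\<lambda>c. c) Q g:]" for g
      by (rule rhom_agree[OF rhom_ev[OF rhom_pconst] rhom_comp[OF rhom_ev[OF rhom_id] rhom_pconst]])
        (simp_all add: ev_cst[OF rhom_pconst] ev_var[OF rhom_pconst] ev_cst[OF rhom_id] ev_var[OF rhom_id])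
    then show ?thesis unfolding h_def ev_scale[OF that] by simp
  qed
  have h_0: "poly (h f) 0 = h0 f" for f
    unfolding h_def h0_def
    by (rule rhom_agree[OF rhom_comp[OF rhom_ev[OF rhom_pconst] rhom_poly] rhom_ev[OF rhom_id]])
      (simp_all add: ev_cst[OF rhom_pconst] ev_var[OF rhom_pconst] ev_cst[OF rhom_id] ev_var[OF rhom_id])
  define P :: "nat \<Rightarrow> 'k poly3 set" where
    "P i = (if i = 0 then NF else if i = 1 then {f. h f = 0} else {f. h0 f = 0})" for i
  have "h F = 0" using h_hom[OF F_hom] Q by simp
  then have NP1: "NF \<subseteq> {f. h f = 0}" unfolding NF_def by (auto simp: rhomD[OF h] elim!: dvdE)
  have P12: "{f. h f = 0} \<subseteq> {f. h0 f = 0}"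
  proof (intro subsetI CollectI)
    fix f assume "f \<in> {f. h f = 0}"
    then show "h0 f = 0" using h_0[of f] by simp
  qed
  have "h l2 = 0" using h_hom[OF l_hom(2)] Q by simp
  moreover have "l2 \<notin> NF" unfolding NF_def using F_not_dvd_linear[OF \<theta>_l(2) l_hom(2) l_nonzero(2)] by simp
  ultimately have less1: "NF \<subset> {f. h f = 0}" using NP1 by blast
  have "h0 (var j) = 0" unfolding h0_def ev_var[OF rhom_id] ..
  moreover have "h (var j) \<noteq> 0" unfolding h_def ev_var[OF rhom_pconst] using j by simp
  ultimately have less2: "{f. h f = 0} \<subset> {f. h0 f = 0}" using P12 by blast
  have "sprime NF"
    unfolding sprime_def using gradedD(1)[OF graded_NF] F_not_unit prime_elem_dvd_multD[OF F_prime]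
    by (auto simp: NF_def)
  then have prime: "sprime (P i)" for i
    unfolding P_def using sprime_kernel[OF h] sprime_kernel[OF h0] by simp
  have NP: "NF \<subseteq> P i" for i unfolding P_def using NP1 P12 by auto
  have less: "P i \<subset> P (Suc i)" if "i < 2" for i
    using that less1 less2 unfolding P_def by (cases "i = 0") auto
  have "primeideal (cproj F ` P i) CR" for i by (rule C.primeideal_image[OF prime NP])
  moreover have "cproj F ` P i \<subset> cproj F ` P (Suc i)" if "i < 2" for i
  proof -
    obtain f where f: "f \<in> P (Suc i)" "f \<notin> P i" using less[OF \<open>i < 2\<close>] by blast
    then have "cproj F f \<in> cproj F ` P (Suc i)" "cproj F f \<notin> cproj F ` P i"
      using C.mem_image[OF sprimeD(1)[OF prime] NP] by simp_all
    moreover have "cproj F ` P i \<subseteq> cproj F ` P (Suc i)" using less[OF that] by (intro image_mono) blast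
    ultimately show ?thesis by blast
  qed
  ultimately show ?thesis unfolding krull_dim_def
    by (intro Sup_upper CollectI exI[of _ 2] exI[of _ "\<lambda>i. cproj F ` P i"]) simp
qed

end

theorem theorem6p7:
  fixes F :: "'k::alg_closed_field poly3" and p :: nat and I :: "'k poly3 set set"
  assumes "Factorial_Ring.prime p" and "CHAR('k) = p"
    and "irreducible_plane_curve F"
    and "graded_ideal (coord_ring F) (coord_grading F) I"
    and "\<exists>a \<in> carrier (coord_ring F). \<exists>b \<in> carrier (coord_ring F). I = Idl\<^bsub>coord_ring F\<^esub> {a, b}"
  shows "e_gHK (coord_ring F) (irrelevant_ideal (coord_ring F) (coord_grading F)) p I \<in> ereal ` \<rat>"
proof -
  obtain d where F: "homogeneous d F" "Factorial_Ring.irreducible F"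
    using assms(3) unfolding irreducible_plane_curve_def by blast
  obtain t i0 i1 i2 where "plane_curve F d t i0 i1 i2"
    by (rule plane_curve_exists[OF infinite_alg_closed F])
  then interpret plane_curve F d t i0 i1 i2 .
  obtain L l where L: "L \<in> \<rat>"
    and l: "\<forall>n. f_gHK CR (irrelevant_ideal CR (coord_grading F)) p I n = enat (l n)"
    and lim: "(\<lambda>n. real (l n) / (real (p ^ n))\<^sup>2) \<longlonglongrightarrow> L"
    using f_gHK_asymptotics[OF assms(1,2,4,5)] by (elim bexE exE conjE)
  have "enat 2 \<le> krull_dim CR" by (rule krull_dim_ge[OF infinite_alg_closed alg_closed_imp_poly_has_root])
  \<comment> \<open>For \<open>D = 2\<close> the limit is \<open>L\<close>; for larger
    \<open>D\<close> the additional power of \<open>p\<close> in the denominator drives it to 0.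
    Both values are rational.\<close>
  then obtain D where D: "krull_dim CR = enat D" "2 \<le> D" using krull_dim_le by (cases "krull_dim CR") auto
  have p1: "1 < real p" using prime_gt_1_nat[OF assms(1)] by simp
  define s where "s n = real (l n) / real p ^ (n * D)" for n
  have s: "s n = real (l n) / (real (p ^ n))\<^sup>2 * (1 / real p ^ (D - 2)) ^ n" for n
  proof -
    have "n * D = n * 2 + (D - 2) * n" using D(2) by (metis add.commute distrib_left le_add_diff_inverse2 mult.commute)
    moreover have "(real p ^ (D - 2)) ^ n = real p ^ ((D - 2) * n)" "(real (p ^ n))\<^sup>2 = real p ^ (n * 2)"
      by (simp_all add: power_mult)
    ultimately show ?thesis unfolding s_def power_one_over by (simp add: power_add)
  qed
  have "\<exists>M\<in>\<rat>. s \<longlonglongrightarrow> M"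
  proof (cases "D = 2")
    case True
    then show ?thesis using lim L unfolding s[abs_def] by (intro bexI[of _ L]) simp_all
  next
    case False
    then have "1 < real p ^ (D - 2)" using p1 D(2) by (intro one_less_power) auto
    then have "(\<lambda>n. (1 / real p ^ (D - 2)) ^ n) \<longlonglongrightarrow> 0"
      using p1 by (intro LIMSEQ_realpow_zero) (auto simp: divide_less_eq_1)
    from tendsto_mult[OF lim this] show ?thesis unfolding s[abs_def] by (intro bexI[of _ 0]) simp_all
  qed
  then obtain M where M: "M \<in> \<rat>" "s \<longlonglongrightarrow> M" by blast
  \<comment> \<open>All lengths are finite, so the quotients are real and \<open>e_gHK\<close> takes
    its convergent branch.\<close>
  have "(\<lambda>n. ereal_of_enat (f_gHK CR (irrelevant_ideal CR (coord_grading F)) p I n) / ereal (real p ^ (n * the_enat (krull_dim CR))))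
      = (\<lambda>n. ereal (s n))"
    using l p1 unfolding s_def D(1) by (simp add: fun_eq_iff)
  moreover have M': "(\<lambda>n. ereal (s n)) \<longlonglongrightarrow> ereal M" using M(2) by simp
  ultimately have "e_gHK CR (irrelevant_ideal CR (coord_grading F)) p I = ereal M"
    unfolding e_gHK_def Let_def using convergentI[OF M'] limI[OF M'] by simp
  then show ?thesis using M(1) by simp
qed

end
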